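(* Let $M$ be a JBW$^*$-triple with predual $M_*$ and let $A\subset M_*$ be a bounded set. Then $$\omega(A)=\mathrm{wk}_{M_*}(A)=\mathrm{wck}_{M_*}(A).$$
   Context: For a Banach space $X$ and nonempty sets $A,B\subset X$, put $\widehat{d}(A,B)=\sup\{\operatorname{dist}(a,B): a\in A\}$. For a bounded set $A\subset X$, define: - the De Blasi measure $\omega(A)=\inf\{\widehat{d}(A,K): K\subset X \text{ weakly compact}\}$; - $\mathrm{wk}_X(A)=\widehat{d}(\overline{A}^{w^*},X)$, where $\overline{A}^{w^*}$ is the weak$^*$ closure of $A$ in $X^{**}$ and $X$ is canonically embedded in $X^{**}$; - $\mathrm{wck}_X(A)=\sup\{\operatorname{dist}(\operatorname{clust}_{w^*}(x_n),X): (x_n) \text{ a sequence in } A\}$, where $\operatorname{clust}_{w^*}(x_n)\subset X^{**}$ is the set of weak$^*$ cluster points of $(x_n)$ and $\operatorname{dist}(S,X)=\inf_{s\in S}\operatorname{dist}(s,X)$. A JB$^*$-triple is a complex Banach space $E$ with a continuous triple product $\{\cdot,\cdot,\cdot\}:E^3\to E$ that is symmetric and bilinear in the outer variables and conjugate-linear in the middle one, satisfying the Jordan identity $L(x,y)L(a,b)=L(L(x,y)a,b)-L(a,L(y,x)b)+L(a,b)L(x,y)$, where $L(a,b)x=\{a,b,x\}$; each $L(a,a)$ is hermitian with nonnegative spectrum; and $\|\{a,a,a\}\|=\|a\|^3$. A JBW$^*$-triple is a JB$^*$-triple that is a dual Banach space. It has a unique isometric predual $M_*$, and its triple product is separately weak$^*$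 continuous. *)

theory Defs
  imports "HOL-Analysis.Analysis"
begin

text \<open>A complex Banach space is encoded as a real Banach space together with the
  real-linear operator J (multiplication by the imaginary unit).\<close>

definition cscale :: "('a::real_vector \<Rightarrow> 'a) \<Rightarrow> complex \<Rightarrow> 'a \<Rightarrow> 'a" where
  "cscale J c x = Re c *\<^sub>R x + Im c *\<^sub>R J x"

definition complex_structure :: "('a::real_normed_vector \<Rightarrow> 'a) \<Rightarrow> bool" where
  "complex_structure J \<longleftrightarrow> linear J \<and> (\<forall>x. J (J x) = - x)
     \<and> (\<forall>c x. norm (cscale J c x) = cmod c * norm x)"

definition bpow :: "('a::real_normed_vector \<Rightarrow>\<^sub>L 'a) \<Rightarrow> nat \<Rightarrow> ('a \<Rightarrow>\<^sub>L 'a)" where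
  "bpow S n = ((\<lambda>R. S o\<^sub>L R) ^^ n) id_blinfun"

definition bexp :: "('a::banach \<Rightarrow>\<^sub>L 'a) \<Rightarrow> ('a \<Rightarrow>\<^sub>L 'a)" where
  "bexp S = (\<Sum>n. (1 / fact n) *\<^sub>R bpow S n)"

definition hermitian :: "('a::banach \<Rightarrow> 'a) \<Rightarrow> ('a \<Rightarrow> 'a) \<Rightarrow> bool" where
  "hermitian J S \<longleftrightarrow> bounded_linear S \<and>
     (\<forall>t::real. norm (bexp (t *\<^sub>R (Blinfun J o\<^sub>L Blinfun S))) = 1)"

text \<open>Spectrum of a bounded complex-linear operator (bijectivity of S - c I is
  equivalent to invertibility in the algebra of bounded operators, by the open mapping theorem).\<close>
definition cspectrum :: "('a::real_vector \<Rightarrow> 'a) \<Rightarrow> ('a \<Rightarrow> 'a) \<Rightarrow> complex set" where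
  "cspectrum J S = {c. \<not> bij (\<lambda>x. S x - cscale J c x)}"

definition JB_triple :: "('a::banach \<Rightarrow> 'a) \<Rightarrow> ('a \<Rightarrow> 'a \<Rightarrow> 'a \<Rightarrow> 'a) \<Rightarrow> bool" where
  "JB_triple J tp \<longleftrightarrow>
     complex_structure J
   \<and> continuous_on UNIV (\<lambda>(x, y, z). tp x y z)
   \<and> (\<forall>x y z. tp x y z = tp z y x)
   \<and> (\<forall>x x' y z. tp (x + x') y z = tp x y z + tp x' y z)
   \<and> (\<forall>c x y z. tp (cscale J c x) y z = cscale J c (tp x y z))
   \<and> (\<forall>x y y' z. tp x (y + y') z = tp x y z + tp x y' z)
   \<and> (\<forall>c x y z. tp x (cscale J c y) z = cscale J (cnj c) (tp x y z))
   \<and> (\<forall>x y a b z. tp x y (tp a b z) =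
        tp (tp x y a) b z - tp a (tp y x b) z + tp a b (tp x y z))
   \<and> (\<forall>a. hermitian J (tp a a)
          \<and> cspectrum J (tp a a) \<subseteq> {c. Im c = 0 \<and> Re c \<ge> 0})
   \<and> (\<forall>a. norm (tp a a a) = norm a ^ 3)"

text \<open>M (with complex structure Jm) is isometrically (complex-)isomorphic to the dual of
  the complex Banach space P (with complex structure Jp).  The complex dual of P is
  identified with the real dual via f \<mapsto> Re f; under this identification
  multiplication by i on the dual becomes g \<mapsto> g \<circ> Jp.\<close>
definition predual_iso ::
  "('m::banach \<Rightarrow> 'm) \<Rightarrow> ('p::banach \<Rightarrow> 'p) \<Rightarrow> ('m \<Rightarrow> ('p \<Rightarrow>\<^sub>L real)) \<Rightarrow> bool" where
  "predual_iso Jm Jp T \<longleftrightarrow> linear T \<and> bij T \<and> (\<forall>m. norm (T m) = norm m)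
     \<and> (\<forall>m p. blinfun_apply (T (Jm m)) p = blinfun_apply (T m) (Jp p))"

definition JBW_triple_with_predual ::
  "('m::banach \<Rightarrow> 'm) \<Rightarrow> ('m \<Rightarrow> 'm \<Rightarrow> 'm \<Rightarrow> 'm) \<Rightarrow> ('p::banach \<Rightarrow> 'p)
     \<Rightarrow> ('m \<Rightarrow> ('p \<Rightarrow>\<^sub>L real)) \<Rightarrow> bool" where
  "JBW_triple_with_predual Jm tp Jp T \<longleftrightarrow>
     JB_triple Jm tp \<and> complex_structure Jp \<and> predual_iso Jm Jp T"

definition weak_top :: "'a::real_normed_vector topology" where
  "weak_top = topology_generated_by
     {(blinfun_apply f) -` U | (f :: 'a \<Rightarrow>\<^sub>L real) U. open U}"

definition canon :: "'a::real_normed_vector \<Rightarrow> (('a \<Rightarrow>\<^sub>L real) \<Rightarrow>\<^sub>L real)" where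
  "canon x = Blinfun (\<lambda>f. blinfun_apply f x)"

definition weakstar_bidual :: "(('a::real_normed_vector \<Rightarrow>\<^sub>L real) \<Rightarrow>\<^sub>L real) topology" where
  "weakstar_bidual = topology_generated_by
     {(\<lambda>z. blinfun_apply z f) -` U | f U. open U}"

definition dhat :: "'a::metric_space set \<Rightarrow> 'a set \<Rightarrow> real" where
  "dhat A B = (SUP a\<in>A. infdist a B)"

definition deBlasi :: "'a::real_normed_vector set \<Rightarrow> real" where
  "deBlasi A = Inf {dhat A K | K. K \<noteq> {} \<and> compactin weak_top K}"

definition wk_meas :: "'a::real_normed_vector set \<Rightarrow> real" where
  "wk_meas A = dhat (weakstar_bidual closure_of (canon ` A)) (range canon)"

definition clust_wstar :: "(nat \<Rightarrow> 'a::real_normed_vector) \<Rightarrow> (('a \<Rightarrow>\<^sub>L real) \<Rightarrow>\<^sub>L real) set" where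
  "clust_wstar x = {z. \<forall>U. openin weakstar_bidual U \<and> z \<in> U \<longrightarrow>
                       (\<forall>N. \<exists>n\<ge>N. canon (x n) \<in> U)}"

definition wck_meas :: "'a::real_normed_vector set \<Rightarrow> real" where
  "wck_meas A = (SUP x\<in>{x. range x \<subseteq> A}. (INF z\<in>clust_wstar x. infdist z (range canon)))"

end

theory Submission
  imports Defs "HOL-Complex_Analysis.Complex_Analysis"
begin

text \<open>Only the inequality deBlasi A \<le> wck_meas A is specific to JBW*-triples.  Functionals are
  real-linear throughout, and L = L(z,z), Q(z) b = {z,b,z}.

  Norming functionals.  If l norms z, then (a, b) \<mapsto> l {a,b,z} is a positive form, because the
  operators L(a,a) have positive numerical range.  Together with the derivative of the cubing map at
  z and the identity norm {z,z,z} = (norm z)^3 this yields l \<circ> L = l = l \<circ> Q(z).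
  For functionals in the predual it follows that the triple product is separately weak-star
  continuous, since an operator with vanishing numerical range is zero.  The Cesaro means of the odd
  powers of z then cluster at a tripotent v on which l still attains its norm.

  A bad sequence.  Let c < deBlasi A.  Given finitely many \<psi> j in A, maximizing a functional of A
  minus a quadratic penalty gives some new \<psi> in A and a tripotent v with v(\<psi>) \<ge> c that is almost
  orthogonal to the supports of the \<psi> j, so that the \<psi> j are almost fixed by the Peirce projection
  P0(v).  From the resulting tripotents v n one builds y k in the unit ball with
  |\<psi> n (y k)| \<ge> c - 2 \<epsilon> for all n > k, whose weak-star limits lie in the inner ideal
  N = {a. \<psi> n {a,b,d} = 0 for all n, b, d}.  For \<rho> in the predual, let f be a tripotent supporting the restriction of
  \<rho> to N.  Then P0(f) fixes all \<psi> n while \<rho> \<circ> P0(f) vanishes on N, so testing a cluster point z of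
  (\<psi> n) against P0(f) (y k) shows that z - \<rho> has norm at least c - 2 \<epsilon>.\<close>

section \<open>The Hahn-Banach theorem\<close>

text \<open>The axioms supply little directly: spectra instead of positivity, a continuous product
  instead of norm estimates, a predual without any continuity. Three devices make up for this.
  Exponentials exp (- w L) are replaced by powers of Euler steps 1 - w L / n, polynomials in w to
  which Cauchy's inequality and the maximum principle apply; they turn spectral information into
  numerical ranges. A map that commutes with cubing and is bounded by some constant is contractive,
  because n-fold cubing raises norms to the power 3^n; this yields the sharp norm bounds, in
  particular those of powers and of Peirce projections. Finally, the Bishop-Phelps-Bollobas theorem
  replaces pairs that almost norm each other by pairs that do so exactly, for which the identities
  of norming functionals hold. Orthogonality in the inductive construction is only approximate; its
  errors are weighted by (1/2) ^ n, and two successive weak-star limits are taken to reach an inner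
  ideal in which an exact argument is possible.\<close>

definition sublinear :: "('a::real_vector \<Rightarrow> real) \<Rightarrow> bool" where
  "sublinear q \<longleftrightarrow> (\<forall>x y. q (x + y) \<le> q x + q y) \<and> (\<forall>t\<ge>0. \<forall>x. q (t *\<^sub>R x) = t * q x)"

lemma sublinear_add: "sublinear q \<Longrightarrow> q (x + y) \<le> q x + q y"
  and sublinear_scale: "sublinear q \<Longrightarrow> t \<ge> 0 \<Longrightarrow> q (t *\<^sub>R x) = t * q x"
  by (simp_all add: sublinear_def)

lemma sublinear_zero: "sublinear q \<Longrightarrow> q 0 = 0"
  using sublinear_scale[of q 0 0] by simp

lemma sublinear_minus: "sublinear q \<Longrightarrow> - q (- x) \<le> q x"
  using sublinear_add[of q x "-x"] sublinear_zero[of q] by simp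

lemma sublinearI:
  assumes add: "\<And>x y. q (x + y) \<le> q x + q y" and zero: "q 0 = 0"
    and scale: "\<And>s x. s > 0 \<Longrightarrow> q (s *\<^sub>R x) \<le> s * q x"
  shows "sublinear q"
  unfolding sublinear_def
proof (intro conjI allI impI)
  fix t :: real and x assume "t \<ge> 0"
  show "q (t *\<^sub>R x) = t * q x"
  proof (cases "t = 0")
    case False
    with \<open>t \<ge> 0\<close> have t: "t > 0" by simp
    have "q x = q ((1/t) *\<^sub>R (t *\<^sub>R x))" using t by simp
    also have "\<dots> \<le> (1/t) * q (t *\<^sub>R x)" using scale[of "1/t" "t *\<^sub>R x"] t by simp
    finally show ?thesis using scale[OF t, of x] t by (simp add: field_simps)
  qed (use zero in simp)
qed (rule add)

lemma sublinear_norm_scaled: "c \<ge> 0 \<Longrightarrow> sublinear (\<lambda>x. c * norm x)"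
  by (rule sublinearI) (auto simp: distrib_left[symmetric] norm_triangle_ineq mult_left_mono)

definition convex_cone0 :: "'a::real_vector set \<Rightarrow> bool" where
  "convex_cone0 C \<longleftrightarrow> 0 \<in> C \<and> (\<forall>x\<in>C. \<forall>y\<in>C. x + y \<in> C) \<and> (\<forall>t\<ge>0. \<forall>x\<in>C. t *\<^sub>R x \<in> C)"

text \<open>Take the infimum over \<open>C\<close> of \<open>q (x + D u) - m u\<close>; the bound
  \<open>m u \<le> q (D u)\<close> keeps it finite. Linear functionals below \<open>p\<close> then
  satisfy \<open>m u \<le> g (D u)\<close> of their own accord, because
  \<open>p (- D u) \<le> - m u\<close>. The map \<open>D\<close> may fail to be injective, which
  matters when a functional is lifted along a derivative.\<close>

lemma sublinear_reduce:
  fixes q :: "'b::real_vector \<Rightarrow> real" and D :: "'a::real_vector \<Rightarrow> 'b"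
  assumes q: "sublinear q" and C: "convex_cone0 C" and D: "linear D" and m: "linear m"
    and le: "\<And>u. u \<in> C \<Longrightarrow> m u \<le> q (D u)"
  obtains p where "sublinear p" "\<And>x. p x \<le> q x" "\<And>x u. u \<in> C \<Longrightarrow> p x \<le> q (x + D u) - m u"
proof -
  define p where "p x = (INF u\<in>C. q (x + D u) - m u)" for x
  have z: "0 \<in> C" using C by (simp add: convex_cone0_def)
  have D0: "D 0 = 0" and m0: "m 0 = 0" using D m by (simp_all add: linear_0)
  have lb: "- q (- x) \<le> q (x + D u) - m u" if "u \<in> C" for x u
    using sublinear_add[OF q, of "x + D u" "- x"] le[OF that] by simp
  have bdd: "bdd_below ((\<lambda>u. q (x + D u) - m u) ` C)" for x
    using lb by (intro bdd_belowI2[where m = "- q (- x)"]) auto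
  have up: "p x \<le> q (x + D u) - m u" if "u \<in> C" for x u
    unfolding p_def by (rule cINF_lower[OF bdd that])
  have ge: "c \<le> p x" if "\<And>u. u \<in> C \<Longrightarrow> c \<le> q (x + D u) - m u" for c x
    unfolding p_def using z that by (intro cINF_greatest) auto
  have sub: "sublinear p"
  proof (rule sublinearI)
    fix x y
    have 1: "p (x + y) - (q (y + D v) - m v) \<le> p x" if v: "v \<in> C" for v
    proof (rule ge)
      fix u assume u: "u \<in> C"
      have "p (x + y) \<le> q (x + y + D (u + v)) - m (u + v)"
        using C u v by (intro up) (auto simp: convex_cone0_def)
      also have "\<dots> \<le> q (x + D u) + q (y + D v) - m u - m v"
        using sublinear_add[OF q, of "x + D u" "y + D v"]
        by (simp add: linear_add[OF D] linear_add[OF m] algebra_simps)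
      finally show "p (x + y) - (q (y + D v) - m v) \<le> q (x + D u) - m u" by simp
    qed
    have "p (x + y) - p x \<le> p y"
      by (rule ge) (use 1 in force)
    thus "p (x + y) \<le> p x + p y" by simp
  next
    have "0 \<le> p 0" by (rule ge) (use le in simp)
    moreover have "p 0 \<le> 0" using up[OF z, of 0] sublinear_zero[OF q] D0 m0 by simp
    ultimately show "p 0 = 0" by simp
  next
    fix s :: real and x assume s: "s > 0"
    have "p (s *\<^sub>R x) / s \<le> p x"
    proof (rule ge)
      fix u assume u: "u \<in> C"
      have "p (s *\<^sub>R x) \<le> q (s *\<^sub>R x + D (s *\<^sub>R u)) - m (s *\<^sub>R u)"
        using C u s by (intro up) (auto simp: convex_cone0_def)
      also have "\<dots> = s * (q (x + D u) - m u)"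
        using sublinear_scale[OF q, of s "x + D u"] s
        by (simp add: linear_scale[OF D] linear_scale[OF m] algebra_simps)
      finally show "p (s *\<^sub>R x) / s \<le> q (x + D u) - m u" using s by (simp add: field_simps)
    qed
    thus "p (s *\<^sub>R x) \<le> s * p x" using s by (simp add: field_simps)
  qed
  show ?thesis
    using that[OF sub _ up] up[OF z] D0 m0 by simp
qed

text \<open>Subadditivity of the pointwise infimum is where the chain enters: of two members the
  smaller one bounds both summands.\<close>

lemma sublinear_chain_lower_bound:
  fixes q :: "'a::real_vector \<Rightarrow> real"
  assumes ne: "C \<noteq> {}" and sub: "\<And>p. p \<in> C \<Longrightarrow> sublinear p \<and> p \<le> q"
    and chain: "\<And>p p'. p \<in> C \<Longrightarrow> p' \<in> C \<Longrightarrow> p \<le> p' \<or> p' \<le> p"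
  obtains r where "sublinear r" "\<And>p. p \<in> C \<Longrightarrow> r \<le> p"
proof -
  define r where "r x = (INF p\<in>C. p x)" for x
  have bdd: "bdd_below ((\<lambda>p. p x) ` C)" for x
  proof (rule bdd_belowI2[where m = "- q (- x)"])
    fix p assume "p \<in> C"
    with sub[OF this] sublinear_minus[of p x] show "- q (- x) \<le> p x"
      by (smt (verit) le_funD)
  qed
  have up: "r x \<le> p x" if "p \<in> C" for p x
    unfolding r_def by (rule cINF_lower[OF bdd that])
  have ge: "c \<le> r x" if "\<And>p. p \<in> C \<Longrightarrow> c \<le> p x" for c x
    unfolding r_def using ne that by (intro cINF_greatest) auto
  have "sublinear r"
  proof (rule sublinearI)
    fix x y
    have 1: "r (x + y) - p y \<le> r x" if p: "p \<in> C" for p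
    proof (rule ge)
      fix p' assume p': "p' \<in> C"
      obtain p0 where p0: "p0 \<in> C" "p0 \<le> p" "p0 \<le> p'" using chain[OF p p'] p p' by blast
      have "r (x + y) \<le> p0 (x + y)" by (rule up[OF p0(1)])
      also have "\<dots> \<le> p0 x + p0 y" using sub[OF p0(1)] sublinear_add by blast
      also have "\<dots> \<le> p' x + p y" using p0 by (intro add_mono) (auto simp: le_fun_def)
      finally show "r (x + y) - p y \<le> p' x" by simp
    qed
    have "r (x + y) - r x \<le> r y" by (rule ge) (use 1 in force)
    thus "r (x + y) \<le> r x + r y" by simp
  next
    have "p 0 = 0" if "p \<in> C" for p using sub[OF that] sublinear_zero by blast
    hence "(\<lambda>p. p 0) ` C = {0}" using ne by force
    thus "r 0 = 0" by (simp add: r_def)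
  next
    fix s :: real and x assume s: "s > 0"
    have "r (s *\<^sub>R x) / s \<le> r x"
    proof (rule ge)
      fix p assume p: "p \<in> C"
      have "r (s *\<^sub>R x) \<le> s * p x"
        using up[OF p, of "s *\<^sub>R x"] sub[OF p] sublinear_scale[of p s x] s by simp
      thus "r (s *\<^sub>R x) / s \<le> p x" using s by (simp add: field_simps)
    qed
    thus "r (s *\<^sub>R x) \<le> s * r x" using s by (simp add: field_simps)
  qed
  thus ?thesis using up that by (simp add: le_fun_def)
qed

lemma linear_below_sublinear:
  fixes q :: "'a::real_vector \<Rightarrow> real"
  assumes q: "sublinear q"
  obtains g where "linear g" "\<And>x. g x \<le> q x"
proof -
  define A where "A = {p. sublinear p \<and> p \<le> q}"
  let ?P = "\<lambda>a b :: 'a \<Rightarrow> real. b \<le> a"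
  have "\<exists>m\<in>A. \<forall>a\<in>A. ?P m a \<longrightarrow> a = m"
  proof (rule predicate_Zorn)
    show "partial_order_on A (relation_of ?P A)"
      by (rule partial_order_on_relation_ofI) auto
  next
    fix C assume C: "C \<in> Chains (relation_of ?P A)"
    show "\<exists>u\<in>A. \<forall>a\<in>C. ?P a u"
    proof (cases "C = {}")
      case True
      thus ?thesis using q by (auto simp: A_def)
    next
      case False
      have CA: "C \<subseteq> A" using C by (auto simp: Chains_def relation_of_def)
      have ch: "p \<le> p' \<or> p' \<le> p" if "p \<in> C" "p' \<in> C" for p p'
        using C that by (auto simp: Chains_def relation_of_def)
      obtain r where "sublinear r" "\<And>p. p \<in> C \<Longrightarrow> r \<le> p"
        using sublinear_chain_lower_bound[OF False, of q] CA ch unfolding A_def by blast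
      moreover have "r \<le> q" using False CA calculation(2) unfolding A_def by (blast intro: order_trans)
      ultimately show ?thesis by (auto simp: A_def)
    qed
  qed
  then obtain m where m: "sublinear m" "m \<le> q" and min: "\<And>a. sublinear a \<Longrightarrow> a \<le> m \<Longrightarrow> a = m"
    unfolding A_def by (blast intro: order_trans)
  have super: "m x + m y \<le> m (x + y)" for x y
  proof -
    have cone: "convex_cone0 {0::real..}" by (auto simp: convex_cone0_def)
    \<comment> \<open>Reducing the minimal \<open>m\<close> along the ray through \<open>y\<close>
      cannot make it smaller, so \<open>p = m\<close>, and the case t = 1 of the last property is
      superadditivity.\<close>
    obtain p where p: "sublinear p" "\<And>x. p x \<le> m x"
      "\<And>x t. t \<in> {0::real..} \<Longrightarrow> p x \<le> m (x + t *\<^sub>R y) - t * m y"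
      using sublinear_reduce[OF m(1) cone, of "\<lambda>t. t *\<^sub>R y" "\<lambda>t. t * m y"] m(1)
      by (auto simp: sublinear_scale linear_iff algebra_simps)
    have "p = m" using min[OF p(1)] p(2) by (simp add: le_fun_def)
    with p(3)[of 1 x] show ?thesis by simp
  qed
  have add: "m (x + y) = m x + m y" for x y
    using super sublinear_add[OF m(1)] by (simp add: order_antisym)
  have neg: "m (- x) = - m x" for x
    using add[of x "-x"] sublinear_zero[OF m(1)] by simp
  have "linear m"
  proof (rule linearI[OF add])
    fix c :: real and x
    show "m (c *\<^sub>R x) = c *\<^sub>R m x"
    proof (cases "c \<ge> 0")
      case False
      hence "m ((-c) *\<^sub>R x) = (-c) * m x" by (intro sublinear_scale[OF m(1)]) simp
      thus ?thesis using neg[of "c *\<^sub>R x"] by simp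
    qed (use sublinear_scale[OF m(1)] in simp)
  qed
  with that m(2) show ?thesis by (simp add: le_fun_def)
qed

theorem hahn_banach_cone:
  fixes q :: "'b::real_vector \<Rightarrow> real" and D :: "'a::real_vector \<Rightarrow> 'b"
  assumes q: "sublinear q" and C: "convex_cone0 C" and D: "linear D" and m: "linear m"
    and le: "\<And>u. u \<in> C \<Longrightarrow> m u \<le> q (D u)"
  obtains g where "linear g" "\<And>x. g x \<le> q x" "\<And>u. u \<in> C \<Longrightarrow> m u \<le> g (D u)"
proof -
  obtain p where p: "sublinear p" "\<And>x. p x \<le> q x" "\<And>x u. u \<in> C \<Longrightarrow> p x \<le> q (x + D u) - m u"
    using sublinear_reduce[OF assms] by blast
  obtain g where g: "linear g" "\<And>x. g x \<le> p x" using linear_below_sublinear[OF p(1)] by blast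
  have "m u \<le> g (D u)" if "u \<in> C" for u
  proof -
    have "- g (D u) = g (- D u)" using g(1) by (simp add: linear_neg)
    also have "\<dots> \<le> - m u" using g(2)[of "- D u"] p(3)[OF that, of "- D u"] sublinear_zero[OF q] by simp
    finally show ?thesis by simp
  qed
  thus ?thesis using that g p(2) by (meson order_trans)
qed

corollary hahn_banach_subspace:
  fixes q :: "'b::real_vector \<Rightarrow> real" and D :: "'a::real_vector \<Rightarrow> 'b"
  assumes q: "sublinear q" and S: "subspace S" and D: "linear D" and m: "linear m"
    and le: "\<And>u. u \<in> S \<Longrightarrow> m u \<le> q (D u)"
  obtains g where "linear g" "\<And>x. g x \<le> q x" "\<And>u. u \<in> S \<Longrightarrow> g (D u) = m u"
proof -
  have "convex_cone0 S" using S by (simp add: convex_cone0_def subspace_def)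
  then obtain g where g: "linear g" "\<And>x. g x \<le> q x" "\<And>u. u \<in> S \<Longrightarrow> m u \<le> g (D u)"
    using hahn_banach_cone[OF q _ D m le] by blast
  have "g (D u) = m u" if "u \<in> S" for u
    using g(3)[OF that] g(3)[of "- u"] subspace_neg[OF S that]
    by (simp add: linear_neg[OF g(1)] linear_neg[OF D] linear_neg[OF m])
  thus ?thesis using that g by blast
qed

lemma linear_le_norm_bounded:
  fixes g :: "'a::real_normed_vector \<Rightarrow> real"
  assumes g: "linear g" and le: "\<And>x. g x \<le> c * norm x"
  shows "bounded_linear g" "\<And>x. \<bar>g x\<bar> \<le> c * norm x"
proof -
  show *: "\<bar>g x\<bar> \<le> c * norm x" for x
    using le[of x] le[of "-x"] linear_neg[OF g, of x] by auto
  show "bounded_linear g"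
    unfolding bounded_linear_def bounded_linear_axioms_def
    using g * by (auto intro!: exI[of _ c] simp: mult.commute)
qed

lemma blinfun_of_dominated:
  fixes g :: "'a::real_normed_vector \<Rightarrow> real"
  assumes g: "linear g" and le: "\<And>x. g x \<le> c * norm x" and c: "c \<ge> 0"
  obtains l :: "'a \<Rightarrow>\<^sub>L real" where "\<And>x. blinfun_apply l x = g x" "norm l \<le> c"
proof -
  note * = linear_le_norm_bounded[OF g le]
  show ?thesis
  proof (rule that[of "Blinfun g"])
    show "blinfun_apply (Blinfun g) x = g x" for x
      using *(1) by (simp add: bounded_linear_Blinfun_apply)
    thus "norm (Blinfun g) \<le> c" using *(2) c by (intro norm_blinfun_bound) auto
  qed
qed

lemma norming_functional:
  fixes x :: "'a::real_normed_vector"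
  obtains l :: "'a \<Rightarrow>\<^sub>L real" where "norm l \<le> 1" "l x = norm x"
proof -
  obtain g :: "'a \<Rightarrow> real" where g: "linear g" "\<And>y. g y \<le> 1 * norm y"
    "\<And>t. t \<in> (UNIV::real set) \<Longrightarrow> g (t *\<^sub>R x) = t * norm x"
  proof (rule hahn_banach_subspace[of "\<lambda>y. 1 * norm y" "UNIV::real set" "\<lambda>t. t *\<^sub>R x" "\<lambda>t. t * norm x"])
    show "u * norm x \<le> 1 * norm (u *\<^sub>R x)" for u by (simp add: mult_right_mono)
    show "sublinear (\<lambda>y :: 'a. 1 * norm y)" by (rule sublinear_norm_scaled) simp
  qed (auto simp: linear_iff algebra_simps)
  obtain l :: "'a \<Rightarrow>\<^sub>L real" where "\<And>x. blinfun_apply l x = g x" "norm l \<le> 1"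
    using blinfun_of_dominated[OF g(1,2)] by auto
  thus ?thesis using that g(3)[of 1] by simp
qed

section \<open>Separation of points from closed subspaces\<close>

lemma infdist_attained_upto:
  assumes "S \<noteq> {}" "e > 0"
  obtains a where "a \<in> S" "dist x a < infdist x S + e"
proof -
  have "(INF a\<in>S. dist x a) < infdist x S + e" using assms by (simp add: infdist_def)
  thus ?thesis using assms that by (subst (asm) cINF_less_iff) auto
qed

text \<open>The distance to \<open>S\<close> is a sublinear function below the norm. A linear
  functional below it is at most 0 on \<open>S\<close>, hence 0 there, and it can be prescribed on
  the line through \<open>x\<close>.\<close>

lemma separating_functional:
  fixes S :: "'a::real_normed_vector set"
  assumes S: "subspace S" "closed S" and x: "x \<notin> S"
  obtains l :: "'a \<Rightarrow>\<^sub>L real" where "\<And>s. s \<in> S \<Longrightarrow> l s = 0" "l x \<noteq> 0"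
proof -
  have S0: "0 \<in> S" using S(1) by (simp add: subspace_0)
  define q where "q y = infdist y S" for y
  have "sublinear q"
  proof (rule sublinearI)
    fix y z
    have "infdist (y + z) S \<le> infdist y S + infdist z S + e" if e: "e > 0" for e
    proof -
      obtain a where a: "a \<in> S" "dist y a < infdist y S + e/2"
        using infdist_attained_upto[of S "e/2" y] e S0 by auto
      obtain b where b: "b \<in> S" "dist z b < infdist z S + e/2"
        using infdist_attained_upto[of S "e/2" z] e S0 by auto
      have "infdist (y + z) S \<le> dist (y + z) (a + b)"
        using S(1) a b by (intro infdist_le) (auto simp: subspace_add)
      also have "\<dots> \<le> dist y a + dist z b" by (rule dist_triangle_add)
      finally show ?thesis using a b by simp
    qed
    thus "q (y + z) \<le> q y + q z" unfolding q_def by (rule field_le_epsilon)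
  next
    show "q 0 = 0" using S0 by (simp add: q_def)
  next
    fix s :: real and y assume s: "s > 0"
    have "q (s *\<^sub>R y) / s \<le> infdist y S"
    proof -
      have "q (s *\<^sub>R y) / s \<le> dist y a" if "a \<in> S" for a
      proof -
        have "q (s *\<^sub>R y) \<le> dist (s *\<^sub>R y) (s *\<^sub>R a)"
          unfolding q_def using S(1) that by (intro infdist_le) (auto simp: subspace_scale)
        also have "\<dots> = s * dist y a" using s by (simp add: dist_norm scaleR_diff_right[symmetric])
        finally show ?thesis using s by (simp add: field_simps)
      qed
      thus ?thesis using S0 by (auto simp: infdist_def intro!: cINF_greatest)
    qed
    thus "q (s *\<^sub>R y) \<le> s * q y" using s by (simp add: field_simps q_def)
  qed
  moreover have "t * q x \<le> q (t *\<^sub>R x)" for t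
  proof (cases "t \<ge> 0")
    case True thus ?thesis using \<open>sublinear q\<close> by (simp add: sublinear_scale)
  next
    case False
    thus ?thesis by (smt (verit) q_def infdist_nonneg mult_nonneg_nonneg mult_minus_left)
  qed
  ultimately obtain g :: "'a \<Rightarrow> real" where g: "linear g" "\<And>y. g y \<le> q y"
    "\<And>t. t \<in> (UNIV::real set) \<Longrightarrow> g (t *\<^sub>R x) = t * q x"
    using hahn_banach_subspace[of q "UNIV::real set" "\<lambda>t. t *\<^sub>R x" "\<lambda>t. t * q x"]
    by (auto simp: linear_iff algebra_simps)
  have "q y \<le> 1 * norm y" for y
    using infdist_le[OF S0, of y] by (simp add: q_def)
  then obtain l :: "'a \<Rightarrow>\<^sub>L real" where l: "\<And>x. blinfun_apply l x = g x"
    using blinfun_of_dominated[of g 1] g(1,2) by (meson order_trans zero_le_one)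
  show ?thesis
  proof (rule that[of l])
    fix s assume s: "s \<in> S"
    have "q s = 0" "q (- s) = 0" using s S(1) by (simp_all add: q_def subspace_neg)
    thus "l s = 0" using g(2)[of s] g(2)[of "- s"] l linear_neg[OF g(1), of s] by simp
  next
    have "infdist x S \<noteq> 0" using in_closed_iff_infdist_zero[OF S(2)] S0 x by auto
    thus "l x \<noteq> 0" using g(3)[of 1] l by (simp add: q_def)
  qed
qed

section \<open>Ultrafilters and weak-star compactness\<close>

definition ultrafilter :: "'a filter \<Rightarrow> bool" where
  "ultrafilter U \<longleftrightarrow> U \<noteq> bot \<and> (\<forall>P. eventually P U \<or> eventually (\<lambda>x. \<not> P x) U)"

lemma ultrafilter_exists:
  fixes F :: "'a filter"
  assumes F: "F \<noteq> bot"
  obtains U where "ultrafilter U" "U \<le> F"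
proof -
  define A where "A = {U. U \<noteq> bot \<and> U \<le> F}"
  let ?P = "\<lambda>a b :: 'a filter. b \<le> a"
  have "\<exists>m\<in>A. \<forall>a\<in>A. ?P m a \<longrightarrow> a = m"
  proof (rule predicate_Zorn)
    show "partial_order_on A (relation_of ?P A)"
      by (rule partial_order_on_relation_ofI) auto
  next
    fix C assume C: "C \<in> Chains (relation_of ?P A)"
    show "\<exists>u\<in>A. \<forall>a\<in>C. ?P a u"
    proof (cases "C = {}")
      case True
      thus ?thesis using F by (auto simp: A_def)
    next
      case False
      have CA: "C \<subseteq> A" using C by (auto simp: Chains_def relation_of_def)
      have ch: "p \<le> p' \<or> p' \<le> p" if "p \<in> C" "p' \<in> C" for p p'
        using C that by (auto simp: Chains_def relation_of_def)
      have "eventually (\<lambda>_. False) (Inf C) \<longleftrightarrow> (\<exists>b\<in>C. eventually (\<lambda>_. False) b)"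
        by (rule eventually_Inf_base[OF False]) (metis ch inf.absorb1 inf.absorb2 order_refl)
      hence "Inf C \<noteq> bot" using CA by (auto simp: A_def trivial_limit_def)
      moreover have "Inf C \<le> F"
      proof -
        obtain c where "c \<in> C" using False by auto
        thus ?thesis using CA by (auto simp: A_def intro: Inf_lower2)
      qed
      ultimately show ?thesis by (intro bexI[of _ "Inf C"]) (auto simp: A_def Inf_lower)
    qed
  qed
  then obtain U where U: "U \<noteq> bot" "U \<le> F" and min: "\<And>a. a \<noteq> bot \<Longrightarrow> a \<le> U \<Longrightarrow> a = U"
    unfolding A_def by (blast intro: order_trans)
  have "eventually P U" if "\<not> eventually (\<lambda>x. \<not> P x) U" for P
  proof -
    have "inf U (principal {x. P x}) \<noteq> bot"
      using that by (simp add: trivial_limit_def eventually_inf_principal)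
    hence eq: "inf U (principal {x. P x}) = U" by (rule min) simp
    have "eventually P (inf U (principal {x. P x}))" by (simp add: eventually_inf_principal)
    thus ?thesis unfolding eq .
  qed
  with U that show ?thesis by (auto simp: ultrafilter_def)
qed

lemma ultrafilter_not_eventually:
  assumes U: "ultrafilter U"
  shows "\<not> eventually P U \<longleftrightarrow> eventually (\<lambda>x. \<not> P x) U"
proof

  show "eventually (\<lambda>x. \<not> P x) U" if "\<not> eventually P U" using U that by (auto simp: ultrafilter_def)
  show "\<not> eventually P U" if n: "eventually (\<lambda>x. \<not> P x) U"
  proof
    assume "eventually P U"
    with n have "eventually (\<lambda>_. False) U" by eventually_elim simp
    with U show False by (simp add: ultrafilter_def trivial_limit_def)
  qed
qed

lemma ultrafilter_filtermap: "ultrafilter U \<Longrightarrow> ultrafilter (filtermap f U)"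
  by (auto simp: ultrafilter_def eventually_filtermap filtermap_bot_iff)

lemma ultrafilter_tendsto_real:
  fixes f :: "'a \<Rightarrow> real"
  assumes U: "ultrafilter U" and b: "eventually (\<lambda>x. \<bar>f x\<bar> \<le> B) U"
  obtains l where "(f \<longlongrightarrow> l) U"
proof -
  have "compact {-B..B}" by simp
  moreover have "filtermap f U \<noteq> bot" using U by (simp add: ultrafilter_def filtermap_bot_iff)
  moreover have "eventually (\<lambda>x. x \<in> {-B..B}) (filtermap f U)"
    using b by (auto simp: eventually_filtermap abs_le_iff elim!: eventually_mono)
  ultimately obtain l where l: "inf (nhds l) (filtermap f U) \<noteq> bot"
    unfolding compact_filter by blast
  have "(f \<longlongrightarrow> l) U"
  proof (rule topological_tendstoI, rule ccontr)
    fix S :: "real set" assume S: "open S" "l \<in> S" and "\<not> eventually (\<lambda>x. f x \<in> S) U"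
    hence "eventually (\<lambda>x. x \<notin> S) (filtermap f U)"
      using U by (simp add: ultrafilter_not_eventually eventually_filtermap)
    moreover have "eventually (\<lambda>x. x \<in> S) (nhds l)" using S by (simp add: eventually_nhds_in_open)
    ultimately have "eventually (\<lambda>_. False) (inf (nhds l) (filtermap f U))"
      unfolding eventually_inf by blast
    with l show False by (simp add: trivial_limit_def)
  qed
  thus ?thesis by (rule that)
qed

section \<open>Compactness by ultrafilter limits\<close>

definition ultra_limit :: "'a topology \<Rightarrow> 'a filter \<Rightarrow> 'a \<Rightarrow> bool" where
  "ultra_limit X U x \<longleftrightarrow> (\<forall>V. openin X V \<and> x \<in> V \<longrightarrow> eventually (\<lambda>y. y \<in> V) U)"

lemma compactin_iff_ultrafilter:
  "compactin X S \<longleftrightarrow> S \<subseteq> topspace X \<and>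
     (\<forall>U. ultrafilter U \<and> eventually (\<lambda>x. x \<in> S) U \<longrightarrow> (\<exists>x\<in>S. ultra_limit X U x))"
    (is "_ \<longleftrightarrow> _ \<and> ?R")
proof (intro iffI conjI)
  assume c: "compactin X S"
  thus "S \<subseteq> topspace X" by (simp add: compactin_def)
  show ?R
  proof (intro allI impI, rule ccontr)
    fix U assume U: "ultrafilter U \<and> eventually (\<lambda>x. x \<in> S) U" and no: "\<not> (\<exists>x\<in>S. ultra_limit X U x)"
    \<comment> \<open>If no point of \<open>S\<close> is a limit, each has an open neighbourhood
      that \<open>U\<close> avoids; finitely many of these cover \<open>S\<close>.\<close>
    define \<C> where "\<C> = {V. openin X V \<and> eventually (\<lambda>y. y \<notin> V) U}"
    have "S \<subseteq> \<Union>\<C>"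
    proof
      fix x assume "x \<in> S"
      with no obtain V where "openin X V" "x \<in> V" "\<not> eventually (\<lambda>y. y \<in> V) U"
        by (auto simp: ultra_limit_def)
      thus "x \<in> \<Union>\<C>" using U by (auto simp: \<C>_def ultrafilter_not_eventually)
    qed
    then obtain \<F> where \<F>: "finite \<F>" "\<F> \<subseteq> \<C>" "S \<subseteq> \<Union>\<F>"
      using c unfolding compactin_def \<C>_def by (metis (no_types, lifting) mem_Collect_eq)
    have "eventually (\<lambda>y. \<forall>V\<in>\<F>. y \<notin> V) U"
      using \<F> by (auto simp: eventually_ball_finite_distrib \<C>_def)
    moreover have "eventually (\<lambda>y. y \<in> S) U" using U by simp
    ultimately have "eventually (\<lambda>y. False) U" by eventually_elim (use \<F>(3) in blast)
    thus False using U by (simp add: ultrafilter_def trivial_limit_def)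
  qed
next
  assume R: "S \<subseteq> topspace X \<and> ?R"
  show "compactin X S"
    unfolding compactin_def
  proof (intro conjI allI impI, use R in blast, rule ccontr)
    fix \<C> assume \<C>: "(\<forall>V\<in>\<C>. openin X V) \<and> S \<subseteq> \<Union>\<C>"
      and no: "\<nexists>\<F>. finite \<F> \<and> \<F> \<subseteq> \<C> \<and> S \<subseteq> \<Union>\<F>"
    \<comment> \<open>Without a finite subcover the sets \<open>S - V\<close> have the finite
      intersection property; an ultrafilter finer than all of them has no limit in
      \<open>S\<close>.\<close>
    define F where "F = (INF V\<in>\<C>. principal (S - V))"
    have "F \<noteq> bot"
      unfolding F_def
    proof (rule INF_filter_not_bot)
      fix \<F> assume \<F>: "\<F> \<subseteq> \<C>" "finite \<F>"
      have "(INF V\<in>\<F>. principal (S - V)) = principal (\<Inter>V\<in>\<F>. S - V)"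
        using INF_principal_finite[OF \<F>(2)] by metis
      moreover have "(\<Inter>V\<in>\<F>. S - V) \<noteq> {}" using no \<F> by auto
      ultimately show "(INF V\<in>\<F>. principal (S - V)) \<noteq> bot" by (simp add: principal_eq_bot_iff)
    qed
    then obtain U where U: "ultrafilter U" "U \<le> F" by (rule ultrafilter_exists)
    have ev: "eventually (\<lambda>x. x \<in> S \<and> x \<notin> V) U" if "V \<in> \<C>" for V
    proof -
      have "U \<le> principal (S - V)" using U(2) that unfolding F_def by (metis INF_lower order_trans)
      thus ?thesis by (auto simp: le_principal)
    qed
    show False
    proof (cases "\<C> = {}")
      case True thus False using no \<C> by auto
    next
      case False
      then obtain V where "V \<in> \<C>" by auto
      from ev[OF this] have "eventually (\<lambda>x. x \<in> S) U" by (rule eventually_mono) simp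
      then obtain x where x: "x \<in> S" "ultra_limit X U x" using R U by blast
      then obtain V where V: "V \<in> \<C>" "x \<in> V" using \<C> by auto
      hence "eventually (\<lambda>y. y \<in> V) U" using x \<C> by (auto simp: ultra_limit_def)
      hence "eventually (\<lambda>y. False) U" using ev[OF V(1)] by eventually_elim simp
      thus False using U by (simp add: ultrafilter_def trivial_limit_def)
    qed
  qed
qed

lemma ultra_limit_generated:
  assumes "\<And>B. B \<in> \<B> \<Longrightarrow> x \<in> B \<Longrightarrow> eventually (\<lambda>y. y \<in> B) U"
  shows "ultra_limit (topology_generated_by \<B>) U x"
proof -
  have "x \<in> V \<longrightarrow> eventually (\<lambda>y. y \<in> V) U" if "generate_topology_on \<B> V" for V
    using that
  proof induction
    case (UN K)
    show ?case
    proof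
      assume "x \<in> \<Union>K"
      then obtain k where k: "k \<in> K" "x \<in> k" by auto
      with UN have "eventually (\<lambda>y. y \<in> k) U" by blast
      thus "eventually (\<lambda>y. y \<in> \<Union>K) U" by (rule eventually_mono) (use k in blast)
    qed
  qed (use assms in \<open>auto elim: eventually_conj simp: eventually_conj_iff\<close>)
  thus ?thesis by (simp add: ultra_limit_def openin_topology_generated_by_iff)
qed

lemma openin_weak_top:
  fixes f :: "'a::real_normed_vector \<Rightarrow>\<^sub>L real"
  shows "open S \<Longrightarrow> openin weak_top (blinfun_apply f -` S)"
  unfolding weak_top_def by (intro topology_generated_by_Basis CollectI exI[of _ f] exI[of _ S] conjI refl)

lemma openin_weakstar_bidual: "open S \<Longrightarrow> openin weakstar_bidual ((\<lambda>z. blinfun_apply z f) -` S)"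
  unfolding weakstar_bidual_def by (intro topology_generated_by_Basis CollectI exI[of _ f] exI[of _ S] conjI refl)

lemma topspace_weak_top [simp]: "topspace weak_top = UNIV"
  using openin_subset[OF openin_weak_top[of UNIV]] by auto

lemma topspace_weakstar_bidual [simp]: "topspace weakstar_bidual = UNIV"
  using openin_subset[OF openin_weakstar_bidual[of UNIV]] by auto

lemma ultra_limit_weak_top_iff:
  fixes x :: "'a::real_normed_vector"
  shows "ultra_limit weak_top U x \<longleftrightarrow> (\<forall>f :: 'a \<Rightarrow>\<^sub>L real. (blinfun_apply f \<longlongrightarrow> f x) U)"
proof
  assume "ultra_limit weak_top U x"
  thus "\<forall>f :: 'a \<Rightarrow>\<^sub>L real. (blinfun_apply f \<longlongrightarrow> f x) U"
    using openin_weak_top by (intro allI topological_tendstoI) (force simp: ultra_limit_def)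
next
  assume "\<forall>f :: 'a \<Rightarrow>\<^sub>L real. (blinfun_apply f \<longlongrightarrow> f x) U"
  thus "ultra_limit weak_top U x" unfolding weak_top_def
    by (intro ultra_limit_generated) (force dest: topological_tendstoD)
qed

lemma ultra_limit_weakstar_iff:
  "ultra_limit weakstar_bidual U z \<longleftrightarrow> (\<forall>f. ((\<lambda>y. blinfun_apply y f) \<longlongrightarrow> z f) U)"
proof
  assume "ultra_limit weakstar_bidual U z"
  thus "\<forall>f. ((\<lambda>y. blinfun_apply y f) \<longlongrightarrow> z f) U"
    using openin_weakstar_bidual by (intro allI topological_tendstoI) (force simp: ultra_limit_def)
next
  assume "\<forall>f. ((\<lambda>y. blinfun_apply y f) \<longlongrightarrow> z f) U"
  thus "ultra_limit weakstar_bidual U z" unfolding weakstar_bidual_def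
    by (intro ultra_limit_generated) (force dest: topological_tendstoD)
qed

lemma ultrafilter_limit_le:
  fixes f g :: "'a \<Rightarrow> real"
  assumes "ultrafilter U" "(f \<longlongrightarrow> a) U" "(g \<longlongrightarrow> b) U" "eventually (\<lambda>x. f x \<le> g x) U"
  shows "a \<le> b"
  using assms by (auto simp: ultrafilter_def intro: tendsto_le)

text \<open>Boundedness gives a real limit at each \<open>x\<close>, and linearity and the norm
  bound survive the limit.\<close>

theorem banach_alaoglu_ultrafilter:
  fixes z :: "'i \<Rightarrow> ('a::real_normed_vector \<Rightarrow>\<^sub>L real)"
  assumes U: "ultrafilter U" and b: "eventually (\<lambda>i. norm (z i) \<le> B) U"
  obtains w where "\<And>x. ((\<lambda>i. z i x) \<longlongrightarrow> blinfun_apply w x) U" "norm w \<le> B"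
proof -
  have nb: "U \<noteq> bot" using U by (simp add: ultrafilter_def)
  have B: "B \<ge> 0"
  proof (rule ccontr)
    assume "\<not> B \<ge> 0"
    hence "eventually (\<lambda>i. False) U" using b
      by (elim eventually_mono) (smt (verit) norm_ge_zero)
    thus False using nb by (simp add: trivial_limit_def)
  qed
  have bx: "eventually (\<lambda>i. \<bar>z i x\<bar> \<le> B * norm x) U" for x
    using b by (elim eventually_mono)
      (metis norm_blinfun mult_right_mono norm_ge_zero order_trans real_norm_def)
  define g where "g x = (THE l. ((\<lambda>i. z i x) \<longlongrightarrow> l) U)" for x
  have g: "((\<lambda>i. z i x) \<longlongrightarrow> g x) U" for x
  proof -
    obtain l where l: "((\<lambda>i. z i x) \<longlongrightarrow> l) U" using ultrafilter_tendsto_real[OF U bx[of x]] by metis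
    hence "g x = l" unfolding g_def by (intro the_equality tendsto_unique[OF nb])
    thus ?thesis using l by simp
  qed
  have "linear g"
  proof (rule linearI)
    show "g (x + y) = g x + g y" for x y
      by (rule tendsto_unique[OF nb g]) (simp add: blinfun.add_right tendsto_add g)
    show "g (c *\<^sub>R x) = c *\<^sub>R g x" for c x
      by (rule tendsto_unique[OF nb g]) (simp add: blinfun.scaleR_right tendsto_mult g)
  qed
  moreover have "g x \<le> B * norm x" for x
    by (rule ultrafilter_limit_le[OF U g tendsto_const], rule eventually_mono[OF bx[of x]]) simp
  ultimately obtain w :: "'a \<Rightarrow>\<^sub>L real" where "\<And>x. w x = g x" "norm w \<le> B"
    using blinfun_of_dominated[of g B] B by metis
  with g that[of w] show ?thesis by simp
qed

section \<open>Comparison of the measures of weak noncompactness\<close>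

lemma canon_apply [simp]: "blinfun_apply (canon x) f = blinfun_apply f x"
proof -
  have "bounded_linear (\<lambda>f :: 'a \<Rightarrow>\<^sub>L real. f x)"
    by (rule blinfun.bounded_linear_left)
  thus ?thesis by (simp add: canon_def bounded_linear_Blinfun_apply)
qed

lemma norm_canon_le: "norm (canon x) \<le> norm x"
proof (rule norm_blinfun_bound)
  fix f :: "'a \<Rightarrow>\<^sub>L real"
  show "norm (canon x f) \<le> norm x * norm f"
    using norm_blinfun[of f x] by (simp add: mult.commute)
qed simp

lemma infdist_range_canon_le: "infdist z (range canon) \<le> norm z"
proof -
  have "canon 0 = 0" by (rule blinfun_eqI) (simp add: blinfun.zero_right)
  hence "0 \<in> range canon" by (metis rangeI)
  from infdist_le[OF this, of z] show ?thesis by simp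
qed

lemma weakstar_closure_ultrafilter:
  fixes A :: "'a::real_normed_vector set"
  assumes z: "z \<in> weakstar_bidual closure_of (canon ` A)"
  obtains U where "ultrafilter U" "eventually (\<lambda>a. a \<in> A) U"
    "\<And>f. (blinfun_apply f \<longlongrightarrow> blinfun_apply z f) U"
proof -
  define N where "N = {V. openin weakstar_bidual V \<and> z \<in> V}"
  define F where "F = (INF V\<in>N. principal {a\<in>A. canon a \<in> V})"
  have UN: "UNIV \<in> N" using openin_topspace[of weakstar_bidual] by (simp add: N_def)
  have ne: "{a\<in>A. canon a \<in> V} \<noteq> {}" if "V \<in> N" for V
    using z that unfolding in_closure_of N_def by fastforce
  have "F \<noteq> bot"
    unfolding F_def
  proof (rule INF_filter_not_bot)
    fix \<F> assume \<F>: "\<F> \<subseteq> N" "finite \<F>"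
    have "openin weakstar_bidual (\<Inter>(insert UNIV \<F>))"
      using \<F> UN by (intro openin_Inter) (auto simp: N_def)
    hence "\<Inter>(insert UNIV \<F>) \<in> N" using \<F> by (auto simp: N_def)
    from ne[OF this] have "(\<Inter>V\<in>\<F>. {a\<in>A. canon a \<in> V}) \<noteq> {}" by fastforce
    moreover have "(INF V\<in>\<F>. principal {a\<in>A. canon a \<in> V}) = principal (\<Inter>V\<in>\<F>. {a\<in>A. canon a \<in> V})"
      using INF_principal_finite[OF \<F>(2)] by metis
    ultimately show "(INF V\<in>\<F>. principal {a\<in>A. canon a \<in> V}) \<noteq> bot"
      by (simp add: principal_eq_bot_iff)
  qed
  then obtain U where U: "ultrafilter U" "U \<le> F" by (rule ultrafilter_exists)
  have ev: "eventually (\<lambda>a. a \<in> A \<and> canon a \<in> V) U" if "V \<in> N" for V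
  proof -
    have "F \<le> principal {a\<in>A. canon a \<in> V}" unfolding F_def by (rule INF_lower[OF that])
    with U(2) have "U \<le> principal {a\<in>A. canon a \<in> V}" by (rule order_trans)
    thus ?thesis by (simp add: le_principal)
  qed
  show ?thesis
  proof (rule that[OF U(1)])
    show "eventually (\<lambda>a. a \<in> A) U" by (rule eventually_mono[OF ev[OF UN]]) simp
    fix f :: "'a \<Rightarrow>\<^sub>L real"
    show "(blinfun_apply f \<longlongrightarrow> blinfun_apply z f) U"
    proof (rule topological_tendstoI)
      fix S :: "real set" assume "open S" "z f \<in> S"
      hence "((\<lambda>z. blinfun_apply z f) -` S) \<in> N" by (simp add: N_def openin_weakstar_bidual)
      thus "eventually (\<lambda>x. f x \<in> S) U" by (rule eventually_mono[OF ev]) simp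
    qed
  qed
qed

lemma norm_weakstar_closure_le:
  assumes z: "z \<in> weakstar_bidual closure_of (canon ` A)" and B: "\<And>a. a \<in> A \<Longrightarrow> norm a \<le> B" "B \<ge> 0"
  shows "norm z \<le> B"
proof -
  obtain U where U: "ultrafilter U" "eventually (\<lambda>a. a \<in> A) U"
    "\<And>f. (blinfun_apply f \<longlongrightarrow> blinfun_apply z f) U"
    using weakstar_closure_ultrafilter[OF z] by metis
  show ?thesis
  proof (rule norm_blinfun_bound[OF B(2)])
    fix f
    have "\<bar>z f\<bar> \<le> B * norm f"
    proof (rule ultrafilter_limit_le[OF U(1) tendsto_rabs[OF U(3)] tendsto_const])
      show "eventually (\<lambda>a. \<bar>blinfun_apply f a\<bar> \<le> B * norm f) U"
        using U(2)
      proof (elim eventually_mono)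
        fix a assume "a \<in> A"
        have "\<bar>f a\<bar> \<le> norm f * norm a" using norm_blinfun[of f a] by simp
        also have "\<dots> \<le> norm f * B" using B(1)[OF \<open>a \<in> A\<close>] by (simp add: mult_left_mono)
        finally show "\<bar>f a\<bar> \<le> B * norm f" by (simp add: mult.commute)
      qed
    qed
    thus "norm (z f) \<le> B * norm f" by simp
  qed
qed

lemma dhat_upper: "bdd_above ((\<lambda>a. infdist a B) ` A) \<Longrightarrow> a \<in> A \<Longrightarrow> infdist a B \<le> dhat A B"
  unfolding dhat_def by (rule cSUP_upper)

lemma bdd_above_infdist:
  assumes "bounded A" "B \<noteq> {}"
  shows "bdd_above ((\<lambda>a. infdist a B) ` A)"
proof -
  obtain b where b: "b \<in> B" using assms by auto
  obtain e where e: "\<And>a. a \<in> A \<Longrightarrow> dist b a \<le> e" using assms(1) bounded_any_center[of A b] by auto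
  show ?thesis
    by (rule bdd_aboveI2[where M = e]) (use infdist_le[OF b] e in \<open>force simp: dist_commute intro: order_trans\<close>)
qed

text \<open>A choice \<open>k a\<close> in \<open>K\<close> near \<open>a\<close> pushes the
  ultrafilter to \<open>K\<close>, where it has a weak limit \<open>k0\<close> by compactness;
  \<open>z - canon k0\<close> is then a weak-star limit of elements \<open>a - k a\<close> of small
  norm.\<close>

lemma infdist_closure_le_dhat:
  fixes A K :: "'a::real_normed_vector set"
  assumes A: "bounded A" and K: "K \<noteq> {}" "compactin weak_top K"
    and z: "z \<in> weakstar_bidual closure_of (canon ` A)"
  shows "infdist z (range canon) \<le> dhat A K"
proof (rule field_le_epsilon)
  fix e :: real assume e: "e > 0"
  obtain U where U: "ultrafilter U" "eventually (\<lambda>a. a \<in> A) U"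
    "\<And>f. (blinfun_apply f \<longlongrightarrow> blinfun_apply z f) U"
    using weakstar_closure_ultrafilter[OF z] by metis
  have "\<forall>a. \<exists>k. k \<in> K \<and> dist a k < infdist a K + e"
    using infdist_attained_upto[OF K(1) e] by metis
  then obtain k where k: "\<And>a. k a \<in> K" "\<And>a. dist a (k a) < infdist a K + e" by metis
  have "ultrafilter (filtermap k U)" "eventually (\<lambda>x. x \<in> K) (filtermap k U)"
    using U k by (auto simp: ultrafilter_filtermap eventually_filtermap)
  then obtain k0 where k0: "k0 \<in> K" "ultra_limit weak_top (filtermap k U) k0"
    using K(2) unfolding compactin_iff_ultrafilter by blast
  hence lim: "((\<lambda>a. blinfun_apply f (k a)) \<longlongrightarrow> f k0) U" for f :: "'a \<Rightarrow>\<^sub>L real"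
    unfolding ultra_limit_weak_top_iff filterlim_filtermap by blast
  have d0: "dhat A K + e \<ge> 0"
  proof -
    have "A \<noteq> {}" using U(1,2) by (auto simp: ultrafilter_def trivial_limit_def)
    then obtain a where "a \<in> A" by auto
    hence "infdist a K \<le> dhat A K" using dhat_upper[OF bdd_above_infdist[OF A K(1)]] by blast
    with e infdist_nonneg[of a K] show ?thesis by linarith
  qed
  have "norm (z - canon k0) \<le> dhat A K + e"
  proof (rule norm_blinfun_bound[OF d0])
    fix f :: "'a \<Rightarrow>\<^sub>L real"
    have "((\<lambda>a. \<bar>f a - f (k a)\<bar>) \<longlongrightarrow> \<bar>z f - f k0\<bar>) U"
      by (intro tendsto_rabs tendsto_diff U(3) lim)
    moreover have "eventually (\<lambda>a. \<bar>f a - f (k a)\<bar> \<le> (dhat A K + e) * norm f) U"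
      using U(2)
    proof (elim eventually_mono)
      fix a assume a: "a \<in> A"
      have "\<bar>f a - f (k a)\<bar> \<le> norm f * norm (a - k a)"
        using norm_blinfun[of f "a - k a"] by (simp add: blinfun.diff_right)
      also have "\<dots> \<le> norm f * (dhat A K + e)"
        using k(2)[of a] dhat_upper[OF bdd_above_infdist[OF A K(1)] a]
        by (intro mult_left_mono) (auto simp: dist_norm)
      finally show "\<bar>f a - f (k a)\<bar> \<le> (dhat A K + e) * norm f" by (simp add: mult.commute)
    qed
    ultimately have "\<bar>z f - f k0\<bar> \<le> (dhat A K + e) * norm f"
      by (rule ultrafilter_limit_le[OF U(1) _ tendsto_const])
    thus "norm (blinfun_apply (z - canon k0) f) \<le> (dhat A K + e) * norm f"
      by (simp add: blinfun.diff_left)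
  qed
  moreover have "infdist z (range canon) \<le> norm (z - canon k0)"
    using infdist_le[of "canon k0" "range canon" z] by (simp add: dist_norm)
  ultimately show "infdist z (range canon) \<le> dhat A K + e" by linarith
qed

text \<open>An infimum over an empty set of cluster points would be a mere default value in
  \<open>wck_meas\<close>; bounded sequences exclude this case.\<close>

lemma clust_wstar_nonempty:
  fixes x :: "nat \<Rightarrow> 'a::real_normed_vector"
  assumes "\<And>n. norm (x n) \<le> B"
  shows "clust_wstar x \<noteq> {}"
proof -
  obtain U :: "nat filter" where U: "ultrafilter U" "U \<le> sequentially"
    using ultrafilter_exists[of sequentially] by auto
  have "eventually (\<lambda>n. norm (canon (x n)) \<le> B) U"
    by (intro always_eventually allI order_trans[OF norm_canon_le assms])
  then obtain z where z: "\<And>f. ((\<lambda>n. canon (x n) f) \<longlongrightarrow> blinfun_apply z f) U"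
    using banach_alaoglu_ultrafilter[OF U(1)] by metis
  have "ultra_limit weakstar_bidual (filtermap (\<lambda>n. canon (x n)) U) z"
    using z by (simp add: ultra_limit_weakstar_iff filterlim_filtermap)
  have "\<exists>n\<ge>N. canon (x n) \<in> V" if "openin weakstar_bidual V" "z \<in> V" for V N
  proof -
    have "eventually (\<lambda>n. canon (x n) \<in> V) U"
      using that \<open>ultra_limit _ _ z\<close> by (simp add: ultra_limit_def eventually_filtermap)
    moreover have "eventually (\<lambda>n. n \<ge> N) U"
      using U(2) eventually_ge_at_top filter_leD by blast
    ultimately have "eventually (\<lambda>n. n \<ge> N \<and> canon (x n) \<in> V) U" by (rule eventually_conj[rotated])
    moreover have "U \<noteq> bot" using U(1) by (simp add: ultrafilter_def)
    ultimately show ?thesis using eventually_happens by blast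
  qed
  thus ?thesis by (auto simp: clust_wstar_def)
qed

lemma clust_wstar_subset_closure:
  assumes "range x \<subseteq> A"
  shows "clust_wstar x \<subseteq> weakstar_bidual closure_of (canon ` A)"
proof
  fix z assume z: "z \<in> clust_wstar x"
  have "\<exists>y. y \<in> canon ` A \<and> y \<in> V" if V: "z \<in> V" "openin weakstar_bidual V" for V
  proof -
    obtain n where "canon (x n) \<in> V" using z V unfolding clust_wstar_def by blast
    moreover have "x n \<in> A" using assms by auto
    ultimately show ?thesis by blast
  qed
  thus "z \<in> weakstar_bidual closure_of (canon ` A)" by (auto simp: in_closure_of)
qed

lemma clust_wstar_lower_bound:
  assumes z: "z \<in> clust_wstar x" and c: "\<And>n. n \<ge> N \<Longrightarrow> c \<le> \<bar>blinfun_apply f (x n)\<bar>"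
  shows "c \<le> \<bar>blinfun_apply z f\<bar>"
proof (rule ccontr)
  assume "\<not> ?thesis"
  hence "z \<in> (\<lambda>w. blinfun_apply w f) -` {t. \<bar>t\<bar> < c}" by simp
  moreover have "openin weakstar_bidual ((\<lambda>w. blinfun_apply w f) -` {t. \<bar>t\<bar> < c})"
    by (intro openin_weakstar_bidual open_Collect_less continuous_intros)
  ultimately obtain n where "n \<ge> N" "canon (x n) \<in> (\<lambda>w. blinfun_apply w f) -` {t. \<bar>t\<bar> < c}"
    using z unfolding clust_wstar_def by blast
  with c[of n] show False by simp
qed

text \<open>For the empty set all three measures reduce to the same default value
  \<open>Sup {}\<close>.\<close>

lemma measures_empty:
  "deBlasi ({} :: 'a::real_normed_vector set) = wk_meas ({} :: 'a set)
    \<and> wk_meas ({} :: 'a set) = wck_meas ({} :: 'a set)"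
proof -
  have "compactin weak_top {0 :: 'a}" by (simp add: finite_imp_compactin)
  hence "{dhat {} K | K :: 'a set. K \<noteq> {} \<and> compactin weak_top K} = {Sup {}}"
    by (auto simp: dhat_def)
  thus ?thesis by (simp add: deBlasi_def wk_meas_def wck_meas_def dhat_def)
qed

lemma wck_inf_bounds:
  fixes x :: "nat \<Rightarrow> 'a::real_normed_vector"
  assumes A: "bounded A" and x: "range x \<subseteq> A"
  shows "0 \<le> (INF z\<in>clust_wstar x. infdist z (range canon))" (is ?lo)
    and "(INF z\<in>clust_wstar x. infdist z (range canon)) \<le> wk_meas A" (is ?hi)
proof -
  obtain B where B: "\<And>a. a \<in> A \<Longrightarrow> norm a \<le> B" "B > 0"
    using A by (auto simp: bounded_pos)
  have ne: "clust_wstar x \<noteq> {}" using x B by (intro clust_wstar_nonempty[of x B]) auto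
  then obtain z where z: "z \<in> clust_wstar x" by auto
  have zc: "z \<in> weakstar_bidual closure_of (canon ` A)"
    using z clust_wstar_subset_closure[OF x] by auto
  show ?lo using ne by (intro cINF_greatest) (auto simp: infdist_nonneg)
  have "(INF z\<in>clust_wstar x. infdist z (range canon)) \<le> infdist z (range canon)"
    by (rule cINF_lower[OF _ z]) (auto intro!: bdd_belowI2[where m = 0] simp: infdist_nonneg)
  also have "\<dots> \<le> wk_meas A"
    unfolding wk_meas_def
  proof (rule dhat_upper[OF _ zc])
    show "bdd_above ((\<lambda>a. infdist a (range canon)) ` (weakstar_bidual closure_of canon ` A))"
    proof (rule bdd_aboveI2[where M = B])
      fix z assume "z \<in> weakstar_bidual closure_of canon ` A"
      hence "norm z \<le> B" using B by (intro norm_weakstar_closure_le) auto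
      thus "infdist z (range canon) \<le> B" using infdist_range_canon_le[of z] by linarith
    qed
  qed
  finally show ?hi .
qed

lemma deBlasi_le_dhat:
  assumes A: "bounded A" "A \<noteq> {}" and K: "K \<noteq> {}" "compactin weak_top K"
  shows "deBlasi A \<le> dhat A K"
  unfolding deBlasi_def
proof (rule cInf_lower)
  show "bdd_below {dhat A K |K. K \<noteq> {} \<and> compactin weak_top K}"
  proof (rule bdd_belowI[where m = 0])
    fix r assume "r \<in> {dhat A K |K. K \<noteq> {} \<and> compactin weak_top K}"
    then obtain K where K: "r = dhat A K" "K \<noteq> {}" by auto
    obtain a where "a \<in> A" using A by auto
    from dhat_upper[OF bdd_above_infdist[OF A(1) K(2)] this] infdist_nonneg[of a K]
    show "0 \<le> r" unfolding K(1) by linarith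
  qed
qed (use K in auto)

lemma deBlasi_less_iff_far:
  assumes A: "bounded A" "A \<noteq> {}" and K: "K \<noteq> {}" "compactin weak_top K" and c: "c < deBlasi A"
  obtains a where "a \<in> A" "c < infdist a K"
proof -
  have "c < dhat A K" using deBlasi_le_dhat[OF A K] c by simp
  thus ?thesis using that A unfolding dhat_def
    by (subst (asm) less_cSUP_iff) (auto intro: bdd_above_infdist[OF A(1) K(1)])
qed

text \<open>Cluster points lie in the weak-star closure, and points of that closure are controlled
  by every weakly compact set. What is left is \<open>deBlasi A \<le> wck_meas A\<close>, for which
  one sequence with all cluster points far away suffices.\<close>

lemma measures_equalI:
  fixes A :: "'a::real_normed_vector set"
  assumes A: "bounded A"
    and main: "\<And>c e. 0 \<le> c \<Longrightarrow> c < deBlasi A \<Longrightarrow> e > 0 \<Longrightarrow> A \<noteq> {} \<Longrightarrow>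
      \<exists>x. range x \<subseteq> A \<and> (\<forall>z\<in>clust_wstar x. c - e \<le> infdist z (range canon))"
  shows "deBlasi A = wk_meas A \<and> wk_meas A = wck_meas A"
proof (cases "A = {}")
  case True thus ?thesis using measures_empty by simp
next
  case False
  define W where "W x = (INF z\<in>clust_wstar x. infdist z (range canon))" for x :: "nat \<Rightarrow> 'a"
  have wck: "wck_meas A = (SUP x\<in>{x. range x \<subseteq> A}. W x)" by (simp add: wck_meas_def W_def)
  have bdd: "bdd_above (W ` {x. range x \<subseteq> A})"
    by (rule bdd_aboveI2[where M = "wk_meas A"]) (use wck_inf_bounds[OF A] in \<open>auto simp: W_def\<close>)
  obtain a where a: "a \<in> A" using False by auto
  have ne: "{x :: nat \<Rightarrow> 'a. range x \<subseteq> A} \<noteq> {}" using a by (auto intro!: exI[of _ "\<lambda>_. a"])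
  have up: "W x \<le> wck_meas A" if "range x \<subseteq> A" for x
    unfolding wck using that bdd by (intro cSUP_upper) auto
  have 1: "wck_meas A \<le> wk_meas A"
    unfolding wck using ne wck_inf_bounds[OF A] by (intro cSUP_least) (auto simp: W_def)
  have "compactin weak_top {0 :: 'a}" by (simp add: finite_imp_compactin)
  hence "{dhat A K |K. K \<noteq> {} \<and> compactin weak_top K} \<noteq> {}" by blast
  hence 2: "wk_meas A \<le> deBlasi A"
    unfolding deBlasi_def
  proof (rule cInf_greatest)
    fix r assume "r \<in> {dhat A K |K. K \<noteq> {} \<and> compactin weak_top K}"
    then obtain K where K: "r = dhat A K" "K \<noteq> {}" "compactin weak_top K" by auto
    have "canon a \<in> weakstar_bidual closure_of (canon ` A)"
      using a by (auto simp: in_closure_of)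
    thus "wk_meas A \<le> r" unfolding K(1) wk_meas_def dhat_def[of "_ closure_of _"]
      using infdist_closure_le_dhat[OF A K(2,3)] by (intro cSUP_least) auto
  qed
  have 3: "deBlasi A \<le> wck_meas A"
  proof (rule ccontr)
    assume *: "\<not> ?thesis"
    have nn: "0 \<le> wck_meas A"
      using wck_inf_bounds(1)[OF A, of "\<lambda>_. a"] up[of "\<lambda>_. a"] a by (auto simp: W_def)
    \<comment> \<open>The midpoint leaves room for the slack, half the gap between
      \<open>wck_meas A\<close> and \<open>c\<close>.\<close>
    define c where "c = (deBlasi A + wck_meas A) / 2"
    have c: "0 \<le> c" "c < deBlasi A" "wck_meas A < c" using * nn by (auto simp: c_def)
    obtain x where x: "range x \<subseteq> A"
      "\<And>z. z \<in> clust_wstar x \<Longrightarrow> c - (c - wck_meas A) / 2 \<le> infdist z (range canon)"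
      using main[OF c(1,2), of "(c - wck_meas A) / 2"] c(3) False by auto
    obtain B where B: "\<And>a. a \<in> A \<Longrightarrow> norm a \<le> B" using A by (auto simp: bounded_iff)
    have "clust_wstar x \<noteq> {}" using x(1) B by (intro clust_wstar_nonempty[of x B]) auto
    hence "c - (c - wck_meas A) / 2 \<le> W x"
      unfolding W_def using x(2) by (intro cINF_greatest) auto
    with up[OF x(1)] c(3) show False by (simp add: field_simps)
  qed
  from 1 2 3 show ?thesis by simp
qed

section \<open>The bounded inverse theorem and the Bishop-Phelps-Bollobas theorem\<close>

text \<open>Baire's theorem puts a ball into the closure of the image of some ball; iterated
  approximation with halved errors then turns approximate preimages into exact ones.\<close>

theorem bounded_inverse:
  fixes A :: "'a::banach \<Rightarrow> 'b::banach"
  assumes A: "bounded_linear A" and bij: "bij A"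
  obtains r where "r > 0" "\<And>x. norm x \<le> r * norm (A x)"
proof -
  interpret A: bounded_linear A by (rule A)
  define C where "C n = closure (A ` cball 0 (real n))" for n :: nat
  have "\<exists>n. interior (C n) \<noteq> {}"
  proof (rule ccontr)
    assume no: "\<not> ?thesis"
    have "(euclidean :: 'b topology) interior_of \<Union>(range C) = {}"
    proof (rule Baire_category_alt)
      show "completely_metrizable_space (euclidean :: 'b topology) \<or>
        locally_compact_space (euclidean :: 'b topology) \<and> regular_space (euclidean :: 'b topology)"
        by (simp add: completely_metrizable_space_euclidean)
    qed (use no in \<open>auto simp: C_def\<close>)
    moreover have "y \<in> \<Union>(range C)" for y
    proof -
      obtain x where x: "y = A x" using bij by (metis bij_pointE)
      obtain n :: nat where "norm x \<le> n" using real_arch_simple by blast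
      hence "y \<in> C n" unfolding C_def using x by (intro subsetD[OF closure_subset]) auto
      thus ?thesis by auto
    qed
    hence "\<Union>(range C) = UNIV" by blast
    ultimately show False by simp
  qed
  then obtain n y0 d where d: "d > 0" "ball y0 d \<subseteq> C n"
    by (metis all_not_in_conv interior_subset open_contains_ball open_interior order_trans)
  have approx0: "\<exists>x. norm x \<le> n \<and> norm (A x - y) < e" if y: "norm y < d" and e: "e > 0" for y e
  proof -
    have "y0 + y \<in> C n" "y0 - y \<in> C n" using d y by (auto simp: dist_norm subset_iff)
    then obtain x1 x2 where x: "norm x1 \<le> n" "dist (A x1) (y0 + y) < e" "norm x2 \<le> n" "dist (A x2) (y0 - y) < e"
      unfolding C_def closure_approachable using e by (metis (no_types, opaque_lifting) imageE mem_cball_0)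
    \<comment> \<open>Half the difference of approximations to \<open>y0 + y\<close> and
      \<open>y0 - y\<close> moves the ball from \<open>y0\<close> to the origin.\<close>
    define x where "x = (1/2) *\<^sub>R (x1 - x2)"
    have "A x - y = (1/2) *\<^sub>R ((A x1 - (y0 + y)) - (A x2 - (y0 - y)))"
      by (simp add: x_def A.scaleR A.diff algebra_simps flip: scaleR_add_left)
    also have "norm \<dots> \<le> (1/2) * (norm (A x1 - (y0 + y)) + norm (A x2 - (y0 - y)))"
      using norm_triangle_ineq4[of "A x1 - (y0 + y)" "A x2 - (y0 - y)"] by simp
    also have "\<dots> < e" using x by (simp add: dist_norm)
    finally have "norm (A x - y) < e" .
    moreover have "norm x \<le> n"
      using norm_triangle_ineq4[of x1 x2] x by (simp add: x_def)
    ultimately show ?thesis by blast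
  qed
  define M where "M = 2 * real n / d"
  have M: "M \<ge> 0" using d by (simp add: M_def)
  have approx: "\<exists>x. norm x \<le> M * norm y \<and> norm (A x - y) \<le> norm y / 2" for y
  proof (cases "y = 0")
    case False
    define c where "c = d / (2 * norm y)"
    have c: "c > 0" using False d by (simp add: c_def)
    have "norm (c *\<^sub>R y) < d" using False d by (simp add: c_def)
    then obtain x where x: "norm x \<le> n" "norm (A x - c *\<^sub>R y) < c * norm y / 2"
      using approx0[of "c *\<^sub>R y" "c * norm y / 2"] c False by auto
    have "norm ((1/c) *\<^sub>R x) \<le> M * norm y"
      using x(1) c False d by (simp add: M_def c_def field_simps)
    moreover have eq: "A ((1/c) *\<^sub>R x) - y = (1/c) *\<^sub>R (A x - c *\<^sub>R y)"
      using c by (simp add: A.scaleR algebra_simps)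
    have "norm (A ((1/c) *\<^sub>R x) - y) \<le> norm y / 2"
      unfolding eq norm_scaleR using x(2) c by (simp add: field_simps)
    ultimately show ?thesis by blast
  qed (use A.zero in \<open>auto intro!: exI[of _ 0]\<close>)
  then obtain f where f: "\<And>y. norm (f y) \<le> M * norm y" "\<And>y. norm (A (f y) - y) \<le> norm y / 2"
    by metis
  have "norm x \<le> (2 * M + 1) * norm (A x)" for x
  proof -
    \<comment> \<open>\<open>Y k\<close> is the residue of \<open>A x\<close> after k corrections;
      it is at least halved each time, so the corrections sum to a preimage.\<close>
    define Y where "Y = rec_nat (A x) (\<lambda>_ y. y - A (f y))"
    have Y: "Y 0 = A x" "\<And>k. Y (Suc k) = Y k - A (f (Y k))" by (simp_all add: Y_def)
    have nY: "norm (Y k) \<le> (1/2)^k * norm (A x)" for k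
    proof (induction k)
      case (Suc k)
      have "norm (Y (Suc k)) \<le> norm (Y k) / 2"
        using f(2)[of "Y k"] by (simp add: Y norm_minus_commute)
      with Suc show ?case by simp
    qed (simp add: Y)
    have g: "summable (\<lambda>k. (1/2::real)^k)" by (rule summable_geometric) simp
    have fb: "norm (f (Y k)) \<le> (M * norm (A x)) * (1/2)^k" for k
      using f(1)[of "Y k"] mult_left_mono[OF nY[of k] M] by (simp add: algebra_simps)
    have sf: "summable (\<lambda>k. norm (f (Y k)))"
      by (rule summable_comparison_test'[where N = 0, OF summable_mult[OF g]]) (use fb in auto)
    hence sf': "summable (\<lambda>k. f (Y k))" by (rule summable_norm_cancel)
    define x' where "x' = (\<Sum>k. f (Y k))"
    have "(\<lambda>k. (1/2)^k * norm (A x)) \<longlonglongrightarrow> 0"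
      by (auto intro!: tendsto_mult_left_zero LIMSEQ_power_zero)
    hence "(\<lambda>k. norm (Y k)) \<longlonglongrightarrow> 0"
      by (rule Lim_null_comparison[rotated]) (use nY in simp)
    hence "Y \<longlonglongrightarrow> 0" by (simp add: tendsto_norm_zero_iff)
    from telescope_sums'[OF this] have "(\<lambda>k. Y k - Y (Suc k)) sums (A x)" by (simp add: Y(1))
    hence "(\<lambda>k. A (f (Y k))) sums A x" by (simp add: Y(2))
    moreover have "(\<lambda>k. A (f (Y k))) sums A x'"
      unfolding x'_def by (rule A.sums[OF summable_sums[OF sf']])
    ultimately have "A x = A x'" by (rule sums_unique2)
    hence "x = x'" using bij by (meson bij_is_inj injD)
    have "norm x' \<le> (\<Sum>k. norm (f (Y k)))" unfolding x'_def by (rule summable_norm[OF sf])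
    also have "\<dots> \<le> (\<Sum>k. (M * norm (A x)) * (1/2)^k)"
      by (rule suminf_le[OF fb sf summable_mult[OF g]])
    also have "\<dots> = 2 * M * norm (A x)"
      using suminf_geometric[of "1/2::real"] by (simp add: suminf_mult[OF g])
    also have "\<dots> \<le> (2 * M + 1) * norm (A x)" by (simp add: algebra_simps)
    finally show ?thesis using \<open>x = x'\<close> by simp
  qed
  thus ?thesis using that[of "2 * M + 1"] M by simp
qed

section \<open>Exactly norming pairs near almost norming ones\<close>

text \<open>Ekeland's principle. Order points by \<open>k * norm (y - x) \<le> a y - a x\<close> and
  move each time to an almost maximal successor. Increments of \<open>a\<close> bound the distances,
  so the sequence converges; a point beyond the limit would lie beyond every term and could not
  increase \<open>a\<close>.\<close>

lemma ekeland_unit_ball: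
  fixes a :: "'a::banach \<Rightarrow>\<^sub>L real"
  assumes k: "k > 0" and h: "norm h \<le> 1"
  obtains h' where "norm h' \<le> 1" "k * norm (h' - h) \<le> a h' - a h"
    "\<And>y. norm y \<le> 1 \<Longrightarrow> a y - a h' \<le> k * norm (y - h')"
proof -
  define S where "S x = {y. norm y \<le> 1 \<and> k * norm (y - x) \<le> a y - a x}" for x
  have refl: "x \<in> S x" if "norm x \<le> 1" for x using that by (simp add: S_def)
  have trans: "z \<in> S x" if "z \<in> S y" "y \<in> S x" for x y z
  proof -
    have "k * norm (z - x) \<le> k * norm (z - y) + k * norm (y - x)"
      using norm_triangle_ineq[of "z - y" "y - x"] k by (simp flip: distrib_left)
    with that show ?thesis by (simp add: S_def)
  qed
  have ab: "a y \<le> norm a" if "norm y \<le> 1" for y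
  proof -
    have "\<bar>a y\<bar> \<le> norm a * norm y" using norm_blinfun[of a y] by simp
    also have "\<dots> \<le> norm a" using that by (simp add: mult_left_le)
    finally show ?thesis by simp
  qed
  have ex: "\<exists>y. y \<in> S x \<and> (\<forall>w\<in>S x. a w \<le> a y + (1/2)^n)" if "norm x \<le> 1" for x and n :: nat
  proof -
    have ne: "S x \<noteq> {}" using refl[OF that] by auto
    have bd: "bdd_above (blinfun_apply a ` S x)"
      using ab by (intro bdd_aboveI2[where M = "norm a"]) (auto simp: S_def)
    have "(SUP w\<in>S x. a w) - (1/2)^n < (SUP w\<in>S x. a w)" by simp
    then obtain y where y: "y \<in> S x" "(SUP w\<in>S x. a w) - (1/2)^n < a y"
      by (subst (asm) less_cSUP_iff[OF ne bd]) blast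
    have "a w \<le> a y + (1/2)^n" if "w \<in> S x" for w
      using cSUP_upper[OF that bd] y(2) by simp
    with y(1) show ?thesis by blast
  qed
  define X where "X = rec_nat h (\<lambda>n x. SOME y. y \<in> S x \<and> (\<forall>w\<in>S x. a w \<le> a y + (1/2)^n))"
  have X0: "X 0 = h" by (simp add: X_def)
  have X1: "X (Suc n) \<in> S (X n) \<and> (\<forall>w\<in>S (X n). a w \<le> a (X (Suc n)) + (1/2)^n)" if "norm (X n) \<le> 1" for n
    using someI_ex[OF ex[OF that, of n]] by (simp add: X_def)
  have nX: "norm (X n) \<le> 1" for n
    by (induction n) (use X0 h X1 in \<open>auto simp: S_def\<close>)
  have XS: "X (n + m) \<in> S (X n)" for n m
  proof (induction m)
    case (Suc m)
    have "X (Suc (n + m)) \<in> S (X (n + m))" using X1[OF nX] by blast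
    from trans[OF this Suc] show ?case by simp
  qed (use refl nX in simp)
  have inc: "incseq (\<lambda>n. a (X n))"
  proof (rule incseq_SucI)
    fix n
    have "0 \<le> k * norm (X (Suc n) - X n)" using k by simp
    with XS[of n 1] show "a (X n) \<le> a (X (Suc n))" by (simp add: S_def)
  qed
  obtain L where L: "(\<lambda>n. a (X n)) \<longlonglongrightarrow> L" "\<And>n. a (X n) \<le> L"
    using incseq_convergent[OF inc, of "norm a"] ab nX by metis
  have "Cauchy X"
  proof (rule CauchyI)
    fix e :: real assume "e > 0"
    hence "e * k > 0" using k by simp
    then obtain N where N: "\<And>n. n \<ge> N \<Longrightarrow> \<bar>a (X n) - L\<bar> < e * k"
      using LIMSEQ_D[OF L(1)] by (metis real_norm_def)
    have main: "norm (X (n + m) - X n) < e" if "n \<ge> N" for n m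
    proof -
      have "k * norm (X (n + m) - X n) \<le> a (X (n + m)) - a (X n)" using XS[of n m] by (simp add: S_def)
      also have "\<dots> \<le> L - a (X n)" using L(2) by simp
      also have "\<dots> < e * k" using N[OF that] by simp
      finally show ?thesis using k by (simp add: mult.commute)
    qed
    show "\<exists>M. \<forall>m\<ge>M. \<forall>n\<ge>M. norm (X m - X n) < e"
    proof (intro exI[of _ N] allI impI)
      fix m n assume "m \<ge> N" "n \<ge> N"
      thus "norm (X m - X n) < e"
        using main[of n "m - n"] main[of m "n - m"] by (cases "n \<le> m") (auto simp: norm_minus_commute)
    qed
  qed
  then obtain h' where h': "X \<longlonglongrightarrow> h'" using Cauchy_convergent convergent_def by blast
  have aX: "(\<lambda>n. a (X n)) \<longlonglongrightarrow> a h'"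
    by (rule blinfun.tendsto[OF tendsto_const h'])
  have nh': "norm h' \<le> 1"
    by (rule tendsto_upperbound[OF tendsto_norm[OF h']]) (use nX in auto)
  have lim: "h' \<in> S (X n)" for n
  proof -
    have 1: "(\<lambda>m. k * norm (X m - X n)) \<longlonglongrightarrow> k * norm (h' - X n)" by (intro tendsto_intros h')
    have 2: "(\<lambda>m. a (X m) - a (X n)) \<longlonglongrightarrow> a h' - a (X n)" by (intro tendsto_intros aX)
    have "k * norm (h' - X n) \<le> a h' - a (X n)"
    proof (rule tendsto_le[OF trivial_limit_sequentially 2 1])
      show "\<forall>\<^sub>F m in sequentially. k * norm (X m - X n) \<le> a (X m) - a (X n)"
        unfolding eventually_sequentially
        by (intro exI[of _ n] allI impI) (metis (mono_tags, lifting) S_def XS le_iff_add mem_Collect_eq)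
    qed
    with nh' show ?thesis by (simp add: S_def)
  qed
  show ?thesis
  proof (rule that[of h'])
    show "k * norm (h' - h) \<le> a h' - a h" using lim[of 0] by (simp add: S_def X0)
    fix y :: 'a assume y: "norm y \<le> 1"
    show "a y - a h' \<le> k * norm (y - h')"
    proof (rule ccontr)
      assume *: "\<not> ?thesis"
      hence yS: "y \<in> S h'" using y by (simp add: S_def)
      have "a y \<le> a h' + (1/2)^n" for n
      proof -
        have "a y \<le> a (X (Suc n)) + (1/2)^n" using X1[OF nX] trans[OF yS lim] by blast
        moreover have "a (X (Suc n)) \<le> a h'"
        proof -
          have "0 \<le> k * norm (h' - X (Suc n))" using k by simp
          with lim[of "Suc n"] show ?thesis by (simp add: S_def)
        qed
        ultimately show ?thesis by simp
      qed
      moreover have "(\<lambda>n. a h' + (1/2::real)^n) \<longlonglongrightarrow> a h' + 0"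
        by (intro tendsto_intros LIMSEQ_power_zero) simp
      ultimately have "a y \<le> a h'" by (intro tendsto_lowerbound) auto
      moreover have "0 \<le> k * norm (y - h')" using k by simp
      ultimately show False using * by simp
    qed
  qed (rule nh')
qed

theorem bishop_phelps_bollobas:
  fixes a :: "'a::banach \<Rightarrow>\<^sub>L real"
  assumes k: "0 < k" "k \<le> 1/4" and a: "norm a \<le> 1" and h: "norm h \<le> 1" and ah: "a h \<ge> 1 - k\<^sup>2"
  obtains a' h' where "norm a' = 1" "norm h' = 1" "blinfun_apply a' h' = 1"
    "norm (a - a') \<le> 3 * k" "norm (h - h') \<le> k"
proof -
  obtain h' where h': "norm h' \<le> 1" "k * norm (h' - h) \<le> a h' - a h"
    "\<And>y. norm y \<le> 1 \<Longrightarrow> a y - a h' \<le> k * norm (y - h')"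
    using ekeland_unit_ball[OF k(1) h] by metis
  have ub: "l x \<le> norm l" if "norm x \<le> 1" for l :: "'a \<Rightarrow>\<^sub>L real" and x
  proof -
    have "\<bar>l x\<bar> \<le> norm l * norm x" using norm_blinfun[of l x] by simp
    also have "\<dots> \<le> norm l" using that by (simp add: mult_left_le)
    finally show ?thesis by simp
  qed
  have "k * norm (h' - h) \<le> k * k" using h'(2) ub[OF h'(1), of a] a ah by (simp add: power2_eq_square)
  hence d: "norm (h - h') \<le> k" using k by (simp add: norm_minus_commute)
  \<comment> \<open>By the choice of \<open>h'\<close> the functional \<open>a\<close> is at most
    \<open>k\<close> times the norm on the cone spanned by the ball as seen from \<open>h'\<close>.
    Subtracting a functional of norm at most \<open>k\<close> that dominates \<open>a\<close> on
    this cone makes \<open>h'\<close> a maximum point.\<close>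
  define C where "C = {t *\<^sub>R (y - h') | t y. t \<ge> 0 \<and> norm y \<le> 1}"
  have C: "convex_cone0 C"
    unfolding convex_cone0_def
  proof (intro conjI ballI allI impI)
    show "0 \<in> C" using h' unfolding C_def by force
  next
    fix u v assume "u \<in> C" "v \<in> C"
    then obtain s x t y where uv: "u = s *\<^sub>R (x - h')" "s \<ge> 0" "norm x \<le> 1" "v = t *\<^sub>R (y - h')" "t \<ge> 0" "norm y \<le> 1"
      unfolding C_def by blast
    show "u + v \<in> C"
    proof (cases "s + t = 0")
      case True
      hence "s = 0" "t = 0" using uv by linarith+
      hence "u + v = 0 *\<^sub>R (h' - h')" using uv by simp
      thus ?thesis using h' unfolding C_def by force
    next
      case False
      hence st: "s + t > 0" using uv by simp
      define w where "w = (s / (s + t)) *\<^sub>R x + (t / (s + t)) *\<^sub>R y"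
      have "norm w \<le> (s / (s + t)) * norm x + (t / (s + t)) * norm y"
        unfolding w_def using norm_triangle_ineq[of "(s / (s + t)) *\<^sub>R x" "(t / (s + t)) *\<^sub>R y"] uv by simp
      also have "\<dots> \<le> (s / (s + t)) * 1 + (t / (s + t)) * 1"
        using uv by (intro add_mono mult_left_mono) auto
      also have "\<dots> = 1" using st by (simp flip: add_divide_distrib)
      finally have "norm w \<le> 1" .
      moreover have "(s + t) *\<^sub>R w = s *\<^sub>R x + t *\<^sub>R y" using st by (simp add: w_def scaleR_add_right)
      hence "u + v = (s + t) *\<^sub>R (w - h')" by (simp add: uv scaleR_diff_right scaleR_add_left)
      ultimately show ?thesis using st unfolding C_def by force
    qed
  next
    fix t :: real and u assume "t \<ge> 0" "u \<in> C"
    then obtain s y where u: "u = s *\<^sub>R (y - h')" "s \<ge> 0" "norm y \<le> 1" unfolding C_def by blast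
    hence "t *\<^sub>R u = (t * s) *\<^sub>R (y - h')" "0 \<le> t * s" using \<open>t \<ge> 0\<close> by simp_all
    thus "t *\<^sub>R u \<in> C" using u(3) unfolding C_def by blast
  qed
  have "a u \<le> k * norm u" if uC: "u \<in> C" for u
  proof -
    obtain t y where u: "u = t *\<^sub>R (y - h')" "t \<ge> 0" "norm y \<le> 1" using uC unfolding C_def by blast
    have "a u = t * (a y - a h')" by (simp add: u blinfun.scaleR_right blinfun.diff_right)
    also have "\<dots> \<le> t * (k * norm (y - h'))" using h'(3)[OF u(3)] u(2) by (intro mult_left_mono)
    finally show ?thesis using u by (simp add: mult.left_commute)
  qed
  then obtain g where g: "linear g" "\<And>x. g x \<le> k * norm x" "\<And>u. u \<in> C \<Longrightarrow> a u \<le> g u"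
    using hahn_banach_cone[OF sublinear_norm_scaled C, of k "\<lambda>x. x" "blinfun_apply a"] k
    by (auto simp: linear_id bounded_linear.linear[OF blinfun.bounded_linear_right] linear_ident)
  obtain g1 :: "'a \<Rightarrow>\<^sub>L real" where g1: "\<And>x. g1 x = g x" "norm g1 \<le> k"
    using blinfun_of_dominated[OF g(1,2)] k by auto
  define f where "f = a - g1"
  have fmax: "f y \<le> f h'" if "norm y \<le> 1" for y
  proof -
    have "y - h' \<in> C" unfolding C_def using that by (auto intro!: exI[of _ 1])
    from g(3)[OF this] show ?thesis
      by (simp add: f_def blinfun.diff_left blinfun.diff_right g1(1)[symmetric])
  qed
  have f1: "norm f \<le> 1 + k" using norm_triangle_ineq4[of a g1] a g1 by (simp add: f_def)
  have "1 - k\<^sup>2 - k \<le> f h"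
    using ub[OF h, of g1] g1(2) ah by (simp add: f_def blinfun.diff_left)
  also have "\<dots> \<le> f h'" by (rule fmax[OF h])
  finally have f2: "1 - k\<^sup>2 - k \<le> f h'" .
  have k2: "k\<^sup>2 \<le> k * (1/4)" using k by (simp add: power2_eq_square)
  have pos: "f h' > 0" using f2 k k2 by linarith
  have "norm f \<le> f h'"
  proof (rule norm_blinfun_bound)
    fix x
    have "f x \<le> f h' * norm x" for x
    proof (cases "x = 0")
      case False
      have "f ((1 / norm x) *\<^sub>R x) \<le> f h'" using False by (intro fmax) simp
      thus ?thesis using False by (simp add: blinfun.scaleR_right field_simps)
    qed simp
    from this[of x] this[of "-x"] show "norm (f x) \<le> f h' * norm x"
      by (simp add: blinfun.minus_right abs_le_iff)
  qed (use pos in simp)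
  hence fh: "f h' = norm f" using ub[OF h'(1), of f] by simp
  define a' where "a' = (1 / norm f) *\<^sub>R f"
  have "norm (f - a') = \<bar>norm f - 1\<bar>"
  proof -
    have "f - a' = (1 - 1 / norm f) *\<^sub>R f" by (simp add: a'_def algebra_simps)
    hence "norm (f - a') = \<bar>1 - 1 / norm f\<bar> * norm f" by simp
    also have "\<dots> = \<bar>(1 - 1 / norm f) * norm f\<bar>" by (simp add: abs_mult)
    also have "(1 - 1 / norm f) * norm f = norm f - 1" using pos fh by (simp add: algebra_simps)
    finally show ?thesis .
  qed
  hence "norm (f - a') \<le> k + k\<^sup>2" using f1 f2 fh zero_le_power2[of k] by linarith
  moreover have "norm (a - f) \<le> k" using g1 by (simp add: f_def)
  \<comment> \<open>Subtracting \<open>g1\<close> costs \<open>k\<close>, and normalizing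
    \<open>f\<close> costs \<open>k + k\<^sup>2\<close>.\<close>
  ultimately have "norm (a - a') \<le> 3 * k"
    using norm_triangle_ineq[of "a - f" "f - a'"] k k2 by simp
  moreover have a'1: "norm a' = 1" "a' h' = 1" using pos fh by (simp_all add: a'_def blinfun.scaleR_left)
  moreover have "norm h' = 1"
  proof -
    have "1 \<le> norm a' * norm h'" using norm_blinfun[of a' h'] a'1 by simp
    with h' a'1 show ?thesis by simp
  qed
  ultimately show ?thesis using d by (intro that)
qed

section \<open>Positive operators on a complex Banach space\<close>

text \<open>For norming pairs the numbers \<open>l (S z)\<close> are the real parts of the numerical
  range of \<open>S\<close>.\<close>

definition norming :: "('a::real_normed_vector \<Rightarrow>\<^sub>L real) \<Rightarrow> 'a \<Rightarrow> bool" where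
  "norming l z \<longleftrightarrow> norm l = 1 \<and> norm z = 1 \<and> l z = 1"

lemma normingD: "norming l z \<Longrightarrow> norm l = 1" "norming l z \<Longrightarrow> norm z = 1" "norming l z \<Longrightarrow> l z = 1"
  by (simp_all add: norming_def)

lemma blinfun_real_le: "\<bar>blinfun_apply l x\<bar> \<le> norm l * norm x" for l :: "'a::real_normed_vector \<Rightarrow>\<^sub>L real"
  using norm_blinfun[of l x] by simp

lemma normingI:
  assumes "norm l \<le> 1" "norm z \<le> 1" "blinfun_apply l z = 1"
  shows "norming l z"
proof -
  have 1: "1 \<le> norm l * norm z" using blinfun_real_le[of l z] assms by simp
  have "norm l * norm z \<le> norm z" "norm l * norm z \<le> norm l"
    using assms by (simp_all add: mult_left_le mult_left_le_one_le)
  with 1 assms show ?thesis by (simp add: norming_def)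
qed

locale complex_banach =
  fixes J :: "'a::banach \<Rightarrow> 'a"
  assumes complex_structure: "complex_structure J"
begin

abbreviation sc :: "complex \<Rightarrow> 'a \<Rightarrow> 'a" where "sc \<equiv> cscale J"

lemma linear_J: "linear J" and J_J [simp]: "J (J x) = - x"
  and norm_sc [simp]: "norm (sc c x) = cmod c * norm x"
  using complex_structure by (simp_all add: complex_structure_def)

lemma J_add: "J (x + y) = J x + J y" and J_scaleR: "J (r *\<^sub>R x) = r *\<^sub>R J x"
  and J_diff: "J (x - y) = J x - J y" and J_minus: "J (- x) = - J x" and J_zero [simp]: "J 0 = 0"
  using linear_J by (simp_all add: linear_add linear_scale linear_diff linear_neg linear_0)

lemma sc_i: "sc \<i> x = J x" by (simp add: cscale_def)

lemma norm_J [simp]: "norm (J x) = norm x"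
  using norm_sc[of \<i> x] by (simp add: sc_i del: norm_sc)

lemma bounded_linear_J: "bounded_linear J"
  unfolding bounded_linear_def bounded_linear_axioms_def
  using linear_J by (auto intro!: exI[of _ 1])

lemma sc_add_right: "sc c (x + y) = sc c x + sc c y"
  by (simp add: cscale_def J_add algebra_simps)
lemma sc_diff_right: "sc c (x - y) = sc c x - sc c y"
  by (simp add: cscale_def J_diff algebra_simps)
lemma sc_add_left: "sc (c + d) x = sc c x + sc d x"
  by (simp add: cscale_def algebra_simps)
lemma sc_sc: "sc c (sc d x) = sc (c * d) x"
  by (simp add: cscale_def J_add J_scaleR algebra_simps)
lemma sc_of_real [simp]: "sc (of_real r) x = r *\<^sub>R x"
  by (simp add: cscale_def)
lemma sc_one [simp]: "sc 1 x = x"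
  using sc_of_real[of 1] by simp
lemma sc_zero [simp]: "sc 0 x = 0" "sc c 0 = 0"
  by (simp_all add: cscale_def)
lemma sc_minus_left: "sc (- c) x = - sc c x"
  by (simp add: cscale_def)
lemma sc_scaleR: "sc c (r *\<^sub>R x) = r *\<^sub>R sc c x"
  by (simp add: cscale_def J_scaleR algebra_simps)

section \<open>Complex functionals and numerical ranges\<close>

text \<open>The complex-linear functional with real part \<open>l\<close>; the holomorphic functions
  below are built from it.\<close>

definition lc :: "('a \<Rightarrow>\<^sub>L real) \<Rightarrow> 'a \<Rightarrow> complex" where
  "lc l x = Complex (l x) (- l (J x))"

lemma Re_lc [simp]: "Re (lc l x) = l x" by (simp add: lc_def)

lemma lc_add: "lc l (x + y) = lc l x + lc l y"
  by (simp add: lc_def J_add blinfun.add_right complex_eq_iff)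
lemma lc_diff: "lc l (x - y) = lc l x - lc l y"
  by (simp add: lc_def J_diff blinfun.diff_right complex_eq_iff)
lemma lc_sc: "lc l (sc c x) = c * lc l x"
  by (simp add: lc_def cscale_def J_add J_scaleR blinfun.add_right blinfun.scaleR_right
      blinfun.diff_right blinfun.minus_right complex_eq_iff algebra_simps)
text \<open>Multiplying \<open>x\<close> by a unimodular \<open>c\<close> makes the value of
  \<open>lc l\<close> real, and there it agrees with \<open>l\<close>.\<close>

lemma norm_lc_le: "cmod (lc l x) \<le> norm l * norm x"
proof (cases "lc l x = 0")
  case False
  define c where "c = cnj (lc l x) / cmod (lc l x)"
  have "c * lc l x = (lc l x * cnj (lc l x)) / cmod (lc l x)" by (simp add: c_def)
  also have "\<dots> = of_real (cmod (lc l x))"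
    unfolding complex_norm_square[symmetric] using False by (simp add: power2_eq_square)
  finally have "lc l (sc c x) = of_real (cmod (lc l x))" by (simp add: lc_sc)
  hence "cmod (lc l x) = l (sc c x)" by (metis Re_complex_of_real Re_lc)
  also have "\<dots> \<le> norm l * norm (sc c x)" using blinfun_real_le[of l "sc c x"] by simp
  also have "norm (sc c x) = norm x" using False by (simp add: c_def norm_divide)
  finally show ?thesis .
qed simp

lemma lc_norming:
  assumes "norming l z"
  shows "lc l z = 1" "l (J z) = 0"
proof -
  have "cmod (lc l z) \<le> 1" using norm_lc_le[of l z] assms by (simp add: norming_def)
  moreover have "Re (lc l z) = 1" using assms by (simp add: norming_def)
  ultimately have "(Im (lc l z))\<^sup>2 \<le> 0" unfolding cmod_def by simp
  hence "Im (lc l z) = 0" by simp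
  with \<open>Re (lc l z) = 1\<close> show "lc l z = 1" by (simp add: complex_eq_iff)
  thus "l (J z) = 0" by (simp add: lc_def complex_eq_iff)
qed

definition clinear :: "('a \<Rightarrow> 'a) \<Rightarrow> bool" where
  "clinear L \<longleftrightarrow> bounded_linear L \<and> (\<forall>x. L (J x) = J (L x))"

lemma clinear_sc: "clinear L \<Longrightarrow> L (sc c x) = sc c (L x)"
  by (auto simp: clinear_def cscale_def bounded_linear.linear linear_add linear_scale)

lemma clinear_bounded_linear: "clinear L \<Longrightarrow> bounded_linear L" by (simp add: clinear_def)

lemma clinear_bound:
  assumes "clinear L"
  obtains K where "K > 0" "\<And>x. norm (L x) \<le> K * norm x"
  using bounded_linear.pos_bounded[of L] assms by (auto simp: clinear_def mult.commute)

text \<open>The two conditions say that \<open>lc l (L z)\<close> is real and nonnegative, so the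
  numerical range lies in the half line.\<close>

definition positive_op :: "('a \<Rightarrow> 'a) \<Rightarrow> bool" where
  "positive_op L \<longleftrightarrow> clinear L \<and> (\<forall>l z. norming l z \<longrightarrow> l (J (L z)) = 0 \<and> 0 \<le> l (L z))"

lemma positive_op_clinear: "positive_op L \<Longrightarrow> clinear L" by (simp add: positive_op_def)

text \<open>A functional norming \<open>x\<close> takes the value \<open>Re c * l (L x)\<close>,
  which is nonnegative, on the added term.\<close>

lemma positive_op_expanding:
  assumes L: "positive_op L" and c: "Re c \<ge> 0"
  shows "norm x \<le> norm (x + sc c (L x))"
proof (cases "x = 0")
  case False
  obtain l :: "'a \<Rightarrow>\<^sub>L real" where l: "norm l \<le> 1" "l x = norm x" by (rule norming_functional)
  define z where "z = (1 / norm x) *\<^sub>R x"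
  have z: "norming l z"
    using False l by (intro normingI) (auto simp: z_def blinfun.scaleR_right)
  have Lx: "L x = norm x *\<^sub>R L z"
    using L False by (simp add: z_def positive_op_def clinear_def bounded_linear.linear linear_scale)
  have "l (L x) \<ge> 0" "l (J (L x)) = 0"
    using L z by (auto simp: Lx positive_op_def J_scaleR blinfun.scaleR_right)
  hence "norm x \<le> l (x + sc c (L x))"
    using c l by (simp add: cscale_def blinfun.add_right blinfun.scaleR_right)
  also have "\<dots> \<le> norm l * norm (x + sc c (L x))" using blinfun_real_le[of l] by (simp add: abs_le_iff)
  also have "\<dots> \<le> norm (x + sc c (L x))" using l by (simp add: mult_left_le_one_le)
  finally show ?thesis .
qed simp

section \<open>Euler steps for the semigroup of a positive operator\<close>

text \<open>One explicit Euler step of complex length \<open>w\<close> for the flow generated by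
  \<open>- L\<close>; n steps of length w / n approximate exp (- w L).\<close>

definition step :: "('a \<Rightarrow> 'a) \<Rightarrow> complex \<Rightarrow> 'a \<Rightarrow> 'a" where
  "step L w x = x - sc w (L x)"

lemma step_commute: "clinear L \<Longrightarrow> step L w (L x) = L (step L w x)"
  by (simp add: step_def clinear_sc clinear_bounded_linear bounded_linear.linear linear_diff)

lemma step_pow_commute: "clinear L \<Longrightarrow> (step L w ^^ n) (L x) = L ((step L w ^^ n) x)"
  by (induction n) (simp_all add: step_commute)

text \<open>The operator 1 + w L expands norms, and applied after 1 - w L it gives 1 - w^2 L^2; so a
  step exceeds norm 1 only to second order.\<close>

lemma norm_step_le:
  assumes L: "positive_op L" and K: "\<And>x. norm (L x) \<le> K * norm x" "K \<ge> 0" and w: "Re w \<ge> 0"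
  shows "norm (step L w x) \<le> (1 + (cmod w * K)\<^sup>2) * norm x"
proof -
  have cl: "clinear L" using L by (rule positive_op_clinear)
  have "norm (step L w x) \<le> norm (step L w x + sc w (L (step L w x)))"
    by (rule positive_op_expanding[OF L w])
  also have "step L w x + sc w (L (step L w x)) = x - sc (w * w) (L (L x))"
    using cl by (simp add: step_def clinear_sc clinear_bounded_linear bounded_linear.linear linear_diff
        sc_diff_right sc_sc)
  also have "norm \<dots> \<le> norm x + (cmod w * cmod w) * norm (L (L x))"
    by (rule order_trans[OF norm_triangle_ineq4]) (simp add: norm_mult)
  also have "\<dots> \<le> norm x + (cmod w * cmod w) * (K * (K * norm x))"
    by (intro add_left_mono mult_left_mono order_trans[OF K(1) mult_left_mono[OF K(1) K(2)]]) simp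
  finally show ?thesis by (simp add: power2_eq_square algebra_simps)
qed

text \<open>The second-order excess of steps of length w / n accumulates over n steps to a factor
  that tends to 1 as n grows.\<close>

lemma norm_step_pow_le:
  assumes L: "positive_op L" and K: "\<And>x. norm (L x) \<le> K * norm x" "K \<ge> 0"
    and w: "Re w \<ge> 0" "cmod w \<le> R" and n: "n > 0" and m: "m \<le> n"
  shows "norm ((step L (w / of_nat n) ^^ m) x) \<le> exp ((R * K)\<^sup>2 / n) * norm x"
proof -
  define q where "q = 1 + (cmod (w / of_nat n) * K)\<^sup>2"
  have q: "q \<ge> 1" by (simp add: q_def)
  have "norm ((step L (w / of_nat n) ^^ m) x) \<le> q ^ m * norm x" for x
  proof (induction m)
    case (Suc m)
    have "Re (w / of_nat n) \<ge> 0" using w by (simp add: Re_divide_of_nat)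
    hence "norm ((step L (w / of_nat n) ^^ Suc m) x) \<le> q * norm ((step L (w / of_nat n) ^^ m) x)"
      unfolding q_def using norm_step_le[OF L K] by simp
    also have "\<dots> \<le> q * (q ^ m * norm x)" using Suc q by (intro mult_left_mono) auto
    finally show ?case by (simp add: mult.assoc)
  qed simp
  also have "q ^ m * norm x \<le> q ^ n * norm x"
    using q m by (intro mult_right_mono power_increasing) auto
  also have "q ^ n \<le> exp ((cmod (w / of_nat n) * K)\<^sup>2) ^ n"
    unfolding q_def by (intro power_mono exp_ge_add_one_self) auto
  also have "\<dots> = exp ((cmod w * K)\<^sup>2 / n)"
    using n by (simp add: norm_divide power2_eq_square field_simps flip: exp_of_nat_mult)
  also have "\<dots> \<le> exp ((R * K)\<^sup>2 / n)"
    using w K by (intro exp_mono divide_right_mono power_mono mult_right_mono) auto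
  finally show ?thesis by (simp add: mult_right_mono)
qed

text \<open>The induction varies \<open>l\<close>, because the outermost step composes
  \<open>l\<close> with \<open>L\<close>.\<close>

lemma step_pow_deriv:
  assumes L: "clinear L"
  shows "((\<lambda>w. lc l ((step L w ^^ n) x)) has_field_derivative
    - of_nat n * lc l (L ((step L w ^^ (n - 1)) x))) (at w)"
proof (induction n arbitrary: l)
  case (Suc n)
  define l' where "l' = l o\<^sub>L Blinfun L"
  have l': "lc l' y = lc l (L y)" for y
    using L by (simp add: l'_def lc_def clinear_def bounded_linear_Blinfun_apply)
  have eq: "lc l ((step L w ^^ Suc n) x) = lc l ((step L w ^^ n) x) - w * lc l' ((step L w ^^ n) x)" for w
    by (simp add: step_def[of _ _ "(step L w ^^ n) x"] lc_diff lc_sc l')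
  have key: "- of_nat n * lc l (L ((step L w ^^ (n - 1)) x))
      - (lc l' ((step L w ^^ n) x) + w * (- of_nat n * lc l' (L ((step L w ^^ (n - 1)) x))))
      = - of_nat (Suc n) * lc l (L ((step L w ^^ n) x))"
  proof (cases n)
    case (Suc k)
    have R: "lc l (L ((step L w ^^ n) x)) = lc l (L ((step L w ^^ k) x)) - w * lc l' (L ((step L w ^^ k) x))"
      using L by (simp add: Suc l' step_def[of _ _ "(step L w ^^ k) x"] lc_diff lc_sc clinear_sc
          clinear_bounded_linear bounded_linear.linear linear_diff)
    have *: "- of_nat n * P - (R + w * (- of_nat n * Q)) = - of_nat (Suc n) * R"
      if "R = P - w * Q" for P Q R :: complex
      by (simp add: that algebra_simps)
    have "n - 1 = k" using Suc by simp
    thus ?thesis using *[OF R] by (simp only: l')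
  qed (simp add: l')
  have "((\<lambda>w. lc l ((step L w ^^ n) x) - w * lc l' ((step L w ^^ n) x)) has_field_derivative
      - of_nat n * lc l (L ((step L w ^^ (n - 1)) x))
      - (lc l' ((step L w ^^ n) x) + w * (- of_nat n * lc l' (L ((step L w ^^ (n - 1)) x))))) (at w)"
    by (rule derivative_eq_intros Suc refl | simp)+
  thus ?case unfolding eq key by simp
qed simp

lemma step_pow_scaled_deriv:
  assumes L: "clinear L" and n: "n > 0"
  shows "((\<lambda>w. lc l ((step L (w / of_nat n) ^^ n) x)) has_field_derivative
    - lc l (L ((step L (w / of_nat n) ^^ (n - 1)) x))) (at w)"
proof -
  have "((\<lambda>w. w / of_nat n) has_field_derivative 1 / of_nat n) (at w)"
    using n by (auto intro!: derivative_eq_intros)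
  note D = DERIV_chain2[where f = "\<lambda>w. lc l ((step L w ^^ n) x)", OF step_pow_deriv[OF L] this]
  have "of_nat n \<noteq> (0 :: complex)" using n by simp
  hence "- of_nat n * X * (1 / of_nat n) = - X" for X :: complex by (simp add: field_simps)
  with D show ?thesis by metis
qed

text \<open>Cauchy's estimate in a disc tangent to the imaginary axis; in the limit it says
  that the semigroup generated by a positive operator satisfies norm (L exp (- s L)) <= 1 / s.\<close>
lemma norm_L_step_pow_le:
  assumes L: "positive_op L" and K: "\<And>x. norm (L x) \<le> K * norm x" "K \<ge> 0"
    and w: "Re w > 0" "cmod w + Re w \<le> R" and n: "n > 0"
  shows "norm (L ((step L (w / of_nat n) ^^ (n - 1)) x)) \<le> exp ((R * K)\<^sup>2 / n) * norm x / Re w"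
proof -
  have cl: "clinear L" using L by (rule positive_op_clinear)
  let ?y = "L ((step L (w / of_nat n) ^^ (n - 1)) x)"
  obtain l :: "'a \<Rightarrow>\<^sub>L real" where l: "norm l \<le> 1" "l ?y = norm ?y" by (rule norming_functional)
  define F where "F v = lc l ((step L (v / of_nat n) ^^ n) x)" for v
  have D: "(F has_field_derivative - lc l (L ((step L (v / of_nat n) ^^ (n - 1)) x))) (at v)" for v
    unfolding F_def by (rule step_pow_scaled_deriv[OF cl n])
  have "F holomorphic_on UNIV"
    unfolding holomorphic_on_def field_differentiable_def using D has_field_derivative_at_within by blast
  hence hol: "F holomorphic_on S" and cont: "continuous_on S F" for S
    by (auto intro: holomorphic_on_subset holomorphic_on_imp_continuous_on continuous_on_subset)
  have "norm ((deriv ^^ 1) F w) \<le> fact 1 * (exp ((R * K)\<^sup>2 / n) * norm x) / Re w ^ 1"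
  proof (rule Cauchy_inequality[OF hol cont w(1)])
    fix v assume v: "cmod (w - v) = Re w"
    have "Re (w - v) \<le> Re w" using complex_Re_le_cmod[of "w - v"] v by simp
    hence v0: "Re v \<ge> 0" by simp
    have v1: "cmod v \<le> R" using w(2) norm_triangle_sub[of v w] v by (simp add: norm_minus_commute)
    have "cmod (F v) \<le> norm l * norm ((step L (v / of_nat n) ^^ n) x)" unfolding F_def by (rule norm_lc_le)
    also have "\<dots> \<le> norm ((step L (v / of_nat n) ^^ n) x)" using l by (simp add: mult_left_le_one_le)
    also have "\<dots> \<le> exp ((R * K)\<^sup>2 / n) * norm x" by (rule norm_step_pow_le[OF L K v0 v1 n order_refl])
    finally show "cmod (F v) \<le> exp ((R * K)\<^sup>2 / n) * norm x" .
  qed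
  moreover have "deriv F w = - lc l ?y" using D by (rule DERIV_imp_deriv)
  ultimately have "cmod (lc l ?y) \<le> exp ((R * K)\<^sup>2 / n) * norm x / Re w" by simp
  moreover have "norm ?y \<le> cmod (lc l ?y)" using l complex_Re_le_cmod[of "lc l ?y"] by simp
  ultimately show ?thesis by simp
qed

lemma exp_over_nat_le:
  fixes C :: real
  assumes "q > 1"
  obtains N where "\<And>n. n \<ge> N \<Longrightarrow> n > 0 \<and> exp (C / real n) \<le> q"
proof -
  have "(\<lambda>n. exp (C / real n)) \<longlonglongrightarrow> exp 0"
    by (intro tendsto_exp tendsto_divide_0[OF tendsto_const] filterlim_compose[OF filterlim_real_at_infinity_sequentially] filterlim_ident)
  hence "eventually (\<lambda>n. exp (C / real n) < q) sequentially"
    using assms by (intro order_tendstoD) auto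
  hence "eventually (\<lambda>n. n > 0 \<and> exp (C / real n) \<le> q) sequentially"
    using eventually_gt_at_top[of 0] by eventually_elim simp
  thus ?thesis using that by (auto simp: eventually_sequentially)
qed

text \<open>The bound for \<open>3 * m\<close> steps prepares \<open>step_pow_small\<close>, where a
  cube turns m steps into 3 m; the bound for \<open>m\<close> steps controls the remainders in
  \<open>norming_cube\<close>.\<close>

lemma positive_op_decay:
  assumes L: "positive_op L" and e: "e > 0"
  obtains t m where "\<And>x. norm (L ((step L (of_real t) ^^ (3 * m)) x)) \<le> e * norm x"
    "\<And>x. norm ((step L (of_real t) ^^ m) x) \<le> 2 * norm x"
proof -
  obtain K where K: "K > 0" "\<And>x. norm (L x) \<le> K * norm x"
    using clinear_bound[OF positive_op_clinear[OF L]] by blast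
  define s where "s = 2 / e"
  have s: "s > 0" using e by (simp add: s_def)
  obtain N where N: "\<And>n. n \<ge> N \<Longrightarrow> n > 0 \<and> exp ((2 * s * K)\<^sup>2 / real n) \<le> 2"
    by (rule exp_over_nat_le[of 2]) auto
  \<comment> \<open>With n = 3 N + 1 the n - 1 steps left by differentiation are divisible by
    three.\<close>
  define n where "n = 3 * N + 1"
  have n: "n > 0" "exp ((2 * s * K)\<^sup>2 / real n) \<le> 2" "n - 1 = 3 * N" using N[of n] by (simp_all add: n_def)
  have tn: "of_real (s / n) = (of_real s / of_nat n :: complex)" by simp
  show ?thesis
  proof (rule that[of N "s / n"]; unfold tn)
    fix x
    have "norm (L ((step L (of_real s / of_nat n) ^^ (n - 1)) x)) \<le> exp ((2 * s * K)\<^sup>2 / n) * norm x / Re (of_real s)"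
      using s K by (intro norm_L_step_pow_le[OF L]) (auto simp: n)
    also have "\<dots> \<le> 2 * norm x / s" using n s by (simp add: divide_right_mono mult_right_mono)
    also have "\<dots> = e * norm x" using e by (simp add: s_def)
    finally show "norm (L ((step L (of_real s / of_nat n) ^^ (3 * N)) x)) \<le> e * norm x" unfolding n(3) .
    have "norm ((step L (of_real s / of_nat n) ^^ N) x) \<le> exp ((2 * s * K)\<^sup>2 / n) * norm x"
      using s K by (intro norm_step_pow_le[OF L]) (auto simp: n_def)
    also have "\<dots> \<le> 2 * norm x" using n by (simp add: mult_right_mono)
    finally show "norm ((step L (of_real s / of_nat n) ^^ N) x) \<le> 2 * norm x" .
  qed
qed

text \<open>The remainder beyond first order is dominated by that of the scalar polynomial
  \<open>(1 + t * K)^n\<close>.\<close>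

lemma step_pow_taylor:
  assumes L: "clinear L" and K: "\<And>x. norm (L x) \<le> K * norm x" "K \<ge> 0" and t: "t \<ge> 0"
  shows "norm ((step L (of_real t) ^^ n) z - z + (n * t) *\<^sub>R L z) \<le> ((1 + t * K)^n - 1 - n * (t * K)) * norm z"
proof (induction n)
  case (Suc n)
  have bl: "linear L" using L by (simp add: clinear_bounded_linear bounded_linear.linear)
  let ?y = "(step L (of_real t) ^^ n) z - z + (n * t) *\<^sub>R L z"
  have eq: "(step L (of_real t) ^^ Suc n) z - z + (Suc n * t) *\<^sub>R L z = ?y - t *\<^sub>R L ?y + (n * t * t) *\<^sub>R L (L z)"
    by (simp add: step_def[of _ _ "(step L (of_real t) ^^ n) z"] linear_add[OF bl] linear_diff[OF bl]
        linear_scale[OF bl] algebra_simps)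
  have "norm (?y - t *\<^sub>R L ?y + (n * t * t) *\<^sub>R L (L z)) \<le> norm (?y - t *\<^sub>R L ?y) + norm ((n * t * t) *\<^sub>R L (L z))"
    by (rule norm_triangle_ineq)
  also have "norm (?y - t *\<^sub>R L ?y) \<le> norm ?y + t * norm (L ?y)"
    using norm_triangle_ineq4[of ?y "t *\<^sub>R L ?y"] t by simp
  also have "t * norm (L ?y) \<le> t * (K * norm ?y)" using K t by (intro mult_left_mono) auto
  also have "norm ?y + t * (K * norm ?y) = (1 + t * K) * norm ?y" by (simp add: algebra_simps)
  also have "\<dots> \<le> (1 + t * K) * (((1 + t * K)^n - 1 - n * (t * K)) * norm z)"
    using Suc K t by (intro mult_left_mono) auto
  also have "norm ((n * t * t) *\<^sub>R L (L z)) \<le> (n * t * t) * (K * (K * norm z))"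
    using t order_trans[OF K(1) mult_left_mono[OF K(1) K(2)], of z] by (simp add: mult_left_mono)
  finally show ?case unfolding eq by (simp add: algebra_simps)
qed simp

text \<open>Three lines argument for the function l (exp (- w L) z), with the exponential replaced by
  (1 - w L / n) ^ n so that only polynomials occur.\<close>
lemma positive_op_growth:
  assumes L: "positive_op L" and r: "r > 0" "\<And>x. norm x \<le> r * norm (L x)"
    and K: "K > 0" "\<And>x. norm (L x) \<le> K * norm x"
    and lz: "norming l z" and t: "0 < t" "t \<le> 4 * r" "t * K \<le> 1"
  shows "exp (ln 2 / (4 * r) * t) * (1 - t * l (L z) - (t * K)\<^sup>2) \<le> 1"
proof (rule field_le_epsilon)
  fix e :: real assume e: "e > 0"
  have cl: "clinear L" using L by (rule positive_op_clinear)
  have K0: "K \<ge> 0" using K by simp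
  define d where "d = min 1 (e / 3)"
  have d: "d > 0" "d \<le> 1" "3 * d \<le> e" using e by (auto simp: d_def)
  define \<epsilon> where "\<epsilon> = d / t"
  have eps: "\<epsilon> > 0" using d t by (simp add: \<epsilon>_def)
  \<comment> \<open>On the line Re w = s the lower bound on \<open>L\<close> and the Cauchy estimate
    give \<open>q * q / 4\<close>, at most \<open>q / 2\<close>, for \<open>F\<close>. The width 4 r
    of the strip is chosen for this gain of 2, which the factor exp (w ln 2 / s) in \<open>g\<close>
    uses up.\<close>
  define s where "s = 4 * r"
  have s: "s > 0" using r by (simp add: s_def)
  \<comment> \<open>At this height the damping denominator of \<open>g\<close> has modulus at least
    2, which outweighs the exponential factor on the horizontal sides.\<close>
  define Y where "Y = 2 / \<epsilon>"
  have Y: "Y > 0" using eps by (simp add: Y_def)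
  define R where "R = 2 * s + Y"
  define q where "q = 1 + d"
  have q: "1 < q" "q \<le> 2" using d by (simp_all add: q_def)
  obtain n where n: "n > 0" "exp ((R * K)\<^sup>2 / real n) \<le> q"
    using exp_over_nat_le[OF q(1)] by (metis order_refl)
  define F where "F w = lc l ((step L (w / of_nat n) ^^ n) z)" for w
  define g where "g w = exp (of_real (ln 2 / s) * w) * F w / (1 + of_real \<epsilon> * w)" for w
  define S where "S = cbox (Complex 0 (-Y)) (Complex s Y)"
  have SD: "0 \<le> Re w \<and> Re w \<le> s \<and> - Y \<le> Im w \<and> Im w \<le> Y" if "w \<in> S" for w
    using that by (auto simp: S_def in_cbox_complex_iff)
  have nw: "cmod w + Re w \<le> R" if "w \<in> S" for w
    using SD[OF that] cmod_le[of w] unfolding R_def by linarith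
  have F1: "cmod (F w) \<le> q" if "w \<in> S" for w
  proof -
    have "cmod (F w) \<le> norm l * norm ((step L (w / of_nat n) ^^ n) z)" unfolding F_def by (rule norm_lc_le)
    also have "\<dots> \<le> 1 * (exp ((R * K)\<^sup>2 / n) * norm z)"
      using SD[OF that] nw[OF that] lz K n
      by (intro mult_mono norm_step_pow_le[OF L]) (auto simp: norming_def)
    finally show ?thesis using n lz by (simp add: norming_def)
  qed
  have F2: "cmod (F w) \<le> q / 2" if "w \<in> S" "Re w = s" for w
  proof -
    let ?B = "step L (w / of_nat n)"
    have st: "norm (?B z) \<le> q * norm z"
    proof -
      have "norm ((?B ^^ 1) z) \<le> exp ((R * K)\<^sup>2 / n) * norm z"
        using SD[OF that(1)] nw[OF that(1)] K n by (intro norm_step_pow_le[OF L]) auto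
      also have "\<dots> \<le> q * norm z" using n by (intro mult_right_mono) auto
      finally show ?thesis by simp
    qed
    \<comment> \<open>One step is split off, since the Cauchy estimate concerns n - 1 steps.\<close>
    have "(?B ^^ n) z = (?B ^^ (n - 1)) (?B z)"
      using n by (cases n) (simp_all add: funpow_Suc_right del: funpow.simps)
    hence "norm ((?B ^^ n) z) \<le> r * norm (L ((?B ^^ (n - 1)) (?B z)))" using r(2) by metis
    also have "\<dots> \<le> r * (exp ((R * K)\<^sup>2 / n) * norm (?B z) / Re w)"
      using that s nw[OF that(1)] r n K by (intro mult_left_mono norm_L_step_pow_le[OF L]) auto
    also have "\<dots> \<le> r * (q * (q * norm z) / Re w)"
      using n r st q that s by (intro mult_left_mono divide_right_mono mult_mono) auto
    also have "\<dots> = q * q / 4" using lz r by (simp add: that s_def norming_def)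
    also have "\<dots> \<le> q / 2" using q by simp
    finally have "norm ((?B ^^ n) z) \<le> q / 2" .
    thus ?thesis unfolding F_def using norm_lc_le[of l "(?B ^^ n) z"] lz by (simp add: norming_def)
  qed
  have den: "cmod (1 + of_real \<epsilon> * w) \<ge> 1" if "w \<in> S" for w
  proof -
    have "1 \<le> Re (1 + of_real \<epsilon> * w)" using SD[OF that] eps by simp
    thus ?thesis using complex_Re_le_cmod order_trans by blast
  qed
  have ex: "cmod (exp (of_real (ln 2 / s) * w)) = exp (ln 2 / s * Re w)" for w
    by (simp add: norm_exp_eq_Re)
  have gn: "cmod (g w) = exp (ln 2 / s * Re w) * cmod (F w) / cmod (1 + of_real \<epsilon> * w)" for w
    by (simp add: g_def norm_mult norm_divide norm_exp_eq_Re)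
  have hol: "g holomorphic_on S"
  proof -
    have "F holomorphic_on S"
      unfolding holomorphic_on_def field_differentiable_def F_def
      using step_pow_scaled_deriv[OF cl n(1)] has_field_derivative_at_within by blast
    moreover have "1 + of_real \<epsilon> * w \<noteq> 0" if "w \<in> S" for w using den[OF that] by auto
    ultimately show ?thesis unfolding g_def by (intro holomorphic_intros) auto
  qed
  have "cmod (g (of_real t)) \<le> q"
  proof (rule maximum_modulus_frontier[of g S])
    show "g holomorphic_on interior S" using hol interior_subset by (rule holomorphic_on_subset)
    show "continuous_on (closure S) g" using hol by (simp add: S_def holomorphic_on_imp_continuous_on)
    show "bounded S" by (simp add: S_def)
    show "of_real t \<in> S" using t Y by (simp add: S_def in_cbox_complex_iff s_def)
    fix w assume "w \<in> frontier S"
    hence w: "w \<in> S" and nb: "w \<notin> box (Complex 0 (-Y)) (Complex s Y)"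
      by (simp_all add: S_def frontier_cbox)
    from nb SD[OF w] consider "Re w = 0" | "Re w = s" | "\<bar>Im w\<bar> = Y"
      by (fastforce simp: in_box_complex_iff)
    thus "cmod (g w) \<le> q"
    proof cases
      case 1
      have "cmod (g w) \<le> cmod (F w) / 1"
        unfolding gn using 1 den[OF w] by (intro frac_le) auto
      with F1[OF w] show ?thesis by simp
    next
      case 2
      have "cmod (g w) \<le> 2 * cmod (F w) / 1"
        unfolding gn using 2 den[OF w] s by (intro frac_le) auto
      with F2[OF w 2] show ?thesis by simp
    next
      case 3
      have "exp (ln 2 / s * Re w) \<le> exp (ln 2 / s * s)"
        using SD[OF w] s by (intro exp_mono mult_left_mono) auto
      hence e2: "exp (ln 2 / s * Re w) \<le> 2" using s by simp
      have "\<bar>Im (1 + of_real \<epsilon> * w)\<bar> = 2" using 3 eps by (simp add: abs_mult Y_def)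
      hence "cmod (1 + of_real \<epsilon> * w) \<ge> 2" using abs_Im_le_cmod by metis
      hence "cmod (g w) \<le> 2 * q / 2"
        unfolding gn using e2 F1[OF w] q by (intro frac_le mult_mono) auto
      thus ?thesis by simp
    qed
  qed
  hence "exp (ln 2 / s * t) * cmod (F (of_real t)) \<le> q * cmod (1 + of_real \<epsilon> * of_real t)"
  proof -
    have "cmod (1 + of_real \<epsilon> * of_real t) > 0"
      using eps t by (metis abs_of_pos add_pos_pos mult_pos_pos norm_of_real of_real_1 of_real_add of_real_mult zero_less_one)
    with \<open>cmod (g (of_real t)) \<le> q\<close> show ?thesis unfolding gn by (simp add: pos_divide_le_eq)
  qed
  also have "cmod (1 + of_real \<epsilon> * of_real t) = 1 + \<epsilon> * t"
    using eps t by (metis abs_of_pos add_pos_pos mult_pos_pos norm_of_real of_real_1 of_real_add of_real_mult zero_less_one)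
  also have "q * (1 + \<epsilon> * t) = (1 + d) * (1 + d)" using t by (simp add: q_def \<epsilon>_def)
  also have "\<dots> \<le> 1 + e"
  proof -
    have "d * d \<le> d" using d by (intro mult_left_le) auto
    moreover have "(1 + d) * (1 + d) = 1 + 2 * d + d * d" by (simp add: algebra_simps)
    ultimately show ?thesis using d by linarith
  qed
  finally have up: "exp (ln 2 / s * t) * cmod (F (of_real t)) \<le> 1 + e" .
  have "1 - t * l (L z) - (t * K)\<^sup>2 \<le> cmod (F (of_real t))"
  proof -
    let ?y = "(step L (of_real (t / n)) ^^ n) z"
    have nt: "real n * (t / n) = t" using n by simp
    have "norm (?y - z + (n * (t / n)) *\<^sub>R L z) \<le> ((1 + t / n * K)^n - 1 - n * (t / n * K)) * norm z"
      using t by (intro step_pow_taylor[OF cl K(2) K0]) simp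
    also have "(1 + t / n * K)^n \<le> exp (t / n * K) ^ n"
      using t K by (intro power_mono exp_ge_add_one_self) auto
    also have "exp (t / n * K) ^ n = exp (t * K)"
      using n by (simp flip: exp_of_nat_mult)
    also have "exp (t * K) \<le> 1 + t * K + (t * K)\<^sup>2"
      using t K by (intro exp_bound) auto
    also have "n * (t / n * K) = t * K" using n by simp
    finally have "norm (?y - z + t *\<^sub>R L z) \<le> (t * K)\<^sup>2"
      using lz nt by (simp add: norming_def mult_right_mono)
    moreover have "- l (?y - z + t *\<^sub>R L z) \<le> norm (?y - z + t *\<^sub>R L z)"
      using blinfun_real_le[of l "?y - z + t *\<^sub>R L z"] lz by (simp add: norming_def)
    ultimately have "1 - t * l (L z) - (t * K)\<^sup>2 \<le> l ?y"
      using lz by (simp add: norming_def blinfun.add_right blinfun.diff_right blinfun.scaleR_right)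
    also have "l ?y \<le> cmod (F (of_real t))"
      unfolding F_def using complex_Re_le_cmod[of "lc l ?y"] by simp
    finally show ?thesis .
  qed
  hence "exp (ln 2 / s * t) * (1 - t * l (L z) - (t * K)\<^sup>2) \<le> exp (ln 2 / s * t) * cmod (F (of_real t))"
    by (intro mult_left_mono) auto
  with up show "exp (ln 2 / (4 * r) * t) * (1 - t * l (L z) - (t * K)\<^sup>2) \<le> 1 + e"
    unfolding s_def[symmetric] by linarith
qed

text \<open>To first order in t, \<open>positive_op_growth\<close> reads (1 + k t) (1 - t a) \<le> 1
  with k = ln 2 / (4 r), which forces a \<ge> k. The constant \<open>M\<close> collects the
  higher-order terms, and t is so small that they cost at most k / 2.\<close>

lemma positive_op_gap:
  assumes L: "positive_op L" and r: "r > 0" "\<And>x. norm x \<le> r * norm (L x)"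
  obtains \<kappa> where "\<kappa> > 0" "\<And>l z. norming l z \<Longrightarrow> \<kappa> \<le> l (L z)"
proof -
  obtain K where K: "K > 0" "\<And>x. norm (L x) \<le> K * norm x"
    using clinear_bound[OF positive_op_clinear[OF L]] by blast
  define k where "k = ln 2 / (4 * r)"
  have k: "k > 0" using r by (simp add: k_def)
  define M where "M = K\<^sup>2 + 2 * k * K"
  have M: "M > 0" using K k by (simp add: M_def add_pos_pos)
  define t where "t = min (4 * r) (min (1 / K) (k / 2 / M))"
  have t: "0 < t" "t \<le> 4 * r" "t * K \<le> 1" "t * M \<le> k / 2"
  proof -
    show "0 < t" "t \<le> 4 * r" using r K k M by (auto simp: t_def)
    have "t \<le> 1 / K" "t \<le> k / 2 / M" by (auto simp: t_def)
    thus "t * K \<le> 1" "t * M \<le> k / 2" using K M by (simp_all add: pos_le_divide_eq)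
  qed
  have "k / 2 \<le> l (L z)" if lz: "norming l z" for l z
  proof -
    define a where "a = l (L z)"
    have a0: "a \<ge> 0" using L lz by (simp add: a_def positive_op_def)
    have aK: "a \<le> K"
      using blinfun_real_le[of l "L z"] K(2)[of z] lz by (simp add: a_def norming_def)
    have 1: "exp (k * t) * (1 - t * a - (t * K)\<^sup>2) \<le> 1"
      unfolding a_def k_def by (rule positive_op_growth[OF L r K lz t(1-3)])
    have "(1 + k * t) * (1 - t * a - (t * K)\<^sup>2) \<le> 1"
    proof (cases "1 - t * a - (t * K)\<^sup>2 \<ge> 0")
      case True
      have "(1 + k * t) * (1 - t * a - (t * K)\<^sup>2) \<le> exp (k * t) * (1 - t * a - (t * K)\<^sup>2)"
        using True by (intro mult_right_mono exp_ge_add_one_self) auto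
      with 1 show ?thesis by simp
    next
      case False
      hence "(1 + k * t) * (1 - t * a - (t * K)\<^sup>2) \<le> 0"
        using k t by (intro mult_nonneg_nonpos) auto
      thus ?thesis by simp
    qed
    hence "t * k \<le> t * (a + t * K\<^sup>2 + k * (t * a) + k * t * (t * K\<^sup>2))"
      by (simp add: algebra_simps power2_eq_square)
    hence "k \<le> a + t * K\<^sup>2 + k * (t * a) + k * t * (t * K\<^sup>2)" using t by simp
    also have "\<dots> \<le> a + t * K\<^sup>2 + k * (t * K) + k * t * (1 * K)"
    proof -
      have "t * K\<^sup>2 \<le> 1 * K" using mult_right_mono[OF t(3), of K] K by (simp add: power2_eq_square mult.assoc)
      thus ?thesis using aK k t by (intro add_mono mult_left_mono) auto
    qed
    also have "\<dots> = a + t * M" by (simp add: M_def algebra_simps)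
    finally show ?thesis using t(4) by (simp add: a_def)
  qed
  thus ?thesis using that[of "k / 2"] k by simp
qed

section \<open>Hermitian operators\<close>

lemma norm_bpow_le:
  fixes S :: "'a \<Rightarrow>\<^sub>L 'a"
  shows "norm (bpow S n) \<le> norm S ^ n"
proof (induction n)
  case 0
  have "norm (id_blinfun :: 'a \<Rightarrow>\<^sub>L 'a) \<le> 1" by (rule norm_blinfun_bound) auto
  thus ?case by (simp add: bpow_def)
next
  case (Suc n)
  have "norm (bpow S (Suc n)) \<le> norm S * norm (bpow S n)"
    using norm_blinfun_compose[of S "bpow S n"] by (simp add: bpow_def)
  also have "\<dots> \<le> norm S * norm S ^ n" using Suc by (intro mult_left_mono) auto
  finally show ?case by simp
qed

lemma norm_bexp_taylor:
  fixes S :: "'a \<Rightarrow>\<^sub>L 'a"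
  assumes S: "norm S \<le> 1"
  shows "norm (bexp S - id_blinfun - S) \<le> (norm S)\<^sup>2"
proof -
  let ?f = "\<lambda>n. (1 / fact n) *\<^sub>R bpow S n"
  have se: "summable (\<lambda>n. norm S ^ n / fact n)"
    using summable_exp[of "norm S"] by (simp add: field_simps)
  have nf: "norm (?f n) \<le> norm S ^ n / fact n" for n
    using norm_bpow_le[of S n] by (simp add: divide_right_mono)
  have sf: "summable (\<lambda>n. norm (?f n))"
    by (rule summable_comparison_test'[where N = 0, OF se]) (use nf in simp)
  hence sf': "summable ?f" by (rule summable_norm_cancel)
  have "bexp S = (\<Sum>n. ?f (n + 2)) + (\<Sum>n<2. ?f n)"
    unfolding bexp_def by (rule suminf_split_initial_segment[OF sf'])
  moreover have "(\<Sum>n<2. ?f n) = id_blinfun + S"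
  proof -
    have "S o\<^sub>L id_blinfun = S" by (rule blinfun_eqI) simp
    thus ?thesis by (simp add: numeral_2_eq_2 bpow_def)
  qed
  ultimately have "bexp S - id_blinfun - S = (\<Sum>n. ?f (n + 2))" by simp
  also have "norm \<dots> \<le> (\<Sum>n. norm (?f (n + 2)))"
    by (rule summable_norm[OF summable_ignore_initial_segment[OF sf]])
  also have "\<dots> \<le> (\<Sum>n. norm S ^ (n + 2) / fact (n + 2))"
    by (rule suminf_le[OF nf summable_ignore_initial_segment[OF sf] summable_ignore_initial_segment[OF se]])
  also have "\<dots> = exp (norm S) - 1 - norm S"
  proof -
    have "exp (norm S) = (\<Sum>n. norm S ^ (n + 2) / fact (n + 2)) + (\<Sum>n<2. norm S ^ n / fact n)"
      unfolding exp_def using suminf_split_initial_segment[OF se, of 2]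
      by (simp add: divide_inverse mult.commute)
    thus ?thesis by (simp add: numeral_2_eq_2)
  qed
  also have "\<dots> \<le> (norm S)\<^sup>2" using exp_bound[of "norm S"] S by simp
  finally show ?thesis .
qed

text \<open>The exponential of t J S has norm 1 and equals 1 + t J S up to order t^2; evaluated at a
  norming pair for both signs of t, this leaves no first-order term.\<close>

lemma hermitian_norming_zero:
  assumes S: "hermitian J S" and lz: "norming l z"
  shows "l (J (S z)) = 0"
proof -
  have bS: "bounded_linear S" using S by (simp add: hermitian_def)
  define R where "R = Blinfun J o\<^sub>L Blinfun S"
  have R: "R x = J (S x)" for x
    using bS bounded_linear_J by (simp add: R_def bounded_linear_Blinfun_apply)
  define C where "C = norm R + 1"
  have C: "C > 0" "norm R \<le> C" by (simp_all add: C_def add_nonneg_pos)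
  have main: "t * l (R z) \<le> t\<^sup>2 * C\<^sup>2" if t: "\<bar>t\<bar> \<le> 1 / C" for t
  proof -
    have "\<bar>t\<bar> * norm R \<le> (1 / C) * C" using t C by (intro mult_mono) auto
    hence n1: "norm (t *\<^sub>R R) \<le> 1" using C by simp
    have "norm (bexp (t *\<^sub>R R)) = 1" using S by (simp add: hermitian_def R_def)
    hence b1: "norm (bexp (t *\<^sub>R R) z) \<le> 1"
      using norm_blinfun[of "bexp (t *\<^sub>R R)" z] lz by (simp add: norming_def)
    have "norm ((bexp (t *\<^sub>R R) - id_blinfun - t *\<^sub>R R) z) \<le> (norm (t *\<^sub>R R))\<^sup>2 * norm z"
      by (rule order_trans[OF norm_blinfun mult_right_mono[OF norm_bexp_taylor[OF n1]]]) simp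
    hence b2: "norm (bexp (t *\<^sub>R R) z - z - t *\<^sub>R R z) \<le> (\<bar>t\<bar> * norm R)\<^sup>2"
      using lz by (simp add: blinfun.diff_left blinfun.scaleR_left norming_def)
    have "z + t *\<^sub>R R z = bexp (t *\<^sub>R R) z - (bexp (t *\<^sub>R R) z - z - t *\<^sub>R R z)" by simp
    hence "norm (z + t *\<^sub>R R z) \<le> 1 + (\<bar>t\<bar> * norm R)\<^sup>2"
      using norm_triangle_ineq4[of "bexp (t *\<^sub>R R) z" "bexp (t *\<^sub>R R) z - z - t *\<^sub>R R z"] b1 b2
      by (simp add: add.commute)
    moreover have "l (z + t *\<^sub>R R z) \<le> norm (z + t *\<^sub>R R z)"
      using blinfun_real_le[of l "z + t *\<^sub>R R z"] lz by (simp add: norming_def)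
    ultimately have "t * l (R z) \<le> (\<bar>t\<bar> * norm R)\<^sup>2"
      using lz by (simp add: norming_def blinfun.add_right blinfun.scaleR_right)
    also have "\<dots> \<le> (\<bar>t\<bar> * C)\<^sup>2" using C by (intro power_mono mult_left_mono) auto
    finally show ?thesis by (simp add: power_mult_distrib)
  qed
  have "\<bar>l (R z)\<bar> \<le> 0"
  proof (rule field_le_epsilon)
    fix e :: real assume e: "e > 0"
    define t where "t = min (1 / C) (e / C\<^sup>2)"
    have t: "t > 0" "t \<le> 1 / C" "t * C\<^sup>2 \<le> e"
    proof -
      show "t > 0" "t \<le> 1 / C" using C e by (auto simp: t_def)
      have "t \<le> e / C\<^sup>2" by (simp add: t_def)
      thus "t * C\<^sup>2 \<le> e" using C by (simp add: pos_le_divide_eq)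
    qed
    have "t * \<bar>l (R z)\<bar> \<le> t * (t * C\<^sup>2)"
      using main[of t] main[of "- t"] t by (cases "l (R z) \<ge> 0") (auto simp: power2_eq_square)
    hence "\<bar>l (R z)\<bar> \<le> t * C\<^sup>2" using t by simp
    thus "\<bar>l (R z)\<bar> \<le> 0 + e" using t by simp
  qed
  thus ?thesis by (simp add: R)
qed

text \<open>If the infimum of the numerical range were negative, subtracting it would give a positive
  invertible operator, whose numerical range has a gap above 0.\<close>
theorem hermitian_spectrum_imp_positive_op:
  assumes S: "hermitian J S" and SJ: "\<And>x. S (J x) = J (S x)"
    and sp: "cspectrum J S \<subseteq> {c. Im c = 0 \<and> Re c \<ge> 0}"
  shows "positive_op S"
proof -
  have cl: "clinear S" using S SJ by (simp add: clinear_def hermitian_def)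
  have lin: "linear S" using cl by (simp add: clinear_bounded_linear bounded_linear.linear)
  obtain K where K: "K > 0" "\<And>x. norm (S x) \<le> K * norm x" using clinear_bound[OF cl] by blast
  define N where "N = {blinfun_apply l (S z) | l z. norming l z}"
  have bdd: "bdd_below N"
  proof (rule bdd_belowI[where m = "- K"])
    fix x assume "x \<in> N"
    then obtain l z where lz: "x = blinfun_apply l (S z)" "norming l z" by (auto simp: N_def)
    show "- K \<le> x"
      using blinfun_real_le[of l "S z"] K(2)[of z] lz by (simp add: norming_def)
  qed
  have low: "Inf N \<le> blinfun_apply l (S z)" if "norming l z" for l z
    using that by (intro cInf_lower[OF _ bdd]) (auto simp: N_def)
  have "0 \<le> blinfun_apply l (S z)" if lz: "norming l z" for l z
  proof (rule ccontr)
    assume neg: "\<not> ?thesis"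
    define c where "c = Inf N"
    have c: "c < 0" using low[OF lz] neg by (simp add: c_def)
    define A where "A x = S x - c *\<^sub>R x" for x
    have clA: "clinear A"
      unfolding clinear_def A_def using cl SJ
      by (auto simp: J_diff J_scaleR clinear_def intro!: bounded_linear_sub bounded_linear_scaleR_right)
    have pos: "positive_op A"
      unfolding positive_op_def
    proof (intro conjI allI impI clA)
      fix l :: "'a \<Rightarrow>\<^sub>L real" and z assume "norming l z"
      from hermitian_norming_zero[OF S this] lc_norming(2)[OF this] low[OF this] \<open>norming l z\<close>
      show "blinfun_apply l (J (A z)) = 0" "0 \<le> blinfun_apply l (A z)"
        by (simp_all add: A_def J_diff J_scaleR blinfun.diff_right blinfun.scaleR_right c_def norming_def)
    qed
    have "of_real c \<notin> cspectrum J S" using sp c by auto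
    hence "bij A" by (simp add: cspectrum_def A_def[abs_def])
    then obtain r where r: "r > 0" "\<And>x. norm x \<le> r * norm (A x)"
      using bounded_inverse[OF clinear_bounded_linear[OF clA]] by blast
    obtain \<kappa> where \<kappa>: "\<kappa> > 0" "\<And>l z. norming l z \<Longrightarrow> \<kappa> \<le> blinfun_apply l (A z)"
      using positive_op_gap[OF pos r] by blast
    have "c + \<kappa> \<le> x" if x: "x \<in> N" for x
    proof -
      obtain l z where lz: "x = blinfun_apply l (S z)" "norming l z" using x by (auto simp: N_def)
      from \<kappa>(2)[OF lz(2)] lz show ?thesis
        by (simp add: A_def norming_def blinfun.diff_right blinfun.scaleR_right)
    qed
    hence "c + \<kappa> \<le> Inf N" using lz by (intro cInf_greatest) (auto simp: N_def)
    thus False using \<kappa>(1) by (simp add: c_def)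
  qed
  thus ?thesis using cl hermitian_norming_zero[OF S] by (simp add: positive_op_def)
qed

end

section \<open>JB*-triples\<close>

locale jb_triple = complex_banach J for J :: "'a::banach \<Rightarrow> 'a" +
  fixes tp :: "'a \<Rightarrow> 'a \<Rightarrow> 'a \<Rightarrow> 'a"
  assumes JB_triple: "JB_triple J tp"
begin

lemmas JB_axioms = JB_triple[unfolded JB_triple_def]

lemma tp_sym: "tp x y z = tp z y x"
  by (rule JB_axioms[THEN conjunct2, THEN conjunct2, THEN conjunct1, rule_format])
lemma tp_add1: "tp (x + x') y z = tp x y z + tp x' y z"
  by (rule JB_axioms[THEN conjunct2, THEN conjunct2, THEN conjunct2, THEN conjunct1, rule_format])
lemma tp_add2: "tp x (y + y') z = tp x y z + tp x y' z"
  by (rule JB_axioms[THEN conjunct2, THEN conjunct2, THEN conjunct2, THEN conjunct2, THEN conjunct2, THEN conjunct1, rule_format])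
lemma tp_add3: "tp x y (z + z') = tp x y z + tp x y z'"
  using tp_add1[of z z' y x] by (simp only: tp_sym[of x])
lemma tp_sc1: "tp (sc c x) y z = sc c (tp x y z)"
  by (rule JB_axioms[THEN conjunct2, THEN conjunct2, THEN conjunct2, THEN conjunct2, THEN conjunct1, rule_format])
lemma tp_sc2: "tp x (sc c y) z = sc (cnj c) (tp x y z)"
  by (rule JB_axioms[THEN conjunct2, THEN conjunct2, THEN conjunct2, THEN conjunct2, THEN conjunct2, THEN conjunct2, THEN conjunct1, rule_format])
lemma tp_sc3: "tp x y (sc c z) = sc c (tp x y z)"
  using tp_sc1[of c z y x] by (simp only: tp_sym[of x])
lemma jordan: "tp x y (tp a b z) = tp (tp x y a) b z - tp a (tp y x b) z + tp a b (tp x y z)"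
  by (rule JB_axioms[THEN conjunct2, THEN conjunct2, THEN conjunct2, THEN conjunct2, THEN conjunct2, THEN conjunct2, THEN conjunct2, THEN conjunct1, rule_format])
lemma norm_cube: "norm (tp a a a) = norm a ^ 3"
  by (rule JB_axioms[THEN conjunct2, THEN conjunct2, THEN conjunct2, THEN conjunct2, THEN conjunct2, THEN conjunct2, THEN conjunct2, THEN conjunct2, THEN conjunct2, rule_format])

lemma tp_scaleR1: "tp (r *\<^sub>R x) y z = r *\<^sub>R tp x y z"
  using tp_sc1[of "of_real r"] by simp
lemma tp_scaleR2: "tp x (r *\<^sub>R y) z = r *\<^sub>R tp x y z"
  using tp_sc2[of x "of_real r"] by simp
lemma tp_scaleR3: "tp x y (r *\<^sub>R z) = r *\<^sub>R tp x y z"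
  using tp_sc3[of x y "of_real r"] by simp
lemma tp_J1: "tp (J x) y z = J (tp x y z)"
  using tp_sc1[of \<i>] by (simp add: sc_i)
lemma tp_J2: "tp x (J y) z = - J (tp x y z)"
  using tp_sc2[of x \<i>] by (simp add: sc_i sc_minus_left)
lemma tp_J3: "tp x y (J z) = J (tp x y z)"
  using tp_sc3[of x y \<i>] by (simp add: sc_i)

lemma linear_tp1: "linear (\<lambda>x. tp x y z)" and linear_tp2: "linear (\<lambda>y. tp x y z)" and linear_tp3: "linear (tp x y)"
  by (rule linearI; simp add: tp_add1 tp_add2 tp_add3 tp_scaleR1 tp_scaleR2 tp_scaleR3)+

lemmas tp_diff1 = linear_diff[OF linear_tp1] and tp_diff2 = linear_diff[OF linear_tp2]
  and tp_diff3 = linear_diff[OF linear_tp3]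
lemmas tp_minus1 = linear_neg[OF linear_tp1] and tp_minus2 = linear_neg[OF linear_tp2]
  and tp_minus3 = linear_neg[OF linear_tp3]
lemmas tp_zero1 = linear_0[OF linear_tp1] and tp_zero2 = linear_0[OF linear_tp2]
  and tp_zero3 = linear_0[OF linear_tp3]
lemmas tp_sum1 = linear_sum[OF linear_tp1] and tp_sum2 = linear_sum[OF linear_tp2]
  and tp_sum3 = linear_sum[OF linear_tp3]
lemmas tp_zero [simp] = tp_zero1 tp_zero2 tp_zero3
lemmas tp_linear = tp_add1 tp_add2 tp_add3 tp_diff1 tp_diff2 tp_diff3
  tp_minus1 tp_minus2 tp_minus3 tp_scaleR1 tp_scaleR2 tp_scaleR3

lemma tp_bounded_ex: "\<exists>K\<ge>1. \<forall>x y z. norm (tp x y z) \<le> K * norm x * norm y * norm z"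
proof -
  have "continuous_on UNIV (\<lambda>(x, y, z). tp x y z)"
    by (rule JB_axioms[THEN conjunct2, THEN conjunct1])
  hence "isCont (\<lambda>(x, y, z). tp x y z) (0, 0, 0)" by (simp add: continuous_on_eq_continuous_at)
  then obtain d where d: "d > 0" "\<And>v. dist v (0, 0, 0) < d \<Longrightarrow> dist (case v of (x, y, z) \<Rightarrow> tp x y z) (tp 0 0 0) < 1"
    unfolding continuous_at_eps_delta by (metis (mono_tags, lifting) case_prod_conv zero_less_one)
  define c where "c = d / 4"
  have c: "c > 0" using d by (simp add: c_def)
  have small: "norm (tp x y z) \<le> 1" if "norm x \<le> c" "norm y \<le> c" "norm z \<le> c" for x y z
  proof -
    have "dist (x, y, z) (0, 0, 0) \<le> norm x + (norm y + norm z)"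
      using norm_Pair_le[of x "(y, z)"] norm_Pair_le[of y z] by (simp add: dist_norm)
    also have "\<dots> < d" using that d by (simp add: c_def)
    finally show ?thesis using d(2)[of "(x, y, z)"] by (simp add: dist_norm)
  qed
  define K where "K = max 1 (1 / c ^ 3)"
  have "norm (tp x y z) \<le> K * norm x * norm y * norm z" for x y z
  proof (cases "x = 0 \<or> y = 0 \<or> z = 0")
    case False
    have "norm (tp ((c / norm x) *\<^sub>R x) ((c / norm y) *\<^sub>R y) ((c / norm z) *\<^sub>R z)) \<le> 1"
      using False c by (intro small) auto
    hence "c ^ 3 * norm (tp x y z) \<le> norm x * norm y * norm z"
      using False c by (simp add: tp_scaleR1 tp_scaleR2 tp_scaleR3 field_simps power3_eq_cube)
    hence "norm (tp x y z) \<le> (1 / c ^ 3) * (norm x * norm y * norm z)" using c by (simp add: field_simps)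
    also have "\<dots> \<le> K * (norm x * norm y * norm z)" by (intro mult_right_mono) (auto simp: K_def)
    finally show ?thesis by (simp add: mult.assoc)
  qed auto
  thus ?thesis by (intro exI[of _ K]) (auto simp: K_def)
qed

definition Ktp :: real where
  "Ktp = (SOME K. K \<ge> 1 \<and> (\<forall>x y z. norm (tp x y z) \<le> K * norm x * norm y * norm z))"

lemma Ktp_ge_1: "Ktp \<ge> 1" and norm_tp_le: "norm (tp x y z) \<le> Ktp * norm x * norm y * norm z"
  using someI_ex[OF tp_bounded_ex] by (simp_all add: Ktp_def)

lemma norm_tp_le_mult:
  assumes "norm x \<le> a" "norm y \<le> b" "norm z \<le> c"
  shows "norm (tp x y z) \<le> Ktp * a * b * c"
proof -
  have "norm (tp x y z) \<le> Ktp * (norm x * (norm y * norm z))" using norm_tp_le[of x y z] by (simp add: mult.assoc)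
  also have "\<dots> \<le> Ktp * (a * (b * c))"
    using assms Ktp_ge_1 norm_ge_zero[of x] norm_ge_zero[of y]
    by (intro mult_left_mono mult_mono mult_nonneg_nonneg) (auto intro: order_trans[OF norm_ge_zero])
  finally show ?thesis by (simp add: mult.assoc)
qed

lemma bounded_linear_tp1: "bounded_linear (\<lambda>x. tp x y z)"
  by (rule bounded_linear_intro[where K = "Ktp * norm y * norm z"])
    (use norm_tp_le[of _ y z] in \<open>auto simp: tp_add1 tp_scaleR1 mult_ac\<close>)
lemma bounded_linear_tp2: "bounded_linear (\<lambda>y. tp x y z)"
  by (rule bounded_linear_intro[where K = "Ktp * norm x * norm z"])
    (use norm_tp_le[of x _ z] in \<open>auto simp: tp_add2 tp_scaleR2 mult_ac\<close>)
lemma bounded_linear_tp3: "bounded_linear (tp x y)"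
  by (rule bounded_linear_intro[where K = "Ktp * norm x * norm y"])
    (use norm_tp_le[of x y] in \<open>auto simp: tp_add3 tp_scaleR3 mult_ac\<close>)

lemma positive_op_tp: "positive_op (tp a a)"
proof (rule hermitian_spectrum_imp_positive_op)
  show "hermitian J (tp a a)" "cspectrum J (tp a a) \<subseteq> {c. Im c = 0 \<and> Re c \<ge> 0}"
    using JB_axioms[THEN conjunct2, THEN conjunct2, THEN conjunct2, THEN conjunct2, THEN conjunct2,
        THEN conjunct2, THEN conjunct2, THEN conjunct2, THEN conjunct1] by blast+
qed (rule tp_J3)

lemma clinear_tp: "clinear (tp a b)"
  by (simp add: clinear_def bounded_linear_tp3 tp_J3)

subsection \<open>Powers of one element\<close>

text \<open>\<open>pw z n\<close> is the odd power of \<open>z\<close> with exponent 2 n + 1; hence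
  the shift by 1 in \<open>tp_pw\<close>.\<close>

abbreviation pw :: "'a \<Rightarrow> nat \<Rightarrow> 'a" where "pw z n \<equiv> (tp z z ^^ n) z"

lemma tp_pw_Suc: "tp z z (pw z n) = pw z (Suc n)" by simp

text \<open>Induction on n. By the Jordan identity the products with index sum n + 1 form an
  arithmetic progression whose difference e is the commutator of L(z, z) with L(pw n, z). A second
  instance of the identity shows that the total change (n + 1) e equals - e, so e = 0.\<close>

lemma tp_pw_tp_pw: "i + j = n \<Longrightarrow> tp (pw z i) (pw z j) x = tp (pw z n) z x"
  and tp_pw_commute: "tp z z (tp (pw z n) z x) = tp (pw z n) z (tp z z x)"
proof -
  have P: "\<forall>i j x. i + j = n \<longrightarrow> tp (pw z i) (pw z j) x = tp (pw z n) z x" for n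
  proof (induction n)
    case (Suc n)
    show ?case
    proof (intro allI impI)
      fix i j x assume ij: "i + j = Suc n"
      define e where "e = tp z z (tp (pw z n) z x) - tp (pw z n) z (tp z z x)"
      define d where "d i = tp (pw z i) (pw z (Suc n - i)) x" for i
      have step: "d (Suc i) = d i + e" if "i \<le> n" for i
      proof -
        have s: "i + (n - i) = n" "Suc n - i = Suc (n - i)" using that by simp_all
        have "tp z z (tp (pw z i) (pw z (n - i)) x) = d (Suc i) - d i + tp (pw z i) (pw z (n - i)) (tp z z x)"
          using jordan[of z z "pw z i" "pw z (n - i)" x] s by (simp add: d_def)
        moreover have "tp (pw z i) (pw z (n - i)) y = tp (pw z n) z y" for y using Suc s by blast
        ultimately show ?thesis by (simp add: e_def algebra_simps)
      qed
      have sum: "d i = d 0 + of_nat i *\<^sub>R e" if "i \<le> Suc n" for i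
        using that by (induction i) (simp_all add: step algebra_simps)
      have "tp z (pw z n) z = tp (pw z n) z z" using Suc[rule_format, of 0 n z] by simp
      hence "tp (pw z n) z (tp z z x) = d (Suc n) - d 0 + tp z z (tp (pw z n) z x)"
        using jordan[of "pw z n" z z z x] tp_sym[of "pw z n" z z] by (simp add: d_def)
      hence "d (Suc n) = d 0 - e" by (simp add: e_def algebra_simps)
      with sum[of "Suc n"] have "(real n + 2) *\<^sub>R e = 0" by (simp add: algebra_simps scaleR_2)
      hence "e = 0" by (metis add_nonneg_pos less_irrefl of_nat_0_le_iff scaleR_eq_0_iff zero_less_numeral)
      with sum[of i] sum[of "Suc n"] ij have "d i = d (Suc n)" by simp
      moreover have "Suc n - i = j" using ij by simp
      ultimately show "tp (pw z i) (pw z j) x = tp (pw z (Suc n)) z x" by (simp add: d_def)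
    qed
  qed simp
  show *: "i + j = n \<Longrightarrow> tp (pw z i) (pw z j) x = tp (pw z n) z x" for i j n x using P by blast
  have "tp z z (tp (pw z n) z x) = tp (pw z (Suc n)) z x - tp (pw z n) (pw z (Suc 0)) x + tp (pw z n) z (tp z z x)"
    using jordan[of z z "pw z n" z x] by simp
  thus "tp z z (tp (pw z n) z x) = tp (pw z n) z (tp z z x)"
    using *[where i = n and j = "Suc 0" and n = "Suc n" and x = x] by (simp del: funpow.simps)
qed

lemma tp_pw: "tp (pw z i) (pw z j) (pw z k) = pw z (i + j + k + 1)"
proof -
  have "tp (pw z k) z (pw z n) = pw z (n + k + 1)" for n
  proof (induction n)
    case 0
    show ?case using tp_sym[of "pw z k" z z] by simp
  next
    case (Suc n)
    have "tp (pw z k) z (pw z (Suc n)) = tp z z (tp (pw z k) z (pw z n))"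
      using tp_pw_commute[where n = k and z = z and x = "pw z n"] by simp
    with Suc show ?case by simp
  qed
  thus ?thesis using tp_pw_tp_pw[where i = i and j = j and n = "i + j" and z = z and x = "pw z k"] tp_sym[of "pw z (i + j)" z "pw z k"] by simp
qed

section \<open>The span of the powers and its multipliers\<close>

abbreviation Vs :: "'a \<Rightarrow> 'a set" where "Vs z \<equiv> span (range (pw z))"

lemma z_in_Vs: "z \<in> Vs z"
proof -
  have "pw z 0 \<in> Vs z" by (intro span_base rangeI)
  thus ?thesis by simp
qed

lemma Vs_induct3:
  assumes x: "x \<in> Vs z" and y: "y \<in> Vs z" and w: "w \<in> Vs z"
    and base: "\<And>i j k. P (pw z i) (pw z j) (pw z k)"
    and sub: "\<And>y w. subspace {x. P x y w}" "\<And>x w. subspace {y. P x y w}" "\<And>x y. subspace {w. P x y w}"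
  shows "P x y w"
proof -
  have 1: "P (pw z i) (pw z j) w" for i j
    using w by (induction rule: span_induct) (use sub(3) base in auto)
  have 2: "P (pw z i) y w" for i
    using y by (induction rule: span_induct) (use sub(2) 1 in auto)
  show ?thesis using x by (induction rule: span_induct) (use sub(1) 2 in auto)
qed

lemma tp_in_Vs: "x \<in> Vs z \<Longrightarrow> y \<in> Vs z \<Longrightarrow> w \<in> Vs z \<Longrightarrow> tp x y w \<in> Vs z"
  by (erule (2) Vs_induct3)
    (auto simp: tp_pw subspace_def tp_linear span_zero span_add span_scale intro!: span_base simp del: funpow.simps)

text \<open>The centroid of the triple \<open>Vs z\<close>. Real polynomials in
  \<open>tp z z\<close> belong to it and can be pulled out of every slot of a triple
  product.\<close>

definition multiplier :: "'a \<Rightarrow> ('a \<Rightarrow> 'a) \<Rightarrow> bool" where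
  "multiplier z B \<longleftrightarrow> linear B \<and> (\<forall>x\<in>Vs z. B x \<in> Vs z) \<and>
    (\<forall>x\<in>Vs z. \<forall>y\<in>Vs z. \<forall>w\<in>Vs z. tp (B x) y w = B (tp x y w) \<and> tp x (B y) w = B (tp x y w))"

lemma multiplierD:
  assumes "multiplier z B"
  shows "linear B" "x \<in> Vs z \<Longrightarrow> B x \<in> Vs z"
    "x \<in> Vs z \<Longrightarrow> y \<in> Vs z \<Longrightarrow> w \<in> Vs z \<Longrightarrow> tp (B x) y w = B (tp x y w)"
    "x \<in> Vs z \<Longrightarrow> y \<in> Vs z \<Longrightarrow> w \<in> Vs z \<Longrightarrow> tp x (B y) w = B (tp x y w)"
    "x \<in> Vs z \<Longrightarrow> y \<in> Vs z \<Longrightarrow> w \<in> Vs z \<Longrightarrow> tp x y (B w) = B (tp x y w)"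
  using assms tp_sym[of x y "B w"] tp_sym[of x y w] unfolding multiplier_def by auto

lemma multiplier_tp: "multiplier z (tp z z)"
  unfolding multiplier_def
proof (intro conjI ballI)
  show "linear (tp z z)" by (rule linear_tp3)
  show "tp z z x \<in> Vs z" if "x \<in> Vs z" for x by (rule tp_in_Vs[OF z_in_Vs z_in_Vs that])
  fix x y w assume V: "x \<in> Vs z" "y \<in> Vs z" "w \<in> Vs z"
  show "tp (tp z z x) y w = tp z z (tp x y w)"
    using V
  proof (rule Vs_induct3)
    fix i j k
    show "tp (tp z z (pw z i)) (pw z j) (pw z k) = tp z z (tp (pw z i) (pw z j) (pw z k))"
      unfolding tp_pw_Suc tp_pw by simp
  qed (auto simp: subspace_def tp_linear)
  show "tp x (tp z z y) w = tp z z (tp x y w)"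
    using V
  proof (rule Vs_induct3)
    fix i j k
    show "tp (pw z i) (tp z z (pw z j)) (pw z k) = tp z z (tp (pw z i) (pw z j) (pw z k))"
      unfolding tp_pw_Suc tp_pw by simp
  qed (auto simp: subspace_def tp_linear)
qed

lemma multiplier_id: "multiplier z (\<lambda>x. x)"
  by (simp add: multiplier_def linear_ident)

lemma multiplier_compose: "multiplier z A \<Longrightarrow> multiplier z B \<Longrightarrow> multiplier z (\<lambda>x. A (B x))"
  unfolding multiplier_def using linear_compose[of B A] by (auto simp: o_def tp_in_Vs)

lemma multiplier_diff: "multiplier z A \<Longrightarrow> multiplier z B \<Longrightarrow> multiplier z (\<lambda>x. A x - B x)"
  unfolding multiplier_def by (auto simp: tp_linear span_diff linear_compose_sub)

lemma multiplier_scale: "multiplier z A \<Longrightarrow> multiplier z (\<lambda>x. c *\<^sub>R A x)"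
  unfolding multiplier_def by (auto simp: tp_linear span_scale linear_compose_scale_right)

lemma multiplier_step: "multiplier z (step (tp z z) (of_real t) ^^ m)"
proof (induction m)
  case 0 show ?case using multiplier_id by (simp add: id_def)
next
  case (Suc m)
  have "multiplier z (step (tp z z) (of_real t))"
    unfolding step_def[abs_def] sc_of_real
    by (intro multiplier_diff multiplier_id multiplier_scale multiplier_tp)
  from multiplier_compose[OF this Suc] show ?case by (simp add: o_def)
qed

section \<open>Norm bounds from iterated cubing\<close>

lemma norm_cube_pow: "norm (((\<lambda>u. tp u u u) ^^ n) x) = norm x ^ (3 ^ n)"
  by (induction n) (simp_all add: norm_cube power_mult[symmetric] mult.commute)

text \<open>Iterated cubing raises norms to the power 3^n, so this turns a uniform bound on iterated
  cubes into the bound 1.\<close>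

lemma norm_le_1_if_power_bounded:
  fixes a :: real
  assumes "\<And>n :: nat. a ^ (3 ^ n) \<le> B"
  shows "a \<le> 1"
proof (rule ccontr)
  assume "\<not> a \<le> 1"
  hence a: "a > 1" by simp
  then obtain n where "B < a ^ n" using real_arch_pow by blast
  also have "a ^ n \<le> a ^ (3 ^ n)"
    using a by (intro power_increasing) (auto simp: less_imp_le less_exp intro: order_trans[OF less_imp_le[OF less_exp] power_mono])
  finally show False using assms[of n] by simp
qed

text \<open>Cubing \<open>pw z k\<close> n times gives the power with exponent 3^n (2 k + 1). It
  also arises from k applications of \<open>tp u u\<close> to \<open>u\<close>, the n-fold cube of
  \<open>z\<close>, which has norm 1; hence the bound \<open>Ktp ^ k\<close> for all n.\<close>

lemma norm_pw_le_1:
  assumes z: "norm z = 1"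
  shows "norm (pw z k) \<le> 1"
proof -
  \<comment> \<open>\<open>N n\<close> is the index of the power with exponent 3^n.\<close>
  define N where "N = (\<lambda>n. ((3::nat) ^ n - 1) div 2)"
  have N: "3 ^ n = 2 * N n + 1" for n
  proof -
    have "odd ((3::nat) ^ n)" by simp
    then obtain k where "(3::nat) ^ n = 2 * k + 1" by (rule oddE)
    thus ?thesis by (simp add: N_def)
  qed
  have cube: "((\<lambda>u. tp u u u) ^^ n) (pw z k) = pw z (N n + k * 3 ^ n)" for n k
  proof (induction n)
    case (Suc n)
    have "N (Suc n) = 3 * N n + 1" using N[of n] N[of "Suc n"] by simp
    moreover have "((\<lambda>u. tp u u u) ^^ Suc n) (pw z k) = tp (pw z (N n + k * 3 ^ n)) (pw z (N n + k * 3 ^ n)) (pw z (N n + k * 3 ^ n))"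
      by (simp only: funpow.simps(2) o_apply Suc)
    ultimately show ?case unfolding tp_pw by (simp only:) (rule arg_cong[where f = "pw z"], simp)
  qed (simp add: N_def)
  have u: "norm (pw z (N n)) = 1" for n
    using norm_cube_pow[of n z] cube[of n 0] z by simp
  have bound: "norm (pw z (N n + k * 3 ^ n)) \<le> Ktp ^ k" for n k
  proof (induction k)
    case (Suc k)
    have "pw z (N n + Suc k * 3 ^ n) = tp (pw z (N n)) (pw z (N n)) (pw z (N n + k * 3 ^ n))"
      unfolding tp_pw by (rule arg_cong[where f = "pw z"]) (use N[of n] in simp)
    also have "norm \<dots> \<le> Ktp * 1 * 1 * Ktp ^ k"
      by (rule norm_tp_le_mult) (use u Suc in auto)
    finally show ?case by simp
  qed (use u in simp)
  show ?thesis
    by (rule norm_le_1_if_power_bounded[of _ "Ktp ^ k"])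
      (simp only: norm_cube_pow[symmetric] cube bound)
qed

text \<open>Decay is known only for \<open>L\<close> times the semigroup. Since the power
  \<open>R\<close> of the step is a multiplier, the cube of \<open>R z\<close> equals
  \<open>L (R (R (R z)))\<close>, so the norm of \<open>R z\<close> itself becomes small.\<close>

lemma step_pow_small:
  assumes e: "e > 0"
  obtains t m where "norm ((step (tp z z) (of_real t) ^^ m) z) \<le> e"
    "\<And>x. norm ((step (tp z z) (of_real t) ^^ m) x) \<le> 2 * norm x"
proof -
  have "e ^ 3 / (norm z + 1) > 0" using e by (simp add: add_nonneg_pos)
  then obtain t m where tm: "\<And>x. norm (tp z z ((step (tp z z) (of_real t) ^^ (3 * m)) x)) \<le> e ^ 3 / (norm z + 1) * norm x"
    "\<And>x. norm ((step (tp z z) (of_real t) ^^ m) x) \<le> 2 * norm x"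
    using positive_op_decay[OF positive_op_tp] by metis
  let ?R = "step (tp z z) (of_real t) ^^ m"
  have R: "multiplier z ?R" by (rule multiplier_step)
  note D = multiplierD[OF R]
  have "tp (?R z) (?R z) (?R z) = ?R (?R (?R (tp z z z)))"
    using D z_in_Vs tp_in_Vs by simp
  also have "\<dots> = (step (tp z z) (of_real t) ^^ (3 * m)) (tp z z z)"
    by (simp add: numeral_3_eq_3 funpow_add)
  also have "\<dots> = tp z z ((step (tp z z) (of_real t) ^^ (3 * m)) z)"
    by (rule step_pow_commute[OF clinear_tp])
  finally have "norm (?R z) ^ 3 \<le> e ^ 3 / (norm z + 1) * norm z" using tm(1)[of z] norm_cube by metis
  also have "\<dots> \<le> e ^ 3 * 1"
  proof -
    have "norm z / (norm z + 1) \<le> 1" by (simp add: divide_le_eq add_nonneg_pos)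
    from mult_left_mono[OF this, of "e ^ 3"] e show ?thesis by simp
  qed
  finally have "norm (?R z) ^ 3 \<le> e ^ 3" by simp
  hence "norm (?R z) \<le> e" using e by (simp add: power_mono_iff)
  with tm(2) that show ?thesis by blast
qed

subsection \<open>Norming functionals\<close>

text \<open>The sesquilinear form \<open>lc l (tp a c z)\<close> is real on the diagonal, hence
  hermitian; polarization with \<open>J c\<close> in place of \<open>c\<close> shows its real part
  to be symmetric.\<close>

lemma norming_tp_swap:
  assumes lz: "norming l z"
  shows "l (tp a c z) = l (tp c a z)"
proof -
  have h: "l (J (tp a a z)) = 0" for a
    using positive_op_tp[of a] lz by (simp add: positive_op_def)
  have "l (J (tp a c z)) + l (J (tp c a z)) = 0" for a c
    using h[of "a + c"] h[of a] h[of c] by (simp add: tp_linear J_add blinfun.add_right)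
  from this[of a "J c"] show ?thesis
    by (simp add: tp_J1 tp_J2 J_minus blinfun.minus_right)
qed

lemma norming_tp_Q: "norming l z \<Longrightarrow> l (tp z c z) = l (tp z z c)"
  using norming_tp_swap[of l z z c] tp_sym[of c z z] by simp

lemma norming_tp_nonneg: "norming l z \<Longrightarrow> 0 \<le> l (tp a a z)"
  using positive_op_tp[of a] by (simp add: positive_op_def)

text \<open>The Cauchy-Schwarz argument: a null vector of a positive form is orthogonal to
  everything.\<close>

lemma norming_tp_null:
  assumes lz: "norming l z" and a: "l (tp a a z) = 0"
  shows "l (tp a c z) = 0" "l (tp c a z) = 0"
proof -
  define p where "p = l (tp a c z)"
  define r where "r = l (tp c c z)"
  have r: "r \<ge> 0" using norming_tp_nonneg[OF lz] by (simp add: r_def)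
  have main: "0 \<le> 2 * t * p + r" for t
    using norming_tp_nonneg[OF lz, of "t *\<^sub>R a + c"] a norming_tp_swap[OF lz, of c a]
    by (simp add: tp_linear blinfun.add_right blinfun.scaleR_right p_def r_def)
  have "p = 0"
  proof (rule ccontr)
    assume p: "p \<noteq> 0"
    have "2 * (- (r + 1) / (2 * p)) * p + r = - 1" using p by (simp add: field_simps)
    with main[of "- (r + 1) / (2 * p)"] show False by simp
  qed
  thus "l (tp a c z) = 0" by (simp add: p_def)
  thus "l (tp c a z) = 0" using norming_tp_swap[OF lz] by simp
qed

text \<open>The chain rule for the norm along the cubing map, whose derivative at z is
  2 {z,z,b} + {z,b,z}, combined with a Hahn-Banach extension.\<close>
lemma norming_cube_lift:
  assumes lz: "norming l z"
  obtains l1 where "norming l1 (tp z z z)" "\<And>b. l1 (2 *\<^sub>R tp z z b + tp z b z) = 3 * l b"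
proof -
  define u where "u = tp z z z"
  have u: "norm u = 1" using lz by (simp add: u_def norm_cube norming_def)
  define D where "D b = 2 *\<^sub>R tp z z b + tp z b z" for b
  have linD: "linear D" unfolding D_def by (rule linearI) (simp_all add: tp_linear algebra_simps)
  define f where "f b t = (norm (u + t *\<^sub>R b) - 1) / t" for b t
  have f_lower: "- norm b \<le> f b t" if "t > 0" for b t
  proof -
    have "norm u \<le> norm (u + t *\<^sub>R b) + norm (t *\<^sub>R b)" using norm_triangle_ineq4[of "u + t *\<^sub>R b" "t *\<^sub>R b"] by simp
    thus ?thesis using that u by (simp add: f_def field_simps)
  qed
  \<comment> \<open>The one-sided derivative of the norm at \<open>u\<close> in direction
    \<open>b\<close>; by convexity the limit is an infimum.\<close>
  define q where "q b = (INF t\<in>{0<..}. f b t)" for b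
  have bdd: "bdd_below (f b ` {0<..})" for b
    by (rule bdd_belowI2[where m = "- norm b"]) (use f_lower in auto)
  have q_le: "q b \<le> f b t" if "t > 0" for b t
    unfolding q_def using that by (intro cINF_lower[OF bdd]) auto
  have q_ge: "c \<le> q b" if "\<And>t. t > 0 \<Longrightarrow> c \<le> f b t" for c b
    unfolding q_def using that by (intro cINF_greatest) auto
  have q_norm: "q b \<le> 1 * norm b" for b
    using q_le[of 1 b] norm_triangle_ineq[of u b] u by (simp add: f_def)
  have sub: "sublinear q"
  proof (rule sublinearI)
    fix b c
    have comb: "q (b + c) \<le> f b s + f c t" if st: "s > 0" "t > 0" for s t
    proof -
      \<comment> \<open>With this r the point u + r (b + c) is the convex combination of u + s b and
        u + t c with weights t / (s + t) and s / (s + t).\<close>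
      define r where "r = s * t / (s + t)"
      have r: "r > 0" using st by (simp add: r_def)
      have "u + r *\<^sub>R (b + c) = (t / (s + t)) *\<^sub>R (u + s *\<^sub>R b) + (s / (s + t)) *\<^sub>R (u + t *\<^sub>R c)"
      proof -
        have "t / (s + t) + s / (s + t) = 1" using st by (simp flip: add_divide_distrib)
        hence "u = (t / (s + t)) *\<^sub>R u + (s / (s + t)) *\<^sub>R u" by (metis scaleR_left_distrib scaleR_one)
        moreover have "t / (s + t) * s = r" "s / (s + t) * t = r" by (simp_all add: r_def mult.commute)
        ultimately show ?thesis by (simp add: scaleR_add_right)
      qed
      hence "norm (u + r *\<^sub>R (b + c)) \<le> (t / (s + t)) * norm (u + s *\<^sub>R b) + (s / (s + t)) * norm (u + t *\<^sub>R c)"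
        using norm_triangle_ineq[of "(t / (s + t)) *\<^sub>R (u + s *\<^sub>R b)" "(s / (s + t)) *\<^sub>R (u + t *\<^sub>R c)"] st by simp
      also have "\<dots> = 1 + r * (f b s + f c t)"
      proof -
        have "r * f b s = (t / (s + t)) * (norm (u + s *\<^sub>R b) - 1)"
          "r * f c t = (s / (s + t)) * (norm (u + t *\<^sub>R c) - 1)"
          using st by (simp_all add: f_def r_def)
        moreover have "t / (s + t) + s / (s + t) = 1" using st by (simp flip: add_divide_distrib)
        ultimately show ?thesis by (simp add: algebra_simps)
      qed
      finally have "f (b + c) r \<le> f b s + f c t" unfolding f_def[of "b + c"] using r by (simp add: field_simps)
      with q_le[OF r, of "b + c"] show ?thesis by simp
    qed
    have "q (b + c) - f b s \<le> q c" if "s > 0" for s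
      by (rule q_ge) (use comb[OF that] in force)
    hence "q (b + c) - q c \<le> q b" by (intro q_ge) force
    thus "q (b + c) \<le> q b + q c" by simp
  next
    have "f 0 t = 0" for t using u by (simp add: f_def)
    thus "q 0 = 0" by (simp add: q_def)
  next
    fix s :: real and b assume s: "s > 0"
    have "q (s *\<^sub>R b) / s \<le> q b"
    proof (rule q_ge)
      fix t :: real assume t: "t > 0"
      have "q (s *\<^sub>R b) \<le> f (s *\<^sub>R b) (t / s)" using s t by (intro q_le) simp
      also have "\<dots> = s * f b t" using s by (simp add: f_def)
      finally show "q (s *\<^sub>R b) / s \<le> f b t" using s by (simp add: field_simps)
    qed
    thus "q (s *\<^sub>R b) \<le> s * q b" using s by (simp add: field_simps)
  qed
  have mono: "f b s \<le> f b t" if "0 < s" "s \<le> t" for b s t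
  proof -
    have "u + s *\<^sub>R b = (1 - s / t) *\<^sub>R u + (s / t) *\<^sub>R (u + t *\<^sub>R b)"
      using that by (simp add: algebra_simps)
    hence "norm (u + s *\<^sub>R b) \<le> norm ((1 - s / t) *\<^sub>R u) + norm ((s / t) *\<^sub>R (u + t *\<^sub>R b))"
      using norm_triangle_ineq by metis
    hence "norm (u + s *\<^sub>R b) \<le> (1 - s / t) + (s / t) * norm (u + t *\<^sub>R b)"
      using that u by simp
    also have "\<dots> = 1 + s * f b t" using that by (simp add: f_def field_simps)
    finally show ?thesis unfolding f_def[of b s] using that by (simp add: field_simps)
  qed
  have dom: "3 * l b \<le> q (D b)" for b
  proof (rule q_ge)
    fix t :: real assume t: "t > 0"
    define w where "w = 2 *\<^sub>R tp b b z + tp b z b"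
    define c where "c = norm w + norm (tp b b b)"
    have c: "c \<ge> 0" by (simp add: c_def)
    \<comment> \<open>To first order in s the cube of z + s b is u + s D b, so the cube of 1 + s (l
      b) is at most the norm of u + s D b up to an error s^2 c.\<close>
    have small: "3 * l b - c * s \<le> f (D b) t"
      if s: "0 < s" "s \<le> t" "s \<le> 1" "s * norm b \<le> 1" for s
    proof -
      have exp: "tp (z + s *\<^sub>R b) (z + s *\<^sub>R b) (z + s *\<^sub>R b)
          = u + s *\<^sub>R D b + (s^2 *\<^sub>R w + s^3 *\<^sub>R tp b b b)"
        unfolding u_def D_def w_def
        by (simp add: tp_linear algebra_simps power2_eq_square power3_eq_cube scaleR_2 tp_sym[of b z z] tp_sym[of z b b])
      have "norm (s^2 *\<^sub>R w + s^3 *\<^sub>R tp b b b) \<le> s^2 * norm w + s^3 * norm (tp b b b)"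
        using norm_triangle_ineq[of "s^2 *\<^sub>R w" "s^3 *\<^sub>R tp b b b"] s by simp
      also have "s^3 * norm (tp b b b) \<le> s^2 * norm (tp b b b)"
        using s by (intro mult_right_mono power_decreasing) auto
      finally have rem: "norm (s^2 *\<^sub>R w + s^3 *\<^sub>R tp b b b) \<le> s^2 * c" by (simp add: c_def algebra_simps)
      have lb: "\<bar>l b\<bar> \<le> norm b" using blinfun_real_le[of l b] lz by (simp add: norming_def)
      have x: "s * l b \<ge> - 1"
      proof -
        have "- norm b \<le> l b" using lb by linarith
        hence "s * (- norm b) \<le> s * l b" using s by (intro mult_left_mono) auto
        thus ?thesis using s by simp
      qed
      have "1 + s * l b = l (z + s *\<^sub>R b)"
        using lz by (simp add: norming_def blinfun.add_right blinfun.scaleR_right)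
      also have "\<dots> \<le> norm (z + s *\<^sub>R b)"
        using blinfun_real_le[of l "z + s *\<^sub>R b"] lz by (simp add: norming_def)
      finally have "(1 + s * l b) ^ 3 \<le> norm (z + s *\<^sub>R b) ^ 3" using x by (intro power_mono) auto
      moreover have "1 + 3 * (s * l b) \<le> (1 + s * l b) ^ 3"
      proof -
        have "(1 + s * l b) ^ 3 = 1 + 3 * (s * l b) + (s * l b)^2 * (3 + s * l b)"
          by (simp add: power3_eq_cube power2_eq_square algebra_simps)
        moreover have "(s * l b)^2 * (3 + s * l b) \<ge> 0" using x by (intro mult_nonneg_nonneg) auto
        ultimately show ?thesis by linarith
      qed
      moreover have "norm (z + s *\<^sub>R b) ^ 3 \<le> norm (u + s *\<^sub>R D b) + s^2 * c"
        unfolding norm_cube[symmetric] exp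
        using norm_triangle_ineq[of "u + s *\<^sub>R D b" "s^2 *\<^sub>R w + s^3 *\<^sub>R tp b b b"] rem by linarith
      ultimately have "s * (3 * l b - c * s) \<le> norm (u + s *\<^sub>R D b) - 1"
        by (simp add: algebra_simps power2_eq_square)
      hence "3 * l b - c * s \<le> f (D b) s" using s by (simp add: f_def field_simps)
      with mono[OF s(1,2), of "D b"] show ?thesis by simp
    qed
    show "3 * l b \<le> f (D b) t"
    proof (rule field_le_epsilon)
      fix e :: real assume e: "e > 0"
      define s where "s = min (min t 1) (min (1 / (norm b + 1)) (e / (c + 1)))"
      have nb: "norm b + 1 > 0" "c + 1 > 0" using c by (simp_all add: add_nonneg_pos)
      have s: "0 < s" "s \<le> t" "s \<le> 1" "s \<le> 1 / (norm b + 1)" "s \<le> e / (c + 1)"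
        using t e nb by (auto simp: s_def)
      have "s * norm b \<le> 1 / (norm b + 1) * (norm b + 1)" using s by (intro mult_mono) auto
      hence "s * norm b \<le> 1" using nb by simp
      from small[OF s(1,2,3) this] have "3 * l b - c * s \<le> f (D b) t" .
      moreover have "c * s \<le> (c + 1) * (e / (c + 1))" using s c by (intro mult_mono) auto
      hence "c * s \<le> e" using nb by simp
      ultimately show "3 * l b \<le> f (D b) t + e" by simp
    qed
  qed
  have lin3: "linear (\<lambda>b. 3 * l b)"
    by (rule linearI) (simp_all add: blinfun.add_right blinfun.scaleR_right algebra_simps)
  obtain g where g: "linear g" "\<And>x. g x \<le> q x" "\<And>b. g (D b) = 3 * l b"
    using hahn_banach_subspace[OF sub subspace_UNIV linD lin3] dom by auto
  have "g x \<le> 1 * norm x" for x using g(2) q_norm order_trans by blast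
  then obtain l1 :: "'a \<Rightarrow>\<^sub>L real" where l1: "\<And>x. l1 x = g x" "norm l1 \<le> 1"
    using blinfun_of_dominated[OF g(1), of 1] by auto
  \<comment> \<open>Testing the direction \<open>- u\<close> forces
    \<open>l1 u \<ge> 1\<close>.\<close>
  have "g (- u) \<le> f (- u) (1/2)" using g(2)[of "- u"] q_le[of "1/2" "- u"] by simp
  also have "\<dots> = - 1"
  proof -
    have "u + (1/2) *\<^sub>R (- u) = (1/2) *\<^sub>R u" by (simp add: algebra_simps flip: scaleR_add_left)
    thus ?thesis using u by (simp add: f_def)
  qed
  finally have "l1 u \<ge> 1" using l1 linear_neg[OF g(1), of u] by simp
  moreover have "l1 u \<le> 1" using blinfun_real_le[of l1 u] l1 u by simp
  ultimately have "norming l1 u" using l1 u by (intro normingI) auto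
  thus ?thesis using that g(3) l1 unfolding u_def D_def by simp
qed

lemma tp_z_Vs_z: "y \<in> Vs z \<Longrightarrow> tp z y z = tp z z y"
proof -
  have "tp z (pw z n) z = tp z z (pw z n)" for n
    using tp_pw[where z = z and i = 0 and j = n and k = 0] by simp
  hence "Vs z \<subseteq> {y. tp z y z = tp z z y}"
    by (intro span_minimal) (auto simp: subspace_def tp_linear)
  thus "y \<in> Vs z \<Longrightarrow> tp z y z = tp z z y" by auto
qed

text \<open>The polynomial 1 - (1 - t L)^m is divisible by L. Once the m-th step power of
  \<open>z\<close> is small, this gives an approximate preimage of \<open>z\<close> under L.\<close>

lemma step_pow_in_range:
  "\<exists>x\<in>Vs z. tp z z x = z - (step (tp z z) (of_real t) ^^ m) z"
proof (induction m)
  case 0 show ?case by (auto intro!: bexI[of _ 0] simp: span_zero)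
next
  case (Suc m)
  then obtain x where x: "x \<in> Vs z" "tp z z x = z - (step (tp z z) (of_real t) ^^ m) z" by blast
  let ?y = "(step (tp z z) (of_real t) ^^ m) z"
  have "?y \<in> Vs z" using multiplierD(2)[OF multiplier_step z_in_Vs] .
  hence "x + t *\<^sub>R ?y \<in> Vs z" using x by (simp add: span_add span_scale)
  moreover have "tp z z (x + t *\<^sub>R ?y) = z - (step (tp z z) (of_real t) ^^ Suc m) z"
    using x(2) by (simp add: tp_linear step_def[of _ _ ?y])
  ultimately show ?case by blast
qed

text \<open>Let g k = l1 (pw z k).  Positivity of l, tested on an approximation of the preimage under L of (1 - L) z,
  gives g 0 - 2 g 1 + g 2 >= 0, while g 1 = 1 and g 0, g 2 <= 1; hence all three are 1.\<close>
lemma norming_cube: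
  assumes lz: "norming l z" and l1: "norming l1 (tp z z z)"
    and D: "\<And>b. l1 (2 *\<^sub>R tp z z b + tp z b z) = 3 * l b"
  shows "norming l1 z" "norming l (tp z z z)" "\<And>v. v \<in> Vs z \<Longrightarrow> l1 (tp z z v) = l v"
proof -
  let ?L = "tp z z"
  have nz: "norm z = 1" "norm l = 1" "norm l1 = 1" using lz l1 by (simp_all add: norming_def)
  show V: "l1 (?L v) = l v" if "v \<in> Vs z" for v
    using D[of v] tp_z_Vs_z[OF that] by (simp add: blinfun.add_right blinfun.scaleR_right)
  \<comment> \<open>\<open>q0\<close> is 1 - L applied twice to \<open>z\<close>.\<close>
  define q0 where "q0 = z - 2 *\<^sub>R ?L z + ?L (?L z)"
  have "- l1 q0 \<le> 0"
  proof (rule field_le_epsilon)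
    fix e :: real assume e: "e > 0"
    \<comment> \<open>The factor \<open>(1 + Ktp)\<^sup>2\<close> bounds the passage from
      \<open>R z\<close> to \<open>R q0\<close>, and 4 accounts for the error terms
      \<open>2 * l1 (R q0)\<close> and \<open>l1 (R (R q0))\<close>.\<close>
    define M where "M = 4 * ((1 + Ktp)\<^sup>2 + 1)"
    have M: "M > 0" by (simp add: M_def add_nonneg_pos)
    obtain t m where tm: "norm ((step ?L (of_real t) ^^ m) z) \<le> e / M"
      "\<And>x. norm ((step ?L (of_real t) ^^ m) x) \<le> 2 * norm x"
      using step_pow_small[of "e / M" z] e M by (metis divide_pos_pos)
    define R where "R = step ?L (of_real t) ^^ m"
    have R: "multiplier z R" unfolding R_def by (rule multiplier_step)
    note RD = multiplierD[OF R]
    have RL: "R (?L x) = ?L (R x)" for x unfolding R_def by (rule step_pow_commute[OF clinear_tp])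
    obtain x where x: "x \<in> Vs z" "?L x = z - R z" using step_pow_in_range R_def by metis
    \<comment> \<open>If \<open>R z\<close> vanished, \<open>L x\<close> would be \<open>z\<close>
      and \<open>y\<close> a preimage of \<open>w\<close>; the terms with \<open>R\<close> measure
      the error.\<close>
    define y where "y = x - ?L x"
    define w where "w = z - ?L z"
    define u where "u = ?L y"
    note LD = multiplierD[OF multiplier_tp[of z]]
    have yV: "y \<in> Vs z" and wV: "w \<in> Vs z"
      unfolding y_def w_def using x(1) LD(2) z_in_Vs by (auto intro!: span_diff LD(2))
    have u: "u = w - R w"
      unfolding u_def y_def w_def using x(2) by (simp add: tp_linear linear_diff[OF RD(1)] RL)
    have "?L (tp y y z) = tp u y z" unfolding u_def using LD(3)[OF yV yV z_in_Vs] by simp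
    also have "\<dots> = tp w y z - R (tp w y z)"
      using RD(3)[OF wV yV z_in_Vs] by (simp add: u tp_linear)
    also have "tp w y z = u - ?L u"
    proof -
      have "tp z y z = u" using tp_z_Vs_z[OF yV] by (simp add: u_def)
      thus ?thesis unfolding w_def using LD(3)[OF z_in_Vs yV z_in_Vs] by (simp add: tp_linear)
    qed
    finally have 1: "?L (tp y y z) = (u - ?L u) - R (u - ?L u)" .
    have Rq: "R q0 = (R z - 2 *\<^sub>R ?L (R z)) + ?L (?L (R z))"
      by (simp add: q0_def linear_diff[OF RD(1)] linear_add[OF RD(1)] linear_scale[OF RD(1)] RL)
    have 2: "u - ?L u = q0 - R q0"
      unfolding Rq u w_def q0_def
      by (simp add: tp_linear linear_diff[OF RD(1)] linear_add[OF RD(1)] RL scaleR_2 algebra_simps)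
    have "?L (tp y y z) = q0 - 2 *\<^sub>R R q0 + R (R q0)"
      unfolding 1 2 by (simp add: linear_diff[OF RD(1)] scaleR_2)
    moreover have "0 \<le> l (tp y y z)" by (rule norming_tp_nonneg[OF lz])
    moreover have "l (tp y y z) = l1 (?L (tp y y z))"
      using V[OF tp_in_Vs[OF yV yV z_in_Vs]] by simp
    ultimately have "0 \<le> l1 q0 - 2 * l1 (R q0) + l1 (R (R q0))"
      by (simp add: blinfun.add_right blinfun.diff_right blinfun.scaleR_right)
    moreover have l1b: "\<bar>l1 v\<bar> \<le> norm v" for v using blinfun_real_le[of l1 v] nz by simp
    have "\<bar>l1 (R q0)\<bar> \<le> norm (R q0)" "\<bar>l1 (R (R q0))\<bar> \<le> 2 * norm (R q0)"
      using l1b[of "R q0"] l1b[of "R (R q0)"] tm(2)[of "R q0"] by (auto simp: R_def)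
    moreover have "norm (R q0) \<le> e / 4"
    proof -
      have Lb: "norm (?L v) \<le> Ktp * norm v" for v
        using norm_tp_le[of z z v] nz by simp
      have "norm (R q0) \<le> norm (R z) + 2 * norm (?L (R z)) + norm (?L (?L (R z)))"
        unfolding Rq using norm_triangle_ineq[of "R z - 2 *\<^sub>R ?L (R z)" "?L (?L (R z))"]
          norm_triangle_ineq4[of "R z" "2 *\<^sub>R ?L (R z)"] by simp
      also have "\<dots> \<le> norm (R z) + 2 * (Ktp * norm (R z)) + Ktp * (Ktp * norm (R z))"
        using Lb[of "R z"] order_trans[OF Lb[of "?L (R z)"] mult_left_mono[OF Lb[of "R z"]]] Ktp_ge_1 by simp
      also have "\<dots> = (1 + Ktp)\<^sup>2 * norm (R z)" by (simp add: power2_eq_square algebra_simps)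
      also have "\<dots> \<le> ((1 + Ktp)\<^sup>2 + 1) * (e / M)"
        using tm(1) by (intro mult_mono) (auto simp: R_def)
      also have "\<dots> = e / 4"
      proof -
        have "(1 + Ktp)\<^sup>2 + 1 > 0" by (simp add: add_nonneg_pos)
        moreover have "c * (e / (4 * c)) = e / 4" if "c > 0" for c :: real using that by simp
        ultimately show ?thesis by (simp only: M_def)
      qed
      finally show ?thesis .
    qed
    ultimately show "- l1 q0 \<le> 0 + e" by linarith
  qed
  moreover have "l1 q0 = l1 z - 2 * 1 + l (?L z)"
    using V[OF z_in_Vs] V[OF tp_in_Vs[OF z_in_Vs z_in_Vs z_in_Vs]] lz
    by (simp add: q0_def blinfun.add_right blinfun.diff_right blinfun.scaleR_right norming_def)
  moreover have "l1 z \<le> 1" using blinfun_real_le[of l1 z] nz by simp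
  moreover have "l (?L z) \<le> 1" using blinfun_real_le[of l "?L z"] nz norm_cube[of z] by simp
  ultimately have "l1 z = 1" "l (?L z) = 1" by auto
  thus "norming l1 z" "norming l (tp z z z)" using nz norm_cube[of z] by (simp_all add: norming_def)
qed

text \<open>Two Jordan identities are linear equations for the two composites of L and Q;
  eliminating {z, b, {z, z, z}} leaves three times their difference equal to 0.\<close>

lemma tp_identities:
  shows tp_Q_commute: "tp z z (tp z b z) = tp z (tp z z b) z"
    and tp_cube_left: "tp (tp z z z) z b = 2 *\<^sub>R tp z z (tp z z b) - tp z (tp z b z) z"
proof -
  have 1: "tp z z (tp z b z) = 2 *\<^sub>R tp (tp z z z) b z - tp z (tp z z b) z"
    using jordan[of z z z b z] tp_sym[of z b "tp z z z"] by (simp add: scaleR_2)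
  have 2: "tp z b (tp z z z) = 2 *\<^sub>R tp z z (tp z b z) - tp z (tp z z b) z"
    using jordan[of z b z z z] tp_sym[of b z z] tp_sym[of "tp z b z" z z] by (simp add: scaleR_2)
  have "A = B" if "A = 2 *\<^sub>R (2 *\<^sub>R A - B) - B" for A B :: 'a
  proof -
    have "(A - B) + (A - B) + (A - B) = 0" using that by (simp add: scaleR_2 algebra_simps)
    hence "3 *\<^sub>R (A - B) = 0" using scaleR_left_distrib[of 2 1 "A - B"] by (simp add: scaleR_2)
    thus ?thesis by simp
  qed
  thus "tp z z (tp z b z) = tp z (tp z z b) z"
    using 1 unfolding tp_sym[of "tp z z z" b z] 2 by blast
  have "tp b z (tp z z z) = tp (tp b z z) z z - tp z (tp z b z) z + tp z z (tp b z z)"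
    by (rule jordan)
  thus "tp (tp z z z) z b = 2 *\<^sub>R tp z z (tp z z b) - tp z (tp z b z) z"
    using tp_sym[of b z z] tp_sym[of b z "tp z z z"] tp_sym[of "tp z z b" z z] by (simp add: scaleR_2)
qed

text \<open>The positive form l2 {a, b, z} vanishes at a = b = z^3 - z, so z^3 may be replaced by z in
  l2 {c, z^3, z}; with {z^3, z, c} = 2 L (L c) - Q (Q c) this gives l2 (L (L c)) = l2 (L c).\<close>
theorem norming_tp_fixed:
  assumes lz: "norming l z"
  shows "l (tp z z c) = l c" "l (tp z c z) = l c"
proof -
  let ?L = "tp z z"
  obtain l1 where l1: "norming l1 (tp z z z)" "\<And>b. l1 (2 *\<^sub>R ?L b + tp z b z) = 3 * l b"
    using norming_cube_lift[OF lz] by blast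
  note N1 = norming_cube[OF lz l1]
  \<comment> \<open>After two lifts \<open>l b = l2 (L (L b))\<close>, and \<open>l2\<close> equals
    1 at the powers 1, 2 and 3, which are the ones that occur in \<open>tp w w z\<close>.\<close>
  obtain l2 where l2: "norming l2 (tp z z z)" "\<And>b. l2 (2 *\<^sub>R ?L b + tp z b z) = 3 * l1 b"
    using norming_cube_lift[OF N1(1)] by blast
  note N2 = norming_cube[OF N1(1) l2]
  have pV: "pw z k \<in> Vs z" for k by (intro span_base) auto
  have e0: "l2 (pw z 1) = 1" using N2(3)[OF pV[of 0]] N1(1) by (simp add: norming_def)
  have e1: "l2 (pw z 2) = 1" using N2(3)[OF pV[of 1]] l1(1) by (simp add: norming_def numeral_2_eq_2)
  have e2: "l2 (pw z 3) = 1"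
  proof -
    have "l2 (pw z 3) = l1 (pw z 2)" using N2(3)[OF pV[of 2]] by (simp add: numeral_3_eq_3 numeral_2_eq_2)
    also have "\<dots> = l (pw z 1)" using N1(3)[OF pV[of 1]] by (simp add: numeral_2_eq_2)
    also have "\<dots> = 1" using N1(2) by (simp add: norming_def)
    finally show ?thesis .
  qed
  define w where "w = pw z 1 - z"
  have "tp w w z = pw z 3 - 2 *\<^sub>R pw z 2 + pw z 1"
    using tp_pw[where z = z and i = 1 and j = 1 and k = 0] tp_pw[where z = z and i = 1 and j = 0 and k = 0] tp_pw[where z = z and i = 0 and j = 1 and k = 0] tp_pw[where z = z and i = 0 and j = 0 and k = 0]
    unfolding w_def by (simp add: tp_linear scaleR_2 numeral_3_eq_3 numeral_2_eq_2 algebra_simps)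
  hence "l2 (tp w w z) = 0"
    using e0 e1 e2 by (simp add: blinfun.add_right blinfun.diff_right blinfun.scaleR_right)
  hence w0: "l2 (tp b w z) = 0" for b by (rule norming_tp_null(2)[OF N2(1)])
  have LL: "l2 (?L (?L b)) = l2 (?L b)" for b
  proof -
    have "tp b (pw z 1) z = tp (tp z z z) z b"
      using tp_pw_tp_pw[where i = 0 and j = 1 and n = 1 and z = z and x = b] tp_sym[of b "pw z 1" z] by simp
    hence "l2 (tp (tp z z z) z b) = l2 (tp b z z)"
      using w0[of b] by (simp add: w_def tp_linear blinfun.diff_right)
    hence "2 * l2 (?L (?L b)) - l2 (tp z (tp z b z) z) = l2 (?L b)"
      using tp_cube_left[of z b] tp_sym[of b z z] by (simp add: blinfun.diff_right blinfun.scaleR_right)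
    moreover have "l2 (tp z (tp z b z) z) = l2 (?L (?L b))"
      using norming_tp_Q[OF N2(1)] tp_Q_commute by metis
    ultimately show ?thesis by simp
  qed
  have 1: "l1 b = l2 (?L b)" for b
    using l2(2)[of b] norming_tp_Q[OF N2(1), of b] by (simp add: blinfun.add_right blinfun.scaleR_right)
  have 2: "l b = l1 (?L b)" for b
    using l1(2)[of b] norming_tp_Q[OF N1(1), of b] by (simp add: blinfun.add_right blinfun.scaleR_right)
  show *: "l (?L c) = l c" using LL by (simp add: 1 2)
  show "l (tp z c z) = l c" using norming_tp_Q[OF lz, of c] * by simp
qed

lemma norming_pw: "norming l z \<Longrightarrow> l (pw z k) = 1"
  by (induction k) (simp_all add: norming_tp_fixed norming_def)

subsection \<open>Tripotents and the Peirce decomposition\<close>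

definition tripotent :: "'a \<Rightarrow> bool" where "tripotent v \<longleftrightarrow> tp v v v = v"

text \<open>Lagrange polynomials in \<open>tp v v\<close> for the nodes 0, 1/2 and 1:
  \<open>Pz\<close>, \<open>Ph\<close> and \<open>Po\<close> are the Peirce projections usually
  written P0, P1 and P2.\<close>

definition Pz :: "'a \<Rightarrow> 'a \<Rightarrow> 'a" where
  "Pz v x = x - 3 *\<^sub>R tp v v x + 2 *\<^sub>R tp v v (tp v v x)"

definition Ph :: "'a \<Rightarrow> 'a \<Rightarrow> 'a" where
  "Ph v x = 4 *\<^sub>R tp v v x - 4 *\<^sub>R tp v v (tp v v x)"

definition Po :: "'a \<Rightarrow> 'a \<Rightarrow> 'a" where
  "Po v x = 2 *\<^sub>R tp v v (tp v v x) - tp v v x"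

lemma Peirce_sum: "Pz v x + Ph v x + Po v x = x"
proof -
  have "a *\<^sub>R y + b *\<^sub>R y = (a + b) *\<^sub>R y" for a b and y :: 'a by (simp add: scaleR_left_distrib)
  have "Pz v x + Ph v x + Po v x = x + (4 - 3 - 1) *\<^sub>R tp v v x + (2 - 4 + 2) *\<^sub>R tp v v (tp v v x)"
    by (simp only: Pz_def Ph_def Po_def scaleR_left_distrib scaleR_left_diff_distrib scaleR_one algebra_simps)
  thus ?thesis by simp
qed

abbreviation eig :: "'a \<Rightarrow> real \<Rightarrow> 'a \<Rightarrow> bool" where "eig v t x \<equiv> tp v v x = t *\<^sub>R x"

lemma tripotent_Q: "tripotent v \<Longrightarrow> tp v v (tp v b v) = tp v b v"
proof -
  assume v: "tripotent v"
  have "tp v b (tp v v v) = tp (tp v b v) v v - tp v (tp b v v) v + tp v v (tp v b v)" by (rule jordan)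
  with v show ?thesis
    using tp_Q_commute[of v b] tp_sym[of b v v] tp_sym[of "tp v b v" v v] by (simp add: tripotent_def)
qed

lemma tripotent_QQ: "tripotent v \<Longrightarrow> tp v (tp v b v) v = Po v b"
  using tp_cube_left[of v b] by (simp add: tripotent_def Po_def algebra_simps)

text \<open>\<open>Po v\<close> is the square of Q(v), whose range \<open>tp v v\<close> fixes; so
  \<open>tp v v\<close> is a root of t (2 t - 1) (t - 1).\<close>

lemma tripotent_L3:
  assumes v: "tripotent v"
  shows "2 *\<^sub>R tp v v (tp v v (tp v v x)) = 3 *\<^sub>R tp v v (tp v v x) - tp v v x"
proof -
  have "tp v v (Po v x) = Po v x" using tripotent_Q[OF v] tripotent_QQ[OF v, symmetric] by simp
  moreover have "3 *\<^sub>R y = 2 *\<^sub>R y + y" for y :: 'a using scaleR_left_distrib[of 2 1 y] by simp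
  ultimately show ?thesis by (simp add: Po_def tp_linear algebra_simps)
qed

lemma eig_P:
  assumes v: "tripotent v"
  shows "eig v 0 (Pz v x)" "eig v (1/2) (Ph v x)" "eig v 1 (Po v x)"
proof -
  have 3: "3 *\<^sub>R y = 2 *\<^sub>R y + y" for y :: 'a using scaleR_left_distrib[of 2 1 y] by simp
  note L3 = tripotent_L3[OF v, of x]
  show "eig v 0 (Pz v x)" using L3 by (simp add: Pz_def tp_linear)
  show "eig v 1 (Po v x)" using L3 by (simp add: Po_def tp_linear 3)
  have six: "6 *\<^sub>R y = 4 *\<^sub>R y + 2 *\<^sub>R y" for y :: 'a using scaleR_left_distrib[of 4 2 y] by simp
  have "tp v v (Ph v x) = 4 *\<^sub>R tp v v (tp v v x) - 2 *\<^sub>R (2 *\<^sub>R tp v v (tp v v (tp v v x)))"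
    by (simp add: Ph_def tp_linear)
  also have "\<dots> = 2 *\<^sub>R tp v v x - 2 *\<^sub>R tp v v (tp v v x)"
    unfolding L3 by (simp add: scaleR_diff_right six)
  finally show "eig v (1/2) (Ph v x)" by (simp add: Ph_def scaleR_diff_right)
qed

lemma eig_tp:
  assumes "eig v r a" "eig v s b" "eig v t c"
  shows "eig v (r - s + t) (tp a b c)"
  using jordan[of v v a b c] assms by (simp add: tp_linear algebra_simps)

lemma eig_values:
  assumes v: "tripotent v" and x: "eig v t x" and t: "t \<noteq> 0" "t \<noteq> 1/2" "t \<noteq> 1"
  shows "x = 0"
proof -
  have "2 *\<^sub>R (t * t * t) *\<^sub>R x = 3 *\<^sub>R (t * t) *\<^sub>R x - t *\<^sub>R x"
    using tripotent_L3[OF v, of x] by (simp add: x tp_scaleR3)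
  hence "(t * (2 * t - 1) * (t - 1)) *\<^sub>R x = 0" by (simp add: algebra_simps)
  with t show ?thesis by simp
qed

lemma Pz_eig0: "eig v 0 x \<Longrightarrow> Pz v x = x" by (simp add: Pz_def)
lemma Pz_eig_half: "eig v (1/2) x \<Longrightarrow> Pz v x = 0"
proof -
  assume "eig v (1/2) x"
  hence "Pz v x = (1 - 3/2 + 1/2) *\<^sub>R x" by (simp only: Pz_def tp_linear scaleR_left_distrib scaleR_left_diff_distrib) simp
  thus ?thesis by simp
qed
lemma Pz_eig1: "eig v 1 x \<Longrightarrow> Pz v x = 0"
proof -
  assume "eig v 1 x"
  hence "Pz v x = (1 - 3 + 2) *\<^sub>R x" by (simp only: Pz_def tp_linear scaleR_left_distrib scaleR_left_diff_distrib) simp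
  thus ?thesis by simp
qed

lemma linear_Pz: "linear (Pz v)" and linear_Ph: "linear (Ph v)" and linear_Po: "linear (Po v)"
  by (rule linearI; simp add: Pz_def Ph_def Po_def tp_linear algebra_simps)+

lemma Peirce_induct:
  assumes v: "tripotent v" and eig: "\<And>x. eig v 0 x \<Longrightarrow> P x" "\<And>x. eig v (1/2) x \<Longrightarrow> P x" "\<And>x. eig v 1 x \<Longrightarrow> P x"
    and add: "\<And>x y. P x \<Longrightarrow> P y \<Longrightarrow> P (x + y)"
  shows "P x"
proof -
  have "P (Pz v x + Ph v x + Po v x)" by (intro add eig eig_P[OF v])
  thus ?thesis by (simp add: Peirce_sum)
qed

section \<open>Peirce rotations and contractive projections\<close>

definition rot :: "'a \<Rightarrow> complex \<Rightarrow> 'a \<Rightarrow> 'a" where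
  "rot v w x = Pz v x + sc w (Ph v x) + sc (w^2) (Po v x)"

lemma rot_add: "rot v w (x + y) = rot v w x + rot v w y"
  by (simp add: rot_def linear_add[OF linear_Pz] linear_add[OF linear_Ph] linear_add[OF linear_Po] sc_add_right algebra_simps)

lemma rot_eig: "eig v (real k / 2) x \<Longrightarrow> k \<le> 2 \<Longrightarrow> rot v w x = sc (w ^ k) x"
proof -
  assume x: "eig v (real k / 2) x" and "k \<le> 2"
  then consider "k = 0" | "k = 1" | "k = 2" by linarith
  thus "rot v w x = sc (w ^ k) x"
  proof cases
    case 1
    thus ?thesis using x by (simp add: rot_def Pz_def Ph_def Po_def)
  next
    case 2
    have "Pz v x = 0" using Pz_eig_half x 2 by simp
    moreover have "Ph v x = x"
    proof -
      have "Ph v x = (2 - 1) *\<^sub>R x" using x 2 by (simp only: Ph_def tp_linear scaleR_left_diff_distrib) simp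
      thus ?thesis by simp
    qed
    moreover have "Po v x = 0" using x 2 by (simp add: Po_def tp_linear)
    ultimately show ?thesis using 2 by (simp add: rot_def)
  next
    case 3
    have "Pz v x = 0" using Pz_eig1 x 3 by simp
    moreover have "Ph v x = 0" using x 3 by (simp add: Ph_def)
    moreover have "Po v x = x" using x 3 by (simp add: Po_def scaleR_2)
    ultimately show ?thesis using 3 by (simp add: rot_def)
  qed
qed

lemma Peirce_induct_nat:
  assumes v: "tripotent v" and eig: "\<And>k x. k \<le> 2 \<Longrightarrow> eig v (real k / 2) x \<Longrightarrow> P x"
    and add: "\<And>x y. P x \<Longrightarrow> P y \<Longrightarrow> P (x + y)"
  shows "P x"
  by (rule Peirce_induct[OF v]) (use eig[of 0] eig[of 1] eig[of 2] add in auto)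

text \<open>Conjugate-linearity turns the middle factor w^j into its inverse, so the product of
  components of index i, j, k is scaled by w^(i - j + k); this is its own Peirce factor unless the
  product vanishes.\<close>

lemma rot_tp:
  assumes v: "tripotent v" and w: "cmod w = 1"
  shows "tp (rot v w x) (rot v w y) (rot v w z) = rot v w (tp x y z)"
proof -
  have base: "tp (rot v w x) (rot v w y) (rot v w z) = rot v w (tp x y z)"
    if ijk: "i \<le> 2" "j \<le> 2" "k \<le> 2"
      and x: "eig v (real i / 2) x" and y: "eig v (real j / 2) y" and z: "eig v (real k / 2) z" for i j k x y z
  proof -
    have e: "eig v (real i / 2 - real j / 2 + real k / 2) (tp x y z)" by (rule eig_tp[OF x y z])
    have l: "tp (rot v w x) (rot v w y) (rot v w z) = sc (w ^ i * cnj (w ^ j) * w ^ k) (tp x y z)"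
      by (simp only: rot_eig[OF x ijk(1)] rot_eig[OF y ijk(2)] rot_eig[OF z ijk(3)] tp_sc1 tp_sc2 tp_sc3 sc_sc mult_ac)
    show ?thesis
    proof (cases "tp x y z = 0")
      case True
      have "rot v w 0 = 0" using rot_add[of v w 0 0] by simp
      thus ?thesis using l True by simp
    next
      case False
      define t where "t = real i / 2 - real j / 2 + real k / 2"
      from eig_values[OF v e] False have "t = 0 \<or> t = 1/2 \<or> t = 1" unfolding t_def by blast
      then obtain m :: nat where m: "m \<le> 2" "t = real m / 2"
        by (metis div_0 div_self le_numeral_extra(3) of_nat_0 of_nat_1 of_nat_numeral one_le_numeral order_refl zero_le zero_neq_numeral)
      hence "real i + real k = real m + real j" unfolding t_def by (simp add: field_simps)
      hence ik: "i + k = m + j" by linarith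
      have wj: "w ^ j * cnj (w ^ j) = 1"
      proof -
        have "w * cnj w = 1" using w complex_norm_square[of w] by simp
        thus ?thesis by (simp flip: power_mult_distrib)
      qed
      have "w ^ i * cnj (w ^ j) * w ^ k = w ^ (i + k) * cnj (w ^ j)" by (simp add: power_add mult_ac)
      also have "\<dots> = w ^ m * (w ^ j * cnj (w ^ j))" by (simp only: ik power_add mult_ac)
      finally have "w ^ i * cnj (w ^ j) * w ^ k = w ^ m" using wj by (simp only: mult_1_right)
      moreover have "rot v w (tp x y z) = sc (w ^ m) (tp x y z)"
        using e m unfolding t_def by (intro rot_eig) simp_all
      ultimately show ?thesis using l by simp
    qed
  qed
  have 1: "tp (rot v w x) (rot v w y) (rot v w z) = rot v w (tp x y z)"
    if "i \<le> 2" "j \<le> 2" "eig v (real i / 2) x" "eig v (real j / 2) y" for i j x y z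
    by (rule Peirce_induct_nat[OF v, of "\<lambda>z. tp (rot v w x) (rot v w y) (rot v w z) = rot v w (tp x y z)"])
      (use base that in \<open>auto simp: rot_add tp_add3\<close>)
  have 2: "tp (rot v w x) (rot v w y) (rot v w z) = rot v w (tp x y z)"
    if "i \<le> 2" "eig v (real i / 2) x" for i x y z
    by (rule Peirce_induct_nat[OF v, of "\<lambda>y. tp (rot v w x) (rot v w y) (rot v w z) = rot v w (tp x y z)"])
      (use 1 that in \<open>auto simp: rot_add tp_add2\<close>)
  show ?thesis
    by (rule Peirce_induct_nat[OF v, of "\<lambda>x. tp (rot v w x) (rot v w y) (rot v w z) = rot v w (tp x y z)"])
      (use 2 in \<open>auto simp: rot_add tp_add1\<close>)
qed

lemma bounded_linear_Pz: "bounded_linear (Pz v)"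
  and bounded_linear_Ph: "bounded_linear (Ph v)" and bounded_linear_Po: "bounded_linear (Po v)"
  unfolding Pz_def[abs_def] Ph_def[abs_def] Po_def[abs_def]
  by (intro bounded_linear_add bounded_linear_sub bounded_linear_ident bounded_linear_tp3
      bounded_linear_compose[OF bounded_linear_scaleR_right] bounded_linear_compose[OF bounded_linear_tp3])+

text \<open>Rotations commute with cubing, so the crude bound by the norms of the three projections
  improves to 1.\<close>

lemma norm_rot_le:
  assumes v: "tripotent v" and w: "cmod w = 1"
  shows "norm (rot v w x) \<le> norm x"
proof (cases "x = 0")
  case True
  thus ?thesis using rot_add[of v w 0 0] by simp
next
  case False
  obtain B0 B1 B2 where B: "\<And>x. norm (Pz v x) \<le> norm x * B0" "\<And>x. norm (Ph v x) \<le> norm x * B1"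
    "\<And>x. norm (Po v x) \<le> norm x * B2"
    using bounded_linear.bounded[OF bounded_linear_Pz[of v]] bounded_linear.bounded[OF bounded_linear_Ph[of v]]
      bounded_linear.bounded[OF bounded_linear_Po[of v]] by metis
  have UB: "norm (rot v w y) \<le> (B0 + B1 + B2) * norm y" for y
  proof -
    have "norm (rot v w y) \<le> norm (Pz v y) + norm (Ph v y) + norm (Po v y)"
      unfolding rot_def using w norm_triangle_ineq[of "Pz v y + sc w (Ph v y)" "sc (w^2) (Po v y)"]
        norm_triangle_ineq[of "Pz v y" "sc w (Ph v y)"] by (simp add: norm_power)
    also have "\<dots> \<le> (B0 + B1 + B2) * norm y" using B[of y] by (simp add: algebra_simps)
    finally show ?thesis .
  qed
  let ?C = "\<lambda>u. tp u u u"
  have C: "(?C ^^ n) (rot v w x) = rot v w ((?C ^^ n) x)" for n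
    by (induction n) (simp_all add: rot_tp[OF v w])
  have "(norm (rot v w x) / norm x) ^ (3 ^ n) \<le> B0 + B1 + B2" for n
  proof -
    have "norm (rot v w x) ^ (3 ^ n) \<le> (B0 + B1 + B2) * norm x ^ (3 ^ n)"
      using UB[of "(?C ^^ n) x"] by (simp add: norm_cube_pow[symmetric] C)
    thus ?thesis using False by (simp add: power_divide divide_le_eq)
  qed
  hence "norm (rot v w x) / norm x \<le> 1" by (rule norm_le_1_if_power_bounded)
  thus ?thesis using False by (simp add: divide_le_eq)
qed

lemma sc_plus_cnj: "sc w x + sc (cnj w) x = (2 * Re w) *\<^sub>R x"
  by (simp add: cscale_def scaleR_left_distrib[symmetric])

lemma rot_plus_rot_cnj:
  "rot v w x + rot v (cnj w) x = 2 *\<^sub>R Pz v x + (2 * Re w) *\<^sub>R Ph v x + (2 * Re (w^2)) *\<^sub>R Po v x"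
  using sc_plus_cnj[of w "Ph v x"] sc_plus_cnj[of "w^2" "Po v x"]
  by (simp add: rot_def scaleR_2 algebra_simps)

definition cube_root :: complex where "cube_root = Complex (-1/2) (sqrt 3 / 2)"

lemma cube_root: "cmod cube_root = 1" "Re cube_root = - 1/2" "Re (cube_root^2) = - 1/2"
proof -
  show "cmod cube_root = 1" by (simp add: cube_root_def cmod_def power_divide)
  show "Re cube_root = - 1/2" by (simp add: cube_root_def)
  show "Re (cube_root^2) = - 1/2" by (simp add: cube_root_def power2_eq_square)
qed

text \<open>Averaging over the third roots of unity cancels the factors w and w^2; as an average of
  contractions \<open>Pz v\<close> becomes a contraction.\<close>

lemma Pz_average: "3 *\<^sub>R Pz v x = x + rot v cube_root x + rot v (cnj cube_root) x"
proof -
  have "x + (rot v cube_root x + rot v (cnj cube_root) x)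
      = Pz v x + Ph v x + Po v x + (2 *\<^sub>R Pz v x + (2 * Re cube_root) *\<^sub>R Ph v x + (2 * Re (cube_root^2)) *\<^sub>R Po v x)"
    unfolding rot_plus_rot_cnj Peirce_sum ..
  also have "\<dots> = Pz v x + 2 *\<^sub>R Pz v x" unfolding cube_root by simp
  also have "\<dots> = 3 *\<^sub>R Pz v x" using scaleR_left_distrib[of 1 2 "Pz v x"] by simp
  finally show ?thesis by (simp add: add.assoc)
qed

lemma norm_Pz_le:
  assumes v: "tripotent v" shows "norm (Pz v x) \<le> norm x"
proof -
  have "norm (3 *\<^sub>R Pz v x) \<le> norm x + norm (rot v cube_root x) + norm (rot v (cnj cube_root) x)"
    unfolding Pz_average by (meson add_right_mono norm_triangle_ineq order_trans)
  also have "\<dots> \<le> 3 * norm x"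
    using norm_rot_le[OF v, of cube_root x] norm_rot_le[OF v, of "cnj cube_root" x] cube_root by simp
  finally show ?thesis by simp
qed

lemma Pz_Pz: "tripotent v \<Longrightarrow> Pz v (Pz v x) = Pz v x"
  using eig_P(1) Pz_eig0 by blast

lemma Pz_eig: "eig v (real k / 2) x \<Longrightarrow> k \<le> 2 \<Longrightarrow> k > 0 \<Longrightarrow> Pz v x = 0"
  using Pz_eig_half Pz_eig1 by (cases "k = 1") (auto dest: le_antisym)

lemma Pz_rot:
  assumes v: "tripotent v" shows "Pz v (rot v w x) = Pz v x"
proof (rule Peirce_induct_nat[OF v, of "\<lambda>x. Pz v (rot v w x) = Pz v x"])
  fix k x assume k: "k \<le> 2" and x: "eig v (real k / 2) x"
  show "Pz v (rot v w x) = Pz v x"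
  proof (cases "k = 0")
    case False
    have "eig v (real k / 2) (sc (w ^ k) x)" using x by (simp add: tp_sc3 sc_scaleR)
    thus ?thesis unfolding rot_eig[OF x k] using False k x Pz_eig[where v = v and k = k] by simp
  qed (use rot_eig[OF x k] in simp)
qed (simp add: rot_add linear_add[OF linear_Pz])

lemma rot_rot_cnj:
  assumes v: "tripotent v" and w: "cmod w = 1" shows "rot v w (rot v (cnj w) x) = x"
proof (rule Peirce_induct_nat[OF v, of "\<lambda>x. rot v w (rot v (cnj w) x) = x"])
  fix k x assume k: "k \<le> 2" and x: "eig v (real k / 2) x"
  have e: "eig v (real k / 2) (sc (cnj w ^ k) x)" using x by (simp add: tp_sc3 sc_scaleR)
  have "w ^ k * cnj w ^ k = 1"
    using w complex_norm_square[of w] by (simp flip: power_mult_distrib)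
  thus "rot v w (rot v (cnj w) x) = x"
    unfolding rot_eig[OF x k] rot_eig[OF e k] sc_sc by simp
qed (simp add: rot_add)

text \<open>P0 absorbs rotations, and a rotation of the first variable can be traded for the inverse
  rotations of the other two. Thus the inner projection is replaced by an average over products with
  \<open>y\<close> itself, which the induction in \<open>Y_ideal\<close> needs.\<close>

lemma Pz_tp_Pz_average:
  assumes v: "tripotent v"
  obtains b1 c1 b2 c2 where "norm b1 \<le> norm b" "norm c1 \<le> norm c" "norm b2 \<le> norm b" "norm c2 \<le> norm c"
    "3 *\<^sub>R Pz v (tp (Pz v y) b c) = Pz v (tp y b c) + Pz v (tp y b1 c1) + Pz v (tp y b2 c2)"
proof -
  have *: "Pz v (tp (rot v w y) b c) = Pz v (tp y (rot v (cnj w) b) (rot v (cnj w) c))" if w: "cmod w = 1" for w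
  proof -
    have "tp (rot v w y) b c = rot v w (tp y (rot v (cnj w) b) (rot v (cnj w) c))"
      using rot_tp[OF v w, of y "rot v (cnj w) b" "rot v (cnj w) c"] rot_rot_cnj[OF v w] by simp
    thus ?thesis using Pz_rot[OF v] by simp
  qed
  have "3 *\<^sub>R Pz v (tp (Pz v y) b c) = Pz v (tp (3 *\<^sub>R Pz v y) b c)"
    by (simp add: tp_scaleR1 linear_scale[OF linear_Pz])
  also have "\<dots> = Pz v (tp y b c) + Pz v (tp (rot v cube_root y) b c) + Pz v (tp (rot v (cnj cube_root) y) b c)"
    unfolding Pz_average by (simp add: tp_add1 linear_add[OF linear_Pz])
  finally show ?thesis
    using that[OF norm_rot_le[OF v] norm_rot_le[OF v] norm_rot_le[OF v] norm_rot_le[OF v]] *[of cube_root] *[of "cnj cube_root"]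
      cube_root(1) by (metis complex_cnj_cnj complex_mod_cnj)
qed

section \<open>Orthogonality to a tripotent\<close>

text \<open>Two instances of the Jordan identity evaluate \<open>tp v v (tp v c x)\<close> with and
  without an extra term \<open>tp v c x\<close>, which therefore vanishes; likewise with
  \<open>c\<close> and \<open>v\<close> exchanged.\<close>

lemma eig0_orthogonal:
  assumes v: "tripotent v" and c: "eig v 0 c"
  shows "tp v c v = 0" "tp v c x = 0" "tp c v x = 0"
proof -
  have c0: "tp v v c = 0" "tp c v v = 0" using c tp_sym[of c v v] by simp_all
  have vv: "tp v v v = v" using v by (simp add: tripotent_def)
  show Q: "tp v c v = 0" using tripotent_Q[OF v, of c] tp_Q_commute[of v c] c0 by simp
  have "tp v v (tp v c x) = tp v c x + tp v c (tp v v x)" using jordan[of v v v c x] c0 vv by simp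
  moreover have "tp v c (tp v v x) = tp v v (tp v c x)" using jordan[of v c v v x] c0 Q by simp
  ultimately show "tp v c x = 0" by simp
  have "tp v v (tp c v x) = - tp c v x + tp c v (tp v v x)" using jordan[of v v c v x] c0 vv by simp
  moreover have "tp c v (tp v v x) = tp v v (tp c v x)" using jordan[of c v v v x] c0 Q by simp
  ultimately show "tp c v x = 0" by simp
qed

text \<open>\<open>b\<close> has the form {v, b', v}; expanding a Jordan identity around it leaves
  otherwise only terms that contain the orthogonal pair \<open>v\<close>, \<open>c\<close>.\<close>

lemma eig1_eig0_tp:
  assumes v: "tripotent v" and b: "eig v 1 b" and c: "eig v 0 c"
  shows "tp v b c = 0"
proof -
  define b' where "b' = tp v b v"
  have "Po v b = b" using b by (simp add: Po_def scaleR_2)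
  hence b': "tp v b' v = b" using tripotent_QQ[OF v, of b] by (simp add: b'_def)
  note o = eig0_orthogonal[OF v c]
  have "tp b' v (tp c v v) = tp (tp b' v c) v v - tp c (tp v b' v) v + tp c v (tp b' v v)" by (rule jordan)
  hence "tp c b v = 0" using o(3) b' tp_sym[of b' v c] by simp
  thus ?thesis using tp_sym[of v b c] by simp
qed

text \<open>For \<open>b\<close> and \<open>c\<close> of Peirce index j and k the product has index
  2 - j + k. This is 0 only for j = 2 and k = 0, the case of \<open>eig1_eig0_tp\<close>.\<close>

lemma Pz_tp_tripotent:
  assumes v: "tripotent v"
  shows "Pz v (tp v b c) = 0"
proof -
  have base: "Pz v (tp v b c) = 0"
    if jk: "j \<le> 2" "k \<le> 2" and b: "eig v (real j / 2) b" and c: "eig v (real k / 2) c" for j k b c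
  proof (cases "j = 2 \<and> k = 0")
    case True
    thus ?thesis using eig1_eig0_tp[OF v, of b c] b c linear_0[OF linear_Pz] by simp
  next
    case False
    define t where "t = 1 - real j / 2 + real k / 2"
    have "eig v 1 v" using v by (simp add: tripotent_def)
    from eig_tp[OF this b c] have e: "eig v t (tp v b c)" by (simp add: t_def)
    have "t \<noteq> 0"
    proof
      assume "t = 0"
      hence "real (2 + k) = real j" by (simp add: t_def)
      hence "2 + k = j" by (simp only: of_nat_eq_iff)
      with False jk show False by linarith
    qed
    then consider "t = 1/2" | "t = 1" | "tp v b c = 0" using eig_values[OF v e] by blast
    thus ?thesis using e Pz_eig_half Pz_eig1 linear_0[OF linear_Pz] by cases auto
  qed
  have 1: "Pz v (tp v b c) = 0" if "j \<le> 2" "eig v (real j / 2) b" for j b c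
    by (rule Peirce_induct_nat[OF v, of "\<lambda>c. Pz v (tp v b c) = 0"])
      (use base that in \<open>auto simp: tp_add3 linear_add[OF linear_Pz]\<close>)
  show ?thesis
    by (rule Peirce_induct_nat[OF v, of "\<lambda>b. Pz v (tp v b c) = 0"])
      (use 1 in \<open>auto simp: tp_add2 linear_add[OF linear_Pz]\<close>)
qed

lemma Pz_self: "tripotent v \<Longrightarrow> Pz v v = 0"
  using Pz_tp_tripotent[of v v v] by (simp add: tripotent_def)

text \<open>The components of index 1 and 2 would give products with eigenvalues - 1/2 and - 1,
  which do not occur.\<close>

lemma tp_Pz_compl:
  assumes v: "tripotent v"
  shows "tp (Pz v e) (x - Pz v x) (Pz v e) = 0"
proof -
  let ?e = "Pz v e"
  have e: "eig v 0 ?e" by (rule eig_P(1)[OF v])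
  have "tp ?e (Ph v x) ?e = 0"
    by (rule eig_values[OF v eig_tp[OF e eig_P(2)[OF v] e]]) auto
  moreover have "tp ?e (Po v x) ?e = 0"
    by (rule eig_values[OF v eig_tp[OF e eig_P(3)[OF v] e]]) auto
  moreover have "x - Pz v x = Ph v x + Po v x" using Peirce_sum[of v x] by (simp add: algebra_simps)
  ultimately show ?thesis by (simp add: tp_add2)
qed

lemma tp_tripotent_Pz: "tripotent v \<Longrightarrow> tp v (Pz v x) v = 0"
  using eig0_orthogonal(1) eig_P(1) by blast

text \<open>Cubing acts separately on the orthogonal summands and fixes
  \<open>s *\<^sub>R v\<close>, so all iterated cubes are bounded by
  \<open>norm v + 1\<close>.\<close>

lemma norm_tripotent_plus_Pz_le:
  assumes v: "tripotent v" and s: "s = 1 \<or> s = (- 1 :: real)" and y: "norm y \<le> 1"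
  shows "norm (s *\<^sub>R v + Pz v y) \<le> 1"
proof -
  let ?C = "\<lambda>u. tp u u u"
  have vv: "tp v v v = v" using v by (simp add: tripotent_def)
  have cube: "?C (s *\<^sub>R v + c) = s *\<^sub>R v + ?C c \<and> eig v 0 (?C c)" if c: "eig v 0 c" for c
  proof
    note o = eig0_orthogonal[OF v c]
    have "tp v v c = 0" "tp c v v = 0" "tp c c v = 0" using c o tp_sym[of c v v] tp_sym[of c c v] by simp_all
    moreover have "s * (s * s) = s" using s by auto
    ultimately show "?C (s *\<^sub>R v + c) = s *\<^sub>R v + ?C c" using o vv by (simp add: tp_linear)
    show "eig v 0 (?C c)" using eig_tp[OF c c c] by simp
  qed
  have iter: "(?C ^^ n) (s *\<^sub>R v + Pz v y) = s *\<^sub>R v + (?C ^^ n) (Pz v y) \<and> eig v 0 ((?C ^^ n) (Pz v y))" for n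
    by (induction n) (use cube eig_P(1)[OF v] in auto)
  have "norm (Pz v y) \<le> 1" using norm_Pz_le[OF v, of y] y by simp
  hence "norm (s *\<^sub>R v + Pz v y) ^ (3 ^ n) \<le> norm v + 1" for n
  proof -
    have "norm (s *\<^sub>R v + Pz v y) ^ (3 ^ n) = norm (s *\<^sub>R v + (?C ^^ n) (Pz v y))"
      using iter norm_cube_pow by metis
    also have "\<dots> \<le> norm (s *\<^sub>R v) + norm ((?C ^^ n) (Pz v y))" by (rule norm_triangle_ineq)
    also have "\<dots> \<le> norm v + 1"
      using s \<open>norm (Pz v y) \<le> 1\<close> by (auto simp: norm_cube_pow power_le_one)
    finally show ?thesis .
  qed
  thus ?thesis by (rule norm_le_1_if_power_bounded)
qed

end

section \<open>JBW*-triples\<close>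

context complex_banach
begin

section \<open>Polynomials with vector coefficients\<close>

inductive cpoly :: "(complex \<Rightarrow> 'a) \<Rightarrow> bool" where
  const: "cpoly (\<lambda>_. a)"
| add: "cpoly f \<Longrightarrow> cpoly g \<Longrightarrow> cpoly (\<lambda>w. f w + g w)"
| mult: "cpoly f \<Longrightarrow> cpoly (\<lambda>w. sc w (f w))"

lemma cpoly_sc: "cpoly f \<Longrightarrow> cpoly (\<lambda>w. sc c (f w))"
proof (induction rule: cpoly.induct)
  case (mult f)
  have "cpoly (\<lambda>w. sc w (sc c (f w)))" by (rule cpoly.mult[OF mult.IH])
  thus ?case by (simp add: sc_sc mult.commute)
qed (auto simp: sc_add_right intro: cpoly.intros)

lemma cpoly_linear:
  assumes "\<And>x y. S (x + y) = S x + S y" "\<And>c x. S (sc c x) = sc c (S x)" and f: "cpoly f"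
  shows "cpoly (\<lambda>w. S (f w))"
  using f by induction (auto simp: assms intro: cpoly.intros)

lemma cpoly_bilinear:
  assumes "\<And>x y z. B (x + y) z = B x z + B y z" "\<And>c x z. B (sc c x) z = sc c (B x z)"
    "\<And>x y z. B z (x + y) = B z x + B z y" "\<And>c x z. B z (sc c x) = sc c (B z x)"
    and f: "cpoly f" and g: "cpoly g"
  shows "cpoly (\<lambda>w. B (f w) (g w))"
  using f
proof induction
  case (const a)
  show ?case by (rule cpoly_linear[OF _ _ g]) (simp_all add: assms)
qed (auto simp: assms intro: cpoly.intros)

lemma cpoly_holomorphic: "cpoly f \<Longrightarrow> (\<lambda>w. lc l (f w)) holomorphic_on UNIV"
  by (induction rule: cpoly.induct) (auto simp: lc_add lc_sc intro!: holomorphic_intros)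

end

locale jbw_triple = jb_triple Jm tp for Jm :: "'m::banach \<Rightarrow> 'm" and tp +
  fixes Jp :: "'p::banach \<Rightarrow> 'p" and T :: "'m \<Rightarrow> ('p \<Rightarrow>\<^sub>L real)"
  assumes predual: "predual_iso Jm Jp T"
begin

section \<open>The predual as a space of functionals\<close>

lemma linear_T: "linear T" and bij_T: "bij T" and norm_T [simp]: "norm (T m) = norm m"
  and T_J: "T (Jm m) p = T m (Jp p)"
  using predual by (simp_all add: predual_iso_def)

lemma T_add: "T (x + y) p = T x p + T y p" and T_diff: "T (x - y) p = T x p - T y p"
  and T_scaleR: "T (r *\<^sub>R x) p = r * T x p" and T_minus: "T (- x) p = - T x p" and T_zero [simp]: "T 0 p = 0"
  using linear_T by (simp_all add: linear_add linear_diff linear_scale linear_neg linear_0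
      blinfun.add_left blinfun.diff_left blinfun.scaleR_left blinfun.minus_left blinfun.zero_left)

lemma T_le: "\<bar>T x p\<bar> \<le> norm x * norm p"
  using norm_blinfun[of "T x" p] by simp

lemma T_eqI:
  assumes "\<And>p. T x p = T y p" shows "x = y"
proof -
  have "T x = T y" by (rule blinfun_eqI) (rule assms)
  thus ?thesis using bij_T by (meson bij_is_inj injD)
qed

lemma T_representation:
  assumes "linear f" "\<And>p. f p \<le> C * norm p" "C \<ge> 0"
  obtains m where "\<And>p. T m p = f p" "norm m \<le> C"
proof -
  obtain l :: "'p \<Rightarrow>\<^sub>L real" where l: "\<And>p. l p = f p" "norm l \<le> C"
    using blinfun_of_dominated[OF assms] by blast
  obtain m where "l = T m" using bij_T by (metis bij_pointE)
  with l that[of m] norm_T[of m] show ?thesis by simp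
qed

definition pf :: "'p \<Rightarrow> ('m \<Rightarrow>\<^sub>L real)" where "pf p = Blinfun (\<lambda>m. T m p)"

lemma pf_apply [simp]: "blinfun_apply (pf p) m = T m p"
proof -
  have "bounded_linear (\<lambda>m. T m p)"
    by (rule bounded_linear_intro[where K = "norm p"]) (use T_le in \<open>auto simp: T_add T_scaleR\<close>)
  thus ?thesis by (simp add: pf_def bounded_linear_Blinfun_apply)
qed

lemma norm_pf [simp]: "norm (pf p) = norm p"
proof (rule antisym)
  show "norm (pf p) \<le> norm p"
    by (rule norm_blinfun_bound) (use T_le in \<open>auto simp: mult.commute\<close>)
  obtain f :: "'p \<Rightarrow>\<^sub>L real" where f: "norm f \<le> 1" "f p = norm p" by (rule norming_functional)
  obtain m where m: "f = T m" using bij_T by (metis bij_pointE)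
  hence nm: "norm m \<le> 1" using f norm_T[of m] by simp
  have "norm p \<le> norm (pf p) * norm m" using blinfun_real_le[of "pf p" m] f m by simp
  also have "\<dots> \<le> norm (pf p)" using nm by (simp add: mult_left_le)
  finally show "norm p \<le> norm (pf p)" .
qed

lemma pf_linear: "pf (x + y) = pf x + pf y" "pf (r *\<^sub>R x) = r *\<^sub>R pf x" "pf (x - y) = pf x - pf y" "pf 0 = 0"
  by (rule blinfun_eqI; simp add: blinfun.add_right blinfun.scaleR_right blinfun.diff_right blinfun.zero_right
      blinfun.add_left blinfun.scaleR_left blinfun.diff_left blinfun.zero_left)+

lemma closed_range_pf: "closed (range pf)"
  unfolding closed_sequential_limits
proof (intro allI impI, elim conjE)
  fix f l assume f: "\<forall>n. f n \<in> range pf" and lim: "f \<longlonglongrightarrow> l"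
  hence "\<forall>n. \<exists>x. f n = pf x" by blast
  then obtain x where x: "\<And>n. f n = pf (x n)" by metis
  have "Cauchy f" using lim LIMSEQ_imp_Cauchy by blast
  moreover have "dist (f m) (f n) = dist (x m) (x n)" for m n
    by (simp add: dist_norm x pf_linear(3)[symmetric] del: pf_apply)
  ultimately have "Cauchy x" by (simp add: Cauchy_def)
  then obtain y where y: "x \<longlonglongrightarrow> y" using Cauchy_convergent convergent_def by blast
  have "(\<lambda>n. norm (pf (x n) - pf y)) \<longlonglongrightarrow> 0"
    unfolding pf_linear(3)[symmetric] norm_pf by (rule tendsto_norm_zero[OF LIM_zero[OF y]])
  hence "(\<lambda>n. pf (x n)) \<longlonglongrightarrow> pf y" by (rule LIM_zero_cancel[OF tendsto_norm_zero_cancel])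
  moreover have "f = (\<lambda>n. pf (x n))" using x by auto
  ultimately have "f \<longlonglongrightarrow> pf y" by simp
  with lim have "l = pf y" by (rule LIMSEQ_unique)
  thus "l \<in> range pf" by simp
qed

lemma subspace_range_pf: "subspace (range pf)"
proof (rule subspaceI)
  show "0 \<in> range pf" using pf_linear(4) by (metis rangeI)
  show "x + y \<in> range pf" if "x \<in> range pf" "y \<in> range pf" for x y
    using that by (auto simp flip: pf_linear(1))
  show "c *\<^sub>R x \<in> range pf" if "x \<in> range pf" for c x
    using that by (auto simp flip: pf_linear(2))
qed

lemma T_norm_attained_upto:
  assumes "e > 0"
  obtains p where "norm p \<le> 1" "norm y - e \<le> T y p"
proof (rule ccontr)
  assume no: "\<not> thesis"
  note witness = that
  have lt: "T y p < norm y - e" if "norm p \<le> 1" for p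
    using witness[OF that] no by (meson not_le)
  have pos: "0 \<le> norm y - e" using lt[of 0] by simp
  have "norm (T y) \<le> norm y - e"
  proof (rule norm_blinfun_bound[OF pos])
    fix p
    have "T y p \<le> (norm y - e) * norm p" for p
    proof (cases "p = 0")
      case False
      have "T y ((1 / norm p) *\<^sub>R p) < norm y - e" using False by (intro lt) simp
      thus ?thesis using False by (simp add: blinfun.scaleR_right field_simps)
    qed simp
    from this[of p] this[of "- p"] show "norm (T y p) \<le> (norm y - e) * norm p"
      by (simp add: blinfun.minus_right abs_le_iff)
  qed
  with assms show False by simp
qed

subsection \<open>Separate weak-star continuity of the triple product\<close>

text \<open>If the numerical range of q with respect to the predual vanishes, the Euler flow
  x \<mapsto> x + (w / n) q x is almost isometric for every complex w, and Liouville's argument gives q = 0.\<close>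
lemma euler_step_norm:
  assumes C: "C \<ge> 0" and bnd: "\<And>x. norm x \<le> 2 \<Longrightarrow> norm (q x) \<le> C"
    and lip: "\<And>x y. norm x \<le> 2 \<Longrightarrow> norm y \<le> 2 \<Longrightarrow> norm (q x - q y) \<le> C * norm (x - y)"
    and zero: "\<And>a p. T a p = norm a * norm p \<Longrightarrow> T (q a) p = 0 \<and> T (Jm (q a)) p = 0"
    and e: "e > 0"
  obtains t0 where "t0 > 0"
    "\<And>t x. cmod t \<le> t0 \<Longrightarrow> norm x \<le> 2 \<Longrightarrow> norm (x + sc t (q x)) \<le> max 1 (norm x) + e * cmod t"
proof -
  \<comment> \<open>Replacing \<open>x\<close> by \<open>v\<close> costs \<open>6 * k * C\<close>
    and replacing \<open>p\<close> by \<open>h'\<close> costs \<open>k * C\<close>, both per unit of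
    \<open>cmod t\<close>; together this is at most \<open>e / 2\<close>.\<close>
  define k where "k = min (1/4) (e / (14 * (C + 1)))"
  have k: "0 < k" "k \<le> 1/4" "7 * k * C \<le> e / 2"
  proof -
    show "0 < k" using e C by (simp add: k_def)
    show "k \<le> 1/4" unfolding k_def by (rule min.cobounded1)
    have "k \<le> e / (14 * (C + 1))" by (simp add: k_def)
    hence "14 * (C + 1) * k \<le> e" using C by (simp add: pos_le_divide_eq mult.commute)
    moreover have "14 * C * k \<le> 14 * (C + 1) * k" using \<open>0 < k\<close> by simp
    ultimately show "7 * k * C \<le> e / 2" by (simp add: mult_ac)
  qed
  \<comment> \<open>The first bound keeps \<open>norm x\<close> at least 1/2, the second makes the
    normalized pair norming up to \<open>k\<^sup>2\<close>, as the Bishop-Phelps-Bollobas theorem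
    requires.\<close>
  define t0 where "t0 = min (1 / (2 * (C + 1))) (k\<^sup>2 / (2 * (C + e)))"
  have t0: "t0 > 0" "t0 * C \<le> 1/2" "2 * (t0 * (C + e)) \<le> k\<^sup>2"
  proof -
    show p: "t0 > 0" using C e k by (simp add: t0_def add_nonneg_pos)
    have "t0 \<le> 1 / (2 * (C + 1))" "t0 \<le> k\<^sup>2 / (2 * (C + e))" by (simp_all add: t0_def)
    hence "t0 * (2 * (C + 1)) \<le> 1" "t0 * (2 * (C + e)) \<le> k\<^sup>2"
      using C e by (simp_all add: pos_le_divide_eq add_nonneg_pos)
    thus "2 * (t0 * (C + e)) \<le> k\<^sup>2" "t0 * C \<le> 1/2" using p by (simp_all add: algebra_simps)
  qed
  have main: "norm (x + sc t (q x)) \<le> max 1 (norm x) + e * cmod t" if t: "cmod t \<le> t0" and x: "norm x \<le> 2" for t x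
  proof (cases "norm (x + sc t (q x)) \<le> max 1 (norm x) \<or> t = 0")
    case True
    thus ?thesis
    proof
      assume "norm (x + sc t (q x)) \<le> max 1 (norm x)"
      moreover have "0 \<le> e * cmod t" using e by simp
      ultimately show ?thesis by linarith
    qed simp
  next
    case False
    \<comment> \<open>Only a step that leaves the unit ball and increases the norm matters; then
      \<open>x\<close> is bounded away from 0 and can be normalized.\<close>
    define y where "y = x + sc t (q x)"
    have t1: "cmod t > 0" and y: "norm y > 1" "norm y > norm x" using False by (auto simp: y_def)
    have tq: "norm (sc t (q x)) \<le> cmod t * C" using bnd[OF x] by (simp add: mult_left_mono)
    have tC: "cmod t * C \<le> 1/2" using mult_right_mono[OF t C] t0 by simp
    have "norm y \<le> norm x + cmod t * C" unfolding y_def using norm_triangle_ineq[of x "sc t (q x)"] tq by linarith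
    hence x2: "norm x \<ge> 1/2" using y tC by linarith
    have x0: "norm x > 0" using x2 by linarith
    have "e * cmod t / 2 > 0" using e t1 by simp
    then obtain p where p: "norm p \<le> 1" "norm y - e * cmod t / 2 \<le> T y p"
      by (rule T_norm_attained_upto)
    have Tq: "\<bar>T (sc t (q x)) p\<bar> \<le> cmod t * C"
      using T_le[of "sc t (q x)" p] mult_left_le[OF p(1), of "norm (sc t (q x))"] tq by simp
    have Tx: "norm x - cmod t * (C + e) \<le> T x p"
    proof -
      have "T x p = T y p - T (sc t (q x)) p" by (simp add: y_def T_add)
      moreover have "e * cmod t \<ge> 0" using e by simp
      ultimately show ?thesis using p(2) Tq y by (simp add: algebra_simps)
    qed
    define x' where "x' = (1 / norm x) *\<^sub>R x"
    have "1 - k\<^sup>2 \<le> T x' p"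
    proof -
      have "cmod t * (C + e) \<le> t0 * (C + e)" using t C e by (intro mult_right_mono) auto
      hence "2 * (cmod t * (C + e)) \<le> k\<^sup>2" using t0(3) by linarith
      moreover have "k\<^sup>2 * (1/2) \<le> k\<^sup>2 * norm x" using x2 by (intro mult_left_mono) auto
      ultimately have "norm x * (1 - k\<^sup>2) \<le> T x p" using Tx by (simp add: algebra_simps)
      thus ?thesis using x0 by (simp add: x'_def T_scaleR field_simps)
    qed
    moreover have "norm (T x') \<le> 1" using x0 by (simp add: x'_def)
    \<comment> \<open>An exactly norming pair is needed, since \<open>zero\<close> says nothing
      about approximate ones.\<close>
    ultimately obtain a' h' where ah: "norm a' = 1" "norm h' = 1" "blinfun_apply a' h' = 1"
      "norm (T x' - a') \<le> 3 * k" "norm (p - h') \<le> k"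
      using bishop_phelps_bollobas[OF k(1,2) _ p(1)] by metis
    obtain x'' where x'': "a' = T x''" using bij_T by (metis bij_pointE)
    have nx'': "norm x'' = 1" using ah(1) x'' by simp
    define v where "v = norm x *\<^sub>R x''"
    have v: "norm v = norm x" using nx'' by (simp add: v_def)
    have "T v h' = norm v * norm h'" using ah x'' v by (simp add: v_def T_scaleR)
    from zero[OF this] have z0: "T (sc t (q v)) h' = 0" by (simp add: cscale_def T_add T_scaleR)
    have "x - v = norm x *\<^sub>R (x' - x'')" using x0 by (simp add: v_def x'_def scaleR_diff_right)
    moreover have "norm (x' - x'') \<le> 3 * k" using ah(4) unfolding x'' linear_diff[OF linear_T, symmetric] by simp
    moreover have "norm x * norm (x' - x'') \<le> 2 * (3 * k)" using x calculation(2) by (intro mult_mono) auto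
    ultimately have "norm (x - v) \<le> 2 * (3 * k)" by simp
    hence "norm (q x - q v) \<le> C * (2 * (3 * k))"
      using order_trans[OF lip[OF x, of v] mult_left_mono[OF _ C]] v x by simp
    hence "norm (sc t (q x - q v)) \<le> cmod t * (C * (2 * (3 * k)))" by (simp add: mult_left_mono)
    moreover have "\<bar>T (sc t (q x - q v)) h'\<bar> \<le> norm (sc t (q x - q v))"
      using T_le[of "sc t (q x - q v)" h'] ah by simp
    moreover have "\<bar>T (sc t (q x)) (p - h')\<bar> \<le> (cmod t * C) * k"
      using T_le[of "sc t (q x)" "p - h'"] mult_mono[OF tq ah(5)] C by simp
    moreover have "T (sc t (q x)) p = T (sc t (q x)) (p - h') + T (sc t (q x - q v)) h' + T (sc t (q v)) h'"
      by (simp add: blinfun.diff_right sc_diff_right T_diff)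
    ultimately have "T (sc t (q x)) p \<le> cmod t * (7 * k * C)" using z0 by (simp add: algebra_simps)
    also have "\<dots> \<le> cmod t * (e / 2)" using k(3) by (intro mult_left_mono) auto
    finally have "T (sc t (q x)) p \<le> e * cmod t / 2" by (simp add: mult_ac)
    moreover have "T x p \<le> norm x" using T_le[of x p] mult_left_le[OF p(1), of "norm x"] by simp
    ultimately have "norm y \<le> norm x + e * cmod t" using p(2) by (simp add: y_def T_add)
    thus ?thesis by (simp add: y_def)
  qed
  show ?thesis by (rule that[OF t0(1) main])
qed

text \<open>For \<open>cmod w \<le> R\<close> the Euler iterates stay in the ball of radius 2, and
  at w = 0 their derivative in w is \<open>q a\<close>; Cauchy's inequality gives the bound 2 / R
  for every R. The map \<open>q\<close> may be quadratic, and \<open>poly\<close> keeps its iterates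
  polynomial in \<open>w\<close>.\<close>

lemma zero_numerical_range:
  assumes C: "C \<ge> 0" and bnd: "\<And>x. norm x \<le> 2 \<Longrightarrow> norm (q x) \<le> C"
    and lip: "\<And>x y. norm x \<le> 2 \<Longrightarrow> norm y \<le> 2 \<Longrightarrow> norm (q x - q y) \<le> C * norm (x - y)"
    and zero: "\<And>a p. T a p = norm a * norm p \<Longrightarrow> T (q a) p = 0 \<and> T (Jm (q a)) p = 0"
    and poly: "\<And>f. cpoly f \<Longrightarrow> cpoly (\<lambda>w. q (f w))"
    and a: "norm a \<le> 1"
  shows "q a = 0"
proof -
  have bound: "norm (q a) \<le> 2 / R" if R: "R > 0" for R
  proof -
    have "1 / R > 0" using R by simp
    then obtain t0 where t0: "t0 > 0"
      "\<And>t x. cmod t \<le> t0 \<Longrightarrow> norm x \<le> 2 \<Longrightarrow> norm (x + sc t (q x)) \<le> max 1 (norm x) + 1 / R * cmod t"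
      using euler_step_norm[OF C bnd lip zero] by blast
    obtain n :: nat where "R / t0 < n" using reals_Archimedean2 by blast
    hence Rn: "R < t0 * n" using t0(1) by (simp add: pos_divide_less_eq mult.commute)
    have "n > 0" using Rn R by (intro Nat.gr0I) auto
    hence n: "n > 0" "R / n \<le> t0" using Rn by (simp_all add: pos_divide_le_eq)
    define f where "f = rec_nat (\<lambda>_. a) (\<lambda>_ g w. g w + sc (w / of_nat n) (q (g w)))"
    have f0: "f 0 w = a" and f1: "f (Suc j) w = f j w + sc (w / of_nat n) (q (f j w))" for j w
      by (simp_all add: f_def)
    have fpoly: "cpoly (f j)" for j
    proof (induction j)
      case (Suc j)
      have "cpoly (\<lambda>w. sc w (sc (1 / of_nat n) (q (f j w))))" by (intro cpoly.mult cpoly_sc poly Suc)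
      from cpoly.add[OF Suc this] show ?case by (simp add: f1[abs_def] sc_sc fun_eq_iff)
    qed (simp add: f0[abs_def] cpoly.const)
    have fn: "norm (f j w) \<le> 1 + real j / n" if w: "cmod w \<le> R" and "j \<le> n" for j w
      using that(2)
    proof (induction j)
      case (Suc j)
      have wn: "cmod (w / of_nat n) \<le> R / n" using w by (simp add: norm_divide divide_right_mono)
      have jn: "real j / n \<le> 1" using Suc.prems n by simp
      have "norm (f (Suc j) w) \<le> max 1 (norm (f j w)) + 1 / R * cmod (w / of_nat n)"
      proof -
        have "norm (f j w) \<le> 1 + real j / n" using Suc by simp
        hence "norm (f j w) \<le> 2" using jn by linarith
        thus ?thesis unfolding f1 using wn n by (intro t0(2)) auto
      qed
      also have "max 1 (norm (f j w)) \<le> 1 + real j / n" using Suc by auto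
      also have "1 / R * cmod (w / of_nat n) \<le> 1 / R * (R / n)" using wn R by (intro mult_left_mono) auto
      finally show ?case using R by (simp add: add_divide_distrib)
    qed (use a f0 in simp)
    have f2: "norm (f j w) \<le> 2" if "cmod w \<le> R" "j \<le> n" for j w
    proof -
      have "real j / n \<le> 1" using that(2) n by simp
      with fn[OF that] show ?thesis by linarith
    qed
    have d1: "norm (f j w - a) \<le> (real j / n) * (cmod w * C)" if w: "cmod w \<le> R" and "j \<le> n" for j w
      using that(2)
    proof (induction j)
      case (Suc j)
      have "f (Suc j) w - a = (f j w - a) + sc (w / of_nat n) (q (f j w))" by (simp add: f1)
      hence "norm (f (Suc j) w - a) \<le> norm (f j w - a) + norm (sc (w / of_nat n) (q (f j w)))"
        using norm_triangle_ineq by metis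
      also have "norm (sc (w / of_nat n) (q (f j w))) \<le> cmod w / n * C"
      proof -
        have "norm (q (f j w)) \<le> C" using bnd[OF f2[OF w, of j]] Suc by simp
        hence "cmod (w / of_nat n) * norm (q (f j w)) \<le> cmod (w / of_nat n) * C" by (intro mult_left_mono) auto
        thus ?thesis by (simp only: norm_sc norm_divide norm_of_nat)
      qed
      finally show ?case using Suc by (simp add: add_divide_distrib algebra_simps)
    qed (simp add: f0)
    have d2: "norm (f j w - a - sc (of_nat j / of_nat n * w) (q a)) \<le> (real j / n) * (C\<^sup>2 * (cmod w)\<^sup>2)"
      if w: "cmod w \<le> R" and "j \<le> n" for j w
      using that(2)
    proof (induction j)
      case (Suc j)
      have "of_nat (Suc j) / of_nat n * w = of_nat j / of_nat n * w + w / of_nat n"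
        by (simp add: add_divide_distrib algebra_simps)
      hence "f (Suc j) w - a - sc (of_nat (Suc j) / of_nat n * w) (q a)
          = (f j w - a - sc (of_nat j / of_nat n * w) (q a)) + sc (w / of_nat n) (q (f j w) - q a)"
        by (simp only: f1 sc_add_left sc_diff_right algebra_simps)
      hence "norm (f (Suc j) w - a - sc (of_nat (Suc j) / of_nat n * w) (q a))
          \<le> norm (f j w - a - sc (of_nat j / of_nat n * w) (q a)) + norm (sc (w / of_nat n) (q (f j w) - q a))"
        using norm_triangle_ineq by metis
      also have "norm (sc (w / of_nat n) (q (f j w) - q a)) \<le> cmod w / n * (C * (cmod w * C))"
      proof -
        have "norm (q (f j w) - q a) \<le> C * norm (f j w - a)" using f2[OF w, of j] Suc a by (intro lip) auto
        also have "\<dots> \<le> C * ((real j / n) * (cmod w * C))" using d1[OF w, of j] Suc C by (intro mult_left_mono) auto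
        also have "\<dots> \<le> C * (1 * (cmod w * C))" using Suc.prems n C by (intro mult_left_mono mult_right_mono) auto
        finally show ?thesis by (simp add: norm_divide mult_left_mono divide_right_mono)
      qed
      finally show ?case using Suc by (simp add: add_divide_distrib algebra_simps power2_eq_square)
    qed (simp add: f0)
    obtain l :: "'m \<Rightarrow>\<^sub>L real" where l: "norm l \<le> 1" "l (q a) = norm (q a)" by (rule norming_functional)
    define g where "g w = lc l (f n w)" for w
    have lcb: "cmod (lc l x) \<le> norm x" for x
      using norm_lc_le[of l x] mult_left_le_one_le[OF norm_ge_zero[of x] norm_ge_zero[of l] l(1)] by simp
    have hol: "g holomorphic_on UNIV" unfolding g_def by (rule cpoly_holomorphic[OF fpoly])
    have "cmod ((deriv ^^ 1) g 0) \<le> fact 1 * 2 / R ^ 1"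
    proof (rule Cauchy_inequality[OF _ _ R])
      show "g holomorphic_on ball 0 R" "continuous_on (cball 0 R) g"
        using hol by (auto intro: holomorphic_on_subset holomorphic_on_imp_continuous_on continuous_on_subset)
      fix w :: complex assume "cmod (0 - w) = R"
      thus "cmod (g w) \<le> 2" using lcb[of "f n w"] f2[of w n] by (simp add: g_def)
    qed
    moreover have "deriv g 0 = lc l (q a)"
    proof (rule DERIV_imp_deriv)
      have "((\<lambda>w. (g w - g 0) / (w - 0) - lc l (q a)) \<longlongrightarrow> 0) (at 0)"
      proof (rule Lim_null_comparison)
        show "((\<lambda>w. C\<^sup>2 * cmod w) \<longlongrightarrow> 0) (at 0)"
          by (rule tendsto_eq_intros refl | simp)+
        have "eventually (\<lambda>w::complex. w \<noteq> 0 \<and> cmod w < R) (at 0)"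
          unfolding eventually_at using R by (intro exI[of _ R]) auto
        thus "\<forall>\<^sub>F w in at 0. cmod ((g w - g 0) / (w - 0) - lc l (q a)) \<le> C\<^sup>2 * cmod w"
        proof eventually_elim
          case (elim w)
          have "f n 0 = a" using d1[of 0 n] R by simp
          hence "g w - g 0 - w * lc l (q a) = lc l (f n w - a - sc w (q a))"
            by (simp add: g_def lc_diff lc_sc)
          moreover have "norm (f n w - a - sc w (q a)) \<le> C\<^sup>2 * (cmod w)\<^sup>2"
            using d2[of w n] elim n by simp
          ultimately have "cmod (g w - g 0 - w * lc l (q a)) \<le> C\<^sup>2 * (cmod w)\<^sup>2"
            using lcb order_trans by metis
          moreover have "(g w - g 0) / (w - 0) - lc l (q a) = (g w - g 0 - w * lc l (q a)) / w"
            using elim by (simp add: field_simps)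
          ultimately show ?case using elim by (simp add: norm_divide divide_le_eq power2_eq_square mult.assoc)
        qed
      qed
      thus "(g has_field_derivative lc l (q a)) (at 0)"
        unfolding has_field_derivative_iff by (rule LIM_zero_cancel)
    qed
    ultimately have "cmod (lc l (q a)) \<le> 2 / R" by simp
    thus ?thesis using complex_Re_le_cmod[of "lc l (q a)"] l by simp
  qed
  have "norm (q a) \<le> 0 + e" if "e > 0" for e
    using bound[of "2 / e"] that by simp
  hence "norm (q a) \<le> 0" by (rule field_le_epsilon)
  thus ?thesis by simp
qed

lemma predual_norming:
  assumes "T a p = norm a * norm p" "a \<noteq> 0" "p \<noteq> 0"
  shows "norming (pf ((1 / norm p) *\<^sub>R p)) ((1 / norm a) *\<^sub>R a)"
  using assms by (intro normingI) (simp_all add: T_scaleR blinfun.scaleR_right)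

text \<open>Weak-star continuity stated by a preadjoint, the form in which limits are
  computed.\<close>

definition weak_star_cont :: "('m \<Rightarrow> 'm) \<Rightarrow> bool" where
  "weak_star_cont S \<longleftrightarrow> (\<forall>p. \<exists>p'. \<forall>x. T (S x) p = T x p')"

text \<open>If \<open>pf p\<close> composed with \<open>S\<close> were outside the closed range of
  \<open>pf\<close>, some \<open>w\<close> vanishing on the predual would separate it from
  there.\<close>

lemma weak_star_contI:
  assumes S: "bounded_linear S"
    and w: "\<And>w :: ('m \<Rightarrow>\<^sub>L real) \<Rightarrow>\<^sub>L real. (\<And>p. w (pf p) = 0) \<Longrightarrow> \<forall>p. w (pf p o\<^sub>L Blinfun S) = 0"
  shows "weak_star_cont S"
  unfolding weak_star_cont_def
proof
  fix p
  have "pf p o\<^sub>L Blinfun S \<in> range pf"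
  proof (rule ccontr)
    assume "pf p o\<^sub>L Blinfun S \<notin> range pf"
    then obtain w :: "('m \<Rightarrow>\<^sub>L real) \<Rightarrow>\<^sub>L real" where "\<And>s. s \<in> range pf \<Longrightarrow> w s = 0" "w (pf p o\<^sub>L Blinfun S) \<noteq> 0"
      using separating_functional[OF subspace_range_pf closed_range_pf] by blast
    with w[of w] show False by blast
  qed
  then obtain p' where "pf p o\<^sub>L Blinfun S = pf p'" by auto
  hence "blinfun_apply (pf p o\<^sub>L Blinfun S) x = pf p' x" for x by simp
  thus "\<exists>p'. \<forall>x. T (S x) p = T x p'" using S by (auto simp: bounded_linear_Blinfun_apply)
qed

text \<open>\<open>w\<close> composed with the adjoint of \<open>S\<close> and restricted to the
  predual is a bounded functional, hence an element of the triple.\<close>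

lemma bidual_representation:
  fixes w :: "('m \<Rightarrow>\<^sub>L real) \<Rightarrow>\<^sub>L real"
  assumes S: "bounded_linear S" and K: "\<And>x. norm (S x) \<le> K * norm x" "K \<ge> 0"
  obtains m where "\<And>p. T m p = w (pf p o\<^sub>L Blinfun S)" "norm m \<le> norm w * K"
proof -
  have lin: "linear (\<lambda>p. w (pf p o\<^sub>L Blinfun S))"
  proof (rule linearI)
    have 1: "pf (x + y) o\<^sub>L Blinfun S = (pf x o\<^sub>L Blinfun S) + (pf y o\<^sub>L Blinfun S)" for x y
      by (rule blinfun_eqI) (simp add: blinfun.add_left blinfun.add_right)
    have 2: "pf (r *\<^sub>R x) o\<^sub>L Blinfun S = r *\<^sub>R (pf x o\<^sub>L Blinfun S)" for r x
      by (rule blinfun_eqI) (simp add: blinfun.scaleR_left blinfun.scaleR_right)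
    show "w (pf (x + y) o\<^sub>L Blinfun S) = w (pf x o\<^sub>L Blinfun S) + w (pf y o\<^sub>L Blinfun S)" for x y
      by (simp add: 1 blinfun.add_right)
    show "w (pf (r *\<^sub>R x) o\<^sub>L Blinfun S) = r *\<^sub>R w (pf x o\<^sub>L Blinfun S)" for r x
      by (simp add: 2 blinfun.scaleR_right)
  qed
  have "w (pf p o\<^sub>L Blinfun S) \<le> (norm w * K) * norm p" for p
  proof -
    have "norm (pf p o\<^sub>L Blinfun S) \<le> K * norm p"
    proof (rule norm_blinfun_bound)
      fix x
      have "\<bar>T (S x) p\<bar> \<le> (K * norm x) * norm p"
        by (rule order_trans[OF T_le mult_right_mono[OF K(1)]]) simp
      thus "norm ((pf p o\<^sub>L Blinfun S) x) \<le> K * norm p * norm x"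
        using S by (simp add: bounded_linear_Blinfun_apply mult_ac)
    qed (use K in simp)
    hence "norm w * norm (pf p o\<^sub>L Blinfun S) \<le> norm w * (K * norm p)" by (intro mult_left_mono) auto
    with blinfun_real_le[of w "pf p o\<^sub>L Blinfun S"] show ?thesis by (simp add: mult.assoc)
  qed
  thus ?thesis using T_representation[OF lin, of "norm w * K"] that K by auto
qed

lemma norming_tp_fixed_predual:
  assumes "T a p = norm a * norm p"
  shows "T (tp a x a) p = (norm a)\<^sup>2 * T x p" "T (tp x z a) p = T (tp z x a) p"
proof -
  have "T (tp a x a) p = (norm a)\<^sup>2 * T x p \<and> T (tp x z a) p = T (tp z x a) p"
  proof (cases "a = 0 \<or> p = 0")
    case True
    thus ?thesis by (auto simp: blinfun.zero_right)
  next
    case False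
    hence n: "norming (pf ((1 / norm p) *\<^sub>R p)) ((1 / norm a) *\<^sub>R a)"
      using predual_norming[OF assms] by blast
    from norming_tp_fixed(2)[OF n, of x] norming_tp_swap[OF n, of x z] False show ?thesis
      by (simp add: tp_linear T_scaleR blinfun.scaleR_right power2_eq_square field_simps)
  qed
  thus "T (tp a x a) p = (norm a)\<^sup>2 * T x p" "T (tp x z a) p = T (tp z x a) p" by blast+
qed

lemma T_sc: "T (sc c x) p = Re c * T x p + Im c * T x (Jp p)"
  by (simp add: cscale_def T_add T_scaleR T_J)

text \<open>For \<open>w\<close> vanishing on the predual, \<open>B a c\<close> represents the
  values of \<open>w\<close> on the functionals x \<mapsto> {a, x, c}. If \<open>p\<close> norms
  \<open>a\<close>, then {a, x, a} has at \<open>p\<close> the value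
  \<open>(norm a)\<^sup>2 * T x p\<close>, a predual functional killed by \<open>w\<close>. So a
  \<mapsto> \<open>B a a\<close> has zero numerical range and vanishes.\<close>

lemma weak_star_cont_quadratic: "weak_star_cont (\<lambda>x. tp a x a)"
proof (rule weak_star_contI[OF bounded_linear_tp2])
  fix w :: "('m \<Rightarrow>\<^sub>L real) \<Rightarrow>\<^sub>L real" assume w0: "\<And>p. w (pf p) = 0"
  define \<phi> where "\<phi> a c p = pf p o\<^sub>L Blinfun (\<lambda>x. tp a x c)" for a c p
  have \<phi>: "blinfun_apply (\<phi> a c p) x = T (tp a x c) p" for a c p x
    by (simp add: \<phi>_def bounded_linear_Blinfun_apply[OF bounded_linear_tp2])
  have "\<exists>m. (\<forall>p. T m p = w (\<phi> a c p)) \<and> norm m \<le> norm w * (Ktp * norm a * norm c)" for a c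
  proof -
    have "norm (tp a x c) \<le> (Ktp * norm a * norm c) * norm x" for x
      using norm_tp_le[of a x c] by (simp add: mult_ac)
    moreover have "0 \<le> Ktp * norm a * norm c" using Ktp_ge_1 by simp
    ultimately obtain m where "\<And>p. T m p = w (\<phi> a c p)" "norm m \<le> norm w * (Ktp * norm a * norm c)"
      unfolding \<phi>_def by (rule bidual_representation[OF bounded_linear_tp2, of a c _ w]) blast
    thus ?thesis by blast
  qed
  then obtain B where B: "\<And>a c p. T (B a c) p = w (\<phi> a c p)" "\<And>a c. norm (B a c) \<le> norm w * (Ktp * norm a * norm c)"
    by metis
  have B_eqI: "B a c = m" if "\<And>p. T m p = w (\<phi> a c p)" for a c m
    using that by (intro T_eqI) (simp add: B)
  have add1: "B (a + a') c = B a c + B a' c" for a a' c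
  proof (rule B_eqI)
    fix p
    have "\<phi> (a + a') c p = \<phi> a c p + \<phi> a' c p"
      by (rule blinfun_eqI) (simp add: \<phi> blinfun.add_left tp_add1 T_add)
    thus "T (B a c + B a' c) p = w (\<phi> (a + a') c p)" by (simp add: T_add B blinfun.add_right)
  qed
  have sym: "B a c = B c a" for a c
  proof (rule B_eqI)
    fix p
    have "\<phi> a c p = \<phi> c a p" by (rule blinfun_eqI) (simp only: \<phi> tp_sym[of a])
    thus "T (B c a) p = w (\<phi> a c p)" by (simp add: B)
  qed
  have sc1: "B (sc r a) c = sc r (B a c)" for r a c
  proof (rule B_eqI)
    fix p
    have "\<phi> (sc r a) c p = Re r *\<^sub>R \<phi> a c p + Im r *\<^sub>R \<phi> a c (Jp p)"
      by (rule blinfun_eqI) (simp add: \<phi> blinfun.add_left blinfun.scaleR_left tp_sc1 T_sc)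
    thus "T (sc r (B a c)) p = w (\<phi> (sc r a) c p)"
      by (simp add: T_sc B blinfun.add_right blinfun.scaleR_right)
  qed
  have add2: "B c (a + a') = B c a + B c a'" and sc2: "B c (sc r a) = sc r (B c a)" for a a' c r
    using add1 sc1 sym by metis+
  have diff1: "B (a - a') c = B a c - B a' c" for a a' c using add1[of "a - a'" a' c] by (simp add: algebra_simps)
  define C where "C = 4 * (norm w * Ktp)"
  have wK: "0 \<le> norm w * Ktp" using Ktp_ge_1 by simp
  have C: "C \<ge> 0" using wK by (simp add: C_def)
  have Bn: "norm (B a c) \<le> (norm w * Ktp) * (norm a * norm c)" for a c using B(2)[of a c] by (simp add: mult_ac)
  have small: "B a a = 0" if a: "norm a \<le> 1" for a
  proof (rule zero_numerical_range[where q = "\<lambda>a. B a a", OF C _ _ _ _ a])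
    fix x :: 'm assume x: "norm x \<le> 2"
    have "norm (B x x) \<le> (norm w * Ktp) * (2 * 2)"
      by (rule order_trans[OF Bn mult_left_mono[OF mult_mono[OF x x] wK]]) auto
    thus "norm (B x x) \<le> C" by (simp add: C_def)
  next
    fix x y :: 'm assume x: "norm x \<le> 2" and y: "norm y \<le> 2"
    have "B x x - B y y = (B x x - B y x) + (B x y - B y y)" using sym[of x y] by simp
    hence "B x x - B y y = B (x - y) x + B (x - y) y" by (simp only: diff1)
    hence "norm (B x x - B y y) \<le> norm (B (x - y) x) + norm (B (x - y) y)"
      using norm_triangle_ineq by metis
    also have "\<dots> \<le> (norm w * Ktp) * (norm (x - y) * 2) + (norm w * Ktp) * (norm (x - y) * 2)"
      using x y by (intro add_mono order_trans[OF Bn mult_left_mono[OF mult_left_mono wK]]) auto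
    finally show "norm (B x x - B y y) \<le> C * norm (x - y)" by (simp add: C_def algebra_simps)
  next
    fix a p assume ap: "T a p = norm a * norm p"
    note F = norming_tp_fixed_predual(1)[OF ap]
    have "\<phi> a a p = pf ((norm a)\<^sup>2 *\<^sub>R p)"
      by (rule blinfun_eqI) (simp add: \<phi> F blinfun.scaleR_right)
    \<comment> \<open>The sign comes from conjugate-linearity in the middle variable; the functional
      still belongs to the predual.\<close>
    moreover have "\<phi> a a (Jp p) = pf (- ((norm a)\<^sup>2) *\<^sub>R Jp p)"
    proof (rule blinfun_eqI)
      fix x
      have "T (tp a x a) (Jp p) = T (- tp a (Jm x) a) p" by (simp add: T_J[symmetric] tp_J2)
      also have "\<dots> = - (norm a)\<^sup>2 * T x (Jp p)" by (simp only: T_minus F T_J)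
      finally show "\<phi> a a (Jp p) x = pf (- ((norm a)\<^sup>2) *\<^sub>R Jp p) x"
        by (simp add: \<phi> blinfun.scaleR_right blinfun.minus_right)
    qed
    ultimately show "T (B a a) p = 0 \<and> T (Jm (B a a)) p = 0" by (simp add: T_J B w0)
  next
    fix f assume f: "cpoly f"
    show "cpoly (\<lambda>x. B (f x) (f x))" by (rule cpoly_bilinear[of B, OF add1 sc1 add2 sc2 f f])
  qed
  have "B a a = 0"
  proof (cases "a = 0")
    case False
    define z where "z = (1 / norm a) *\<^sub>R a"
    have "a = sc (of_real (norm a)) z" using False by (simp add: z_def)
    moreover have "B z z = 0" using False by (intro small) (simp add: z_def)
    ultimately show ?thesis by (metis sc1 sc2 sc_zero(2))
  qed (use small in simp)
  thus "\<forall>p. w (pf p o\<^sub>L Blinfun (\<lambda>x. tp a x a)) = 0"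
    using B(1)[of a a] by (simp add: \<phi>_def)
qed

lemma weak_star_cont_add: "weak_star_cont S \<Longrightarrow> weak_star_cont R \<Longrightarrow> weak_star_cont (\<lambda>x. S x + R x)"
  unfolding weak_star_cont_def T_add by (metis blinfun.add_right)

lemma weak_star_cont_diff: "weak_star_cont S \<Longrightarrow> weak_star_cont R \<Longrightarrow> weak_star_cont (\<lambda>x. S x - R x)"
  unfolding weak_star_cont_def T_diff by (metis blinfun.diff_right)

lemma weak_star_cont_scaleR: "weak_star_cont S \<Longrightarrow> weak_star_cont (\<lambda>x. r *\<^sub>R S x)"
  unfolding weak_star_cont_def T_scaleR by (metis blinfun.scaleR_right real_scaleR_def)

lemma weak_star_cont_compose: "weak_star_cont S \<Longrightarrow> weak_star_cont R \<Longrightarrow> weak_star_cont (\<lambda>x. S (R x))"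
  unfolding weak_star_cont_def by metis

lemma weak_star_cont_ident: "weak_star_cont (\<lambda>x. x)"
  unfolding weak_star_cont_def by blast

lemma weak_star_cont_tp2: "weak_star_cont (\<lambda>x. tp a x c)"
proof -
  have "tp a x c = (1/2) *\<^sub>R (tp (a + c) x (a + c) - tp a x a - tp c x c)" for x
    by (simp add: tp_linear tp_sym[of c x a] scaleR_2[symmetric])
  thus ?thesis by (simp only:) (intro weak_star_cont_scaleR weak_star_cont_diff weak_star_cont_quadratic)
qed

text \<open>The scheme of the quadratic case with a linear map \<open>B\<close>: if \<open>p\<close>
  norms \<open>a\<close>, the outer variable may be swapped with the middle one, where continuity is
  already known.\<close>

lemma weak_star_cont_tp1: "weak_star_cont (\<lambda>x. tp x z a)"
proof (rule weak_star_contI[OF bounded_linear_tp1])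
  fix w :: "('m \<Rightarrow>\<^sub>L real) \<Rightarrow>\<^sub>L real" assume w0: "\<And>p. w (pf p) = 0"
  define \<phi> where "\<phi> a p = pf p o\<^sub>L Blinfun (\<lambda>x. tp x z a)" for a p
  have \<phi>: "blinfun_apply (\<phi> a p) x = T (tp x z a) p" for a p x
    by (simp add: \<phi>_def bounded_linear_Blinfun_apply[OF bounded_linear_tp1])
  have "\<exists>m. (\<forall>p. T m p = w (\<phi> a p)) \<and> norm m \<le> norm w * (Ktp * norm z * norm a)" for a
  proof -
    have "norm (tp x z a) \<le> (Ktp * norm z * norm a) * norm x" for x
      using norm_tp_le[of x z a] by (simp add: mult_ac)
    moreover have "0 \<le> Ktp * norm z * norm a" using Ktp_ge_1 by simp
    ultimately obtain m where "\<And>p. T m p = w (\<phi> a p)" "norm m \<le> norm w * (Ktp * norm z * norm a)"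
      unfolding \<phi>_def by (rule bidual_representation[OF bounded_linear_tp1, of z a _ w]) blast
    thus ?thesis by blast
  qed
  then obtain B where B: "\<And>a p. T (B a) p = w (\<phi> a p)" "\<And>a. norm (B a) \<le> norm w * (Ktp * norm z * norm a)"
    by metis
  have B_eqI: "B a = m" if "\<And>p. T m p = w (\<phi> a p)" for a m
    using that by (intro T_eqI) (simp add: B)
  have add: "B (a + a') = B a + B a'" for a a'
  proof (rule B_eqI)
    fix p
    have "\<phi> (a + a') p = \<phi> a p + \<phi> a' p"
      by (rule blinfun_eqI) (simp add: \<phi> blinfun.add_left tp_add3 T_add)
    thus "T (B a + B a') p = w (\<phi> (a + a') p)" by (simp add: T_add B blinfun.add_right)
  qed
  have sc: "B (sc r a) = sc r (B a)" for r a
  proof (rule B_eqI)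
    fix p
    have "\<phi> (sc r a) p = Re r *\<^sub>R \<phi> a p + Im r *\<^sub>R \<phi> a (Jp p)"
      by (rule blinfun_eqI) (simp add: \<phi> blinfun.add_left blinfun.scaleR_left tp_sc3 T_sc)
    thus "T (sc r (B a)) p = w (\<phi> (sc r a) p)"
      by (simp add: T_sc B blinfun.add_right blinfun.scaleR_right)
  qed
  have diff: "B (a - a') = B a - B a'" for a a' using add[of "a - a'" a'] by (simp add: algebra_simps)
  define C where "C = 2 * (norm w * (Ktp * norm z))"
  have wK: "0 \<le> norm w * (Ktp * norm z)" using Ktp_ge_1 by simp
  have C: "C \<ge> 0" using wK by (simp add: C_def)
  have Bn: "norm (B a) \<le> (norm w * (Ktp * norm z)) * norm a" for a using B(2)[of a] by (simp add: mult_ac)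
  have small: "B a = 0" if a: "norm a \<le> 1" for a
  proof (rule zero_numerical_range[where q = B, OF C _ _ _ _ a])
    fix x :: 'm assume x: "norm x \<le> 2"
    show "norm (B x) \<le> C" using order_trans[OF Bn mult_left_mono[OF x wK]] by (simp add: C_def)
  next
    fix x y :: 'm
    have "norm (B (x - y)) \<le> (norm w * (Ktp * norm z)) * norm (x - y)" by (rule Bn)
    also have "\<dots> \<le> C * norm (x - y)" using wK unfolding C_def by (intro mult_right_mono norm_ge_zero) linarith
    finally show "norm (B x - B y) \<le> C * norm (x - y)" by (simp add: diff)
  next
    fix a p assume ap: "T a p = norm a * norm p"
    note F = norming_tp_fixed_predual(2)[OF ap, of _ z]
    obtain p' where p': "\<And>x. T (tp z x a) p = T x p'"
      using weak_star_cont_tp2[of z a] unfolding weak_star_cont_def by metis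
    have "\<phi> a p = pf p'" by (rule blinfun_eqI) (simp add: \<phi> F p')
    moreover have "\<phi> a (Jp p) = pf (Jp p')"
    proof (rule blinfun_eqI)
      fix x
      have "T (tp x z a) (Jp p) = T (tp (Jm x) z a) p" by (simp add: T_J[symmetric] tp_J1)
      thus "\<phi> a (Jp p) x = pf (Jp p') x" by (simp add: \<phi> F p' T_J)
    qed
    ultimately show "T (B a) p = 0 \<and> T (Jm (B a)) p = 0" by (simp add: T_J B w0)
  next
    fix f assume f: "cpoly f"
    show "cpoly (\<lambda>x. B (f x))" by (rule cpoly_linear[of B, OF add sc f])
  qed
  have "B a = 0"
  proof (cases "a = 0")
    case False
    define y where "y = (1 / norm a) *\<^sub>R a"
    have "a = sc (of_real (norm a)) y" using False by (simp add: y_def)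
    moreover have "B y = 0" using False by (intro small) (simp add: y_def)
    ultimately show ?thesis by (metis sc sc_zero(2))
  qed (use small in simp)
  thus "\<forall>p. w (pf p o\<^sub>L Blinfun (\<lambda>x. tp x z a)) = 0"
    using B(1)[of a] by (simp add: \<phi>_def)
qed

lemma weak_star_cont_tp3: "weak_star_cont (tp a z)"
proof -
  have "tp a z = (\<lambda>x. tp x z a)" by (rule ext) (rule tp_sym)
  thus ?thesis using weak_star_cont_tp1[of z a] by simp
qed

lemma weak_star_cont_Pz: "weak_star_cont (Pz v)"
  unfolding Pz_def[abs_def]
  by (intro weak_star_cont_add weak_star_cont_diff weak_star_cont_scaleR weak_star_cont_ident
      weak_star_cont_tp3 weak_star_cont_compose[OF weak_star_cont_tp3])

section \<open>Weak-star limits along ultrafilters\<close>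

definition wlim :: "'i filter \<Rightarrow> ('i \<Rightarrow> 'm) \<Rightarrow> 'm \<Rightarrow> bool" where
  "wlim U x m \<longleftrightarrow> (\<forall>p. ((\<lambda>i. T (x i) p) \<longlongrightarrow> T m p) U)"

lemma wlim_exists:
  assumes U: "ultrafilter U" and b: "eventually (\<lambda>i. norm (x i) \<le> B) U"
  obtains m where "wlim U x m" "norm m \<le> B"
proof -
  have "eventually (\<lambda>i. norm (T (x i)) \<le> B) U" using b by simp
  then obtain w where w: "\<And>p. ((\<lambda>i. T (x i) p) \<longlongrightarrow> blinfun_apply w p) U" "norm w \<le> B"
    using banach_alaoglu_ultrafilter[OF U] by metis
  obtain m where m: "w = T m" using bij_T by (metis bij_pointE)
  show ?thesis using that[of m] w m by (simp add: wlim_def)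
qed

lemma wlim_unique:
  assumes "ultrafilter U" "wlim U x a" "wlim U x b" shows "a = b"
  using assms by (intro T_eqI) (auto simp: wlim_def ultrafilter_def intro: tendsto_unique)

lemma wlim_const: "wlim U (\<lambda>_. a) a" by (simp add: wlim_def)

lemma wlim_compose:
  assumes "weak_star_cont S" "wlim U x m" shows "wlim U (\<lambda>i. S (x i)) (S m)"
  unfolding wlim_def
proof
  fix p :: 'p
  obtain p' where "\<And>x. T (S x) p = T x p'" using assms(1) unfolding weak_star_cont_def by metis
  thus "((\<lambda>i. T (S (x i)) p) \<longlongrightarrow> T (S m) p) U" using assms(2) by (simp add: wlim_def)
qed

lemma wlim_norm_null:
  assumes x: "wlim U x m" and d: "((\<lambda>i. norm (y i - x i)) \<longlongrightarrow> 0) U"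
  shows "wlim U y m"
  unfolding wlim_def
proof
  fix p :: 'p
  have "((\<lambda>i. norm (y i - x i) * norm p) \<longlongrightarrow> 0 * norm p) U" by (intro tendsto_mult d tendsto_const)
  hence "((\<lambda>i. T (y i - x i) p) \<longlongrightarrow> 0) U"
    by (intro Lim_null_comparison[of "\<lambda>i. T (y i - x i) p"]) (use T_le in \<open>auto simp: mult_zero_left\<close>)
  moreover have "((\<lambda>i. T (x i) p) \<longlongrightarrow> T m p) U" using x by (simp add: wlim_def)
  ultimately have "((\<lambda>i. T (y i - x i) p + T (x i) p) \<longlongrightarrow> 0 + T m p) U" by (rule tendsto_add)
  thus "((\<lambda>i. T (y i) p) \<longlongrightarrow> T m p) U" by (simp add: T_diff)
qed

subsection \<open>Support tripotents\<close>

text \<open>Cesaro means of consecutive odd powers change by at most 2 m / (n + 1) under a shift by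
  m, so all shifted means share the limit \<open>v\<close>. The last property carries a constant
  value on the powers over to \<open>v\<close>.\<close>

theorem exists_support_tripotent:
  assumes z: "norm z = 1"
  obtains v where "tripotent v" "norm v \<le> 1" "\<And>c. tp v z c = tp v v c"
    "\<And>p s. (\<And>j. T (pw z j) p = s) \<Longrightarrow> T v p = s"
proof -
  obtain U :: "nat filter" where U: "ultrafilter U" "U \<le> sequentially"
    using ultrafilter_exists[of sequentially] by auto
  define xs where "xs m n = (1 / real (Suc n)) *\<^sub>R (\<Sum>k\<le>n. pw z (k + m))" for m n
  have nx: "norm (xs m n) \<le> 1" for m n
  proof -
    have "norm (\<Sum>k\<le>n. pw z (k + m)) \<le> (\<Sum>k\<le>n. 1)"
      by (intro sum_norm_le norm_pw_le_1[OF z])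
    thus ?thesis by (simp add: xs_def divide_le_eq)
  qed
  obtain v where v: "wlim U (xs 0) v" "norm v \<le> 1"
    using wlim_exists[OF U(1), of "xs 0" 1] nx by auto
  have d: "norm (xs m n - xs 0 n) \<le> 2 * real m / real (Suc n)" for m n
  proof (induction m)
    case (Suc m)
    have "(\<Sum>k\<le>n. pw z (k + Suc m)) - (\<Sum>k\<le>n. pw z (k + m)) = pw z (Suc n + m) - pw z m"
      by (induction n) (simp_all add: algebra_simps del: funpow.simps(2))
    hence eq: "xs (Suc m) n - xs m n = (1 / real (Suc n)) *\<^sub>R (pw z (Suc n + m) - pw z m)"
      unfolding xs_def scaleR_diff_right[symmetric] by simp
    have "norm (pw z (Suc n + m) - pw z m) \<le> 2"
      using norm_triangle_ineq4[of "pw z (Suc n + m)" "pw z m"] norm_pw_le_1[OF z, of "Suc n + m"]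
        norm_pw_le_1[OF z, of m] by linarith
    hence "norm (xs (Suc m) n - xs m n) \<le> 2 / real (Suc n)"
      unfolding eq norm_scaleR by (simp add: divide_right_mono)
    moreover have "xs (Suc m) n - xs 0 n = (xs (Suc m) n - xs m n) + (xs m n - xs 0 n)" by simp
    hence "norm (xs (Suc m) n - xs 0 n) \<le> norm (xs (Suc m) n - xs m n) + norm (xs m n - xs 0 n)"
      using norm_triangle_ineq by metis
    ultimately show ?case using Suc by (simp add: add_divide_distrib)
  qed simp
  have shift: "wlim U (xs m) v" for m
  proof (rule wlim_norm_null[OF v(1)])
    have "(\<lambda>n. (2 * real m) * inverse (real (Suc n))) \<longlonglongrightarrow> (2 * real m) * 0"
      by (intro tendsto_mult tendsto_const LIMSEQ_inverse_real_of_nat)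
    hence "(\<lambda>n. norm (xs m n - xs 0 n)) \<longlonglongrightarrow> 0"
      by (intro Lim_null_comparison[of "\<lambda>n. norm (xs m n - xs 0 n)"]) (use d in \<open>auto simp: divide_inverse\<close>)
    thus "((\<lambda>n. norm (xs m n - xs 0 n)) \<longlongrightarrow> 0) U" using U(2) by (rule tendsto_mono[rotated])
  qed
  have avg: "f (xs m n) = c" if f: "linear f" and c: "\<And>k. f (pw z k) = c" for f :: "'m \<Rightarrow> 'm" and c m n
  proof -
    have "f (xs m n) = (1 / real (Suc n)) *\<^sub>R (\<Sum>k\<le>n. c)"
      by (simp add: xs_def linear_scale[OF f] linear_sum[OF f] c)
    also have "(\<Sum>k\<le>n. c) = real (Suc n) *\<^sub>R c" by (simp add: sum_constant_scaleR)
    finally show ?thesis by simp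
  qed
  have lim: "f v = c" if "weak_star_cont f" "linear f" "\<And>k. f (pw z k) = c" for f c
  proof -
    have "wlim U (\<lambda>n. f (xs 0 n)) (f v)" by (rule wlim_compose[OF that(1) v(1)])
    moreover have "(\<lambda>n. f (xs 0 n)) = (\<lambda>_. c)" using avg[OF that(2,3)] by simp
    ultimately show ?thesis using wlim_const[of U c] by (auto intro: wlim_unique[OF U(1)])
  qed
  \<comment> \<open>Multiplication by powers shifts the means, which the limit does not notice. The
    next two equations replace the remaining powers by \<open>v\<close> one slot at a time, as
    continuity is only separate.\<close>
  have 1: "tp (pw z i) (pw z j) v = v" for i j
  proof -
    have "tp (pw z i) (pw z j) (xs 0 n) = xs (i + j + 1) n" for n
      by (simp add: xs_def tp_scaleR3 tp_sum3 tp_pw add_ac)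
    hence "wlim U (xs (i + j + 1)) (tp (pw z i) (pw z j) v)"
      using wlim_compose[OF weak_star_cont_tp3 v(1), of "pw z i" "pw z j"] by simp
    thus ?thesis using shift wlim_unique[OF U(1)] by blast
  qed
  have 2: "tp (pw z i) v v = v" for i
    by (rule lim[OF weak_star_cont_tp2 linear_tp2]) (rule 1)
  have 3: "tp v v v = v"
    by (rule lim[OF weak_star_cont_tp1 linear_tp1]) (rule 2)
  have 4: "tp v (pw z j) c = tp v z c" for j c
  proof -
    have "tp (xs 0 n) (pw z j) c = tp (xs j n) z c" for n
      by (simp add: xs_def tp_scaleR1 tp_sum1 tp_pw_tp_pw[OF refl])
    hence "wlim U (\<lambda>n. tp (xs j n) z c) (tp v (pw z j) c)"
      using wlim_compose[OF weak_star_cont_tp1 v(1), of "pw z j" c] by simp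
    moreover have "wlim U (\<lambda>n. tp (xs j n) z c) (tp v z c)"
      by (rule wlim_compose[OF weak_star_cont_tp1 shift])
    ultimately show ?thesis by (rule wlim_unique[OF U(1)])
  qed
  have 5: "tp v v c = tp v z c" for c
    by (rule lim[OF weak_star_cont_tp2 linear_tp2]) (rule 4)
  have 6: "T v p = s" if "\<And>j. T (pw z j) p = s" for p s
  proof -
    have "T (\<Sum>k\<le>n. pw z k) p = (\<Sum>k\<le>n. s)" for n
      by (induction n) (use that[of 0] in \<open>simp_all add: T_add that algebra_simps del: funpow.simps(2)\<close>)
    hence "T (xs 0 n) p = s" for n by (simp add: xs_def T_scaleR)
    moreover have "((\<lambda>n. T (xs 0 n) p) \<longlongrightarrow> T v p) U" using v(1) by (simp add: wlim_def)
    ultimately have "((\<lambda>n. s) \<longlongrightarrow> T v p) U" by simp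
    moreover have "U \<noteq> bot" using U(1) by (simp add: ultrafilter_def)
    ultimately show ?thesis by (simp add: tendsto_const_iff)
  qed
  show ?thesis
  proof (rule that)
    show "tripotent v" using 3 by (simp add: tripotent_def)
    show "norm v \<le> 1" by (rule v(2))
    show "tp v z c = tp v v c" for c using 5 by simp
    show "T v p = s" if "\<And>j. T (pw z j) p = s" for p s by (rule 6[OF that])
  qed
qed

section \<open>Almost orthogonality\<close>

lemma norming_pf_iff: "norming (pf h) e \<longleftrightarrow> norm h = 1 \<and> norm e = 1 \<and> T e h = 1"
  by (simp add: norming_def)

text \<open>Let x and y be the values of \<open>h\<close> on \<open>Ph v e\<close> and
  \<open>Po v e\<close>; nothing says that they are nonnegative. Rotations by a primitive sixth root
  of unity and its conjugate do not raise the value of \<open>h\<close> above 1, which gives x + 3 y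
  \<ge> 0, and the claim is x + y \<le> 2 x + 4 y.\<close>

lemma Pz_norming_ge:
  assumes v: "tripotent v" and he: "norming (pf h) e"
  shows "1 - T (Pz v e) h \<le> 4 * T (tp v v e) h"
proof -
  define w where "w = Complex (1/2) (sqrt 3 / 2)"
  have w: "cmod w = 1" "Re w = 1/2" "Re (w^2) = - 1/2"
    by (simp_all add: w_def cmod_def power_divide power2_eq_square)
  note ne = he[unfolded norming_pf_iff]
  have le1: "T (rot v u e) h \<le> 1" if "cmod u = 1" for u
    using T_le[of "rot v u e" h] norm_rot_le[OF v that, of e] ne by (simp add: abs_le_iff)
  have "T (rot v w e + rot v (cnj w) e) h \<le> 2"
    using le1[of w] le1[of "cnj w"] w by (simp add: T_add)
  hence 1: "2 * T (Pz v e) h + T (Ph v e) h - T (Po v e) h \<le> 2"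
    unfolding rot_plus_rot_cnj by (simp add: w T_add T_diff T_scaleR)
  have "T (Pz v e + Ph v e + Po v e) h = 1" using ne by (simp add: Peirce_sum)
  hence 2: "T (Pz v e) h + T (Ph v e) h + T (Po v e) h = 1" by (simp add: T_add)
  have "tp v v (Pz v e + Ph v e + Po v e) = (1/2) *\<^sub>R Ph v e + Po v e"
    by (simp add: tp_add3 eig_P[OF v])
  hence "T (tp v v e) h = T (Ph v e) h / 2 + T (Po v e) h" by (simp add: Peirce_sum T_add T_scaleR)
  with 1 2 show ?thesis by simp
qed

text \<open>Bishop-Phelps-Bollobas moves (Pz v e, h) to an exactly norming pair (e0, h0) nearby; then
  h0 is invariant under Q(e0), and Q(e0) almost annihilates the range of 1 - Pz v.\<close>
lemma almost_orthogonal: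
  assumes e: "\<epsilon> > 0"
  obtains d where "d > 0" "\<And>h e v x. norming (pf h) e \<Longrightarrow> tripotent v \<Longrightarrow> T (tp v v e) h \<le> d \<Longrightarrow>
    \<bar>T (x - Pz v x) h\<bar> \<le> \<epsilon> * norm x"
proof -
  \<comment> \<open>Moving \<open>e'\<close> to \<open>e0\<close> costs \<open>12 * Ktp * k\<close>,
    from two terms with factors 3 k and 2 (norm x); moving \<open>h\<close> to \<open>h0\<close>
    costs \<open>2 * k\<close>.\<close>
  define k where "k = min (1/4) (\<epsilon> / (12 * Ktp + 2))"
  have K: "Ktp \<ge> 1" by (rule Ktp_ge_1)
  have k: "0 < k" "k \<le> 1/4" "(12 * Ktp + 2) * k \<le> \<epsilon>"
  proof -
    show "0 < k" using e K by (simp add: k_def)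
    show "k \<le> 1/4" unfolding k_def by (rule min.cobounded1)
    have "k \<le> \<epsilon> / (12 * Ktp + 2)" by (simp add: k_def)
    thus "(12 * Ktp + 2) * k \<le> \<epsilon>" using K by (simp add: pos_le_divide_eq mult.commute)
  qed
  have "\<bar>T (x - Pz v x) h\<bar> \<le> \<epsilon> * norm x"
    if he: "norming (pf h) e" and v: "tripotent v" and d: "T (tp v v e) h \<le> k\<^sup>2 / 4" for h e v x
  proof -
    note ne = he[unfolded norming_pf_iff]
    define e' where "e' = Pz v e"
    have ne': "norm e' \<le> 1" using norm_Pz_le[OF v, of e] ne by (simp add: e'_def)
    have "1 - k\<^sup>2 \<le> T e' h" using Pz_norming_ge[OF v he] d by (simp add: e'_def)
    moreover have "norm (T e') \<le> 1" "norm h \<le> 1" using ne' ne by simp_all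
    ultimately obtain a' h0 where ah: "norm a' = 1" "norm h0 = 1" "blinfun_apply a' h0 = 1"
      "norm (T e' - a') \<le> 3 * k" "norm (h - h0) \<le> k"
      using bishop_phelps_bollobas[OF k(1,2)] by metis
    obtain e0 where e0: "a' = T e0" using bij_T by (metis bij_pointE)
    have n0: "norm e0 = 1" using ah(1) e0 by simp
    have d0: "norm (e0 - e') \<le> 3 * k"
      using ah(4) unfolding e0 linear_diff[OF linear_T, symmetric] by (simp add: norm_minus_commute)
    have nrm: "norming (pf h0) e0" using ah e0 n0 by (simp add: norming_pf_iff)
    define y where "y = x - Pz v x"
    have ny: "norm y \<le> 2 * norm x"
      using norm_triangle_ineq4[of x "Pz v x"] norm_Pz_le[OF v, of x] by (simp add: y_def)
    have "tp e' y e' = 0" using tp_Pz_compl[OF v] by (simp add: e'_def y_def)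
    hence "tp e0 y e0 = tp (e0 - e') y e0 + tp e' y (e0 - e')" by (simp add: tp_linear)
    hence "norm (tp e0 y e0) \<le> norm (tp (e0 - e') y e0) + norm (tp e' y (e0 - e'))"
      using norm_triangle_ineq by metis
    also have "\<dots> \<le> Ktp * (3 * k) * (2 * norm x) * 1 + Ktp * 1 * (2 * norm x) * (3 * k)"
      using n0 ne' d0 ny by (intro add_mono norm_tp_le_mult) auto
    finally have t: "norm (tp e0 y e0) \<le> 12 * Ktp * k * norm x" by (simp add: mult_ac)
    have "T y h0 = T (tp e0 y e0) h0" using norming_tp_fixed(2)[OF nrm, of y] by simp
    hence "\<bar>T y h0\<bar> \<le> 12 * Ktp * k * norm x" using T_le[of "tp e0 y e0" h0] t ah(2) by simp
    moreover have "\<bar>T y (h - h0)\<bar> \<le> (2 * norm x) * k"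
      using T_le[of y "h - h0"] mult_mono[OF ny ah(5)] by simp
    moreover have "T y h = T y h0 + T y (h - h0)" by (simp add: blinfun.diff_right)
    ultimately have "\<bar>T y h\<bar> \<le> (12 * Ktp + 2) * k * norm x" by (simp add: algebra_simps)
    also have "\<dots> \<le> \<epsilon> * norm x" using k(3) by (intro mult_right_mono) auto
    finally show ?thesis by (simp add: y_def)
  qed
  moreover have "k\<^sup>2 / 4 > 0" using k by simp
  ultimately show ?thesis using that by blast
qed

lemma norming_pf_exists:
  assumes "h \<noteq> 0"
  obtains e where "norming (pf ((1 / norm h) *\<^sub>R h)) e"
proof -
  define g where "g = (1 / norm h) *\<^sub>R h"
  have g: "norm g = 1" using assms by (simp add: g_def)
  obtain f :: "'p \<Rightarrow>\<^sub>L real" where f: "norm f \<le> 1" "f g = norm g" by (rule norming_functional)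
  obtain e where e: "f = T e" using bij_T by (metis bij_pointE)
  have "norming (pf g) e"
    using f g e by (intro normingI) auto
  thus ?thesis using that by (simp add: g_def)
qed

end

section \<open>The penalized maximum and the next tripotent\<close>

locale norming_family = jbw_triple Jm tp Jp T
  for Jm :: "'m::banach \<Rightarrow> 'm" and tp and Jp :: "'p::banach \<Rightarrow> 'p" and T +
  fixes I :: "'i set" and h :: "'i \<Rightarrow> 'p" and e :: "'i \<Rightarrow> 'm"
  assumes finite_I: "finite I" and norming_I: "j \<in> I \<Longrightarrow> norming (pf (h j)) (e j)"
begin

text \<open>A positive semidefinite form that measures the overlap with the supports of all
  \<open>h j\<close>; a tripotent \<open>v\<close> with small \<open>\<Phi> v v\<close> is almost
  orthogonal to each of them.\<close>

definition \<Phi> :: "'m \<Rightarrow> 'm \<Rightarrow> real" where "\<Phi> a b = (\<Sum>j\<in>I. T (tp a b (e j)) (h j))"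

lemma \<Phi>_sym: "\<Phi> a b = \<Phi> b a"
  unfolding \<Phi>_def using norming_tp_swap[OF norming_I] by (intro sum.cong) auto

lemma \<Phi>_nonneg: "0 \<le> \<Phi> a a"
  unfolding \<Phi>_def using norming_tp_nonneg[OF norming_I] by (intro sum_nonneg) auto

lemma \<Phi>_term_le: "j \<in> I \<Longrightarrow> T (tp a a (e j)) (h j) \<le> \<Phi> a a"
  unfolding \<Phi>_def using norming_tp_nonneg[OF norming_I] finite_I
  by (intro member_le_sum[of j I "\<lambda>j. T (tp a a (e j)) (h j)"]) auto

lemma \<Phi>_add1: "\<Phi> (a + b) c = \<Phi> a c + \<Phi> b c"
  by (simp add: \<Phi>_def tp_add1 T_add sum.distrib)

lemma \<Phi>_scale1: "\<Phi> (r *\<^sub>R a) c = r * \<Phi> a c"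
  by (simp add: \<Phi>_def tp_scaleR1 T_scaleR sum_distrib_left)

lemma \<Phi>_add2: "\<Phi> c (a + b) = \<Phi> c a + \<Phi> c b" and \<Phi>_scale2: "\<Phi> c (r *\<^sub>R a) = r * \<Phi> c a"
  using \<Phi>_add1 \<Phi>_scale1 \<Phi>_sym by metis+

lemma \<Phi>_diff1: "\<Phi> (a - b) c = \<Phi> a c - \<Phi> b c" and \<Phi>_diff2: "\<Phi> c (a - b) = \<Phi> c a - \<Phi> c b"
  using \<Phi>_add1[of "a - b" b c] \<Phi>_add2[of c "a - b" b] by simp_all

lemma \<Phi>_representation: "\<exists>k. \<forall>x. T x k = \<Phi> x b"
proof -
  have "\<forall>j. \<exists>k. \<forall>x. T (tp x b (e j)) (h j) = T x k"
    using weak_star_cont_tp1 unfolding weak_star_cont_def by blast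
  then obtain k where k: "\<And>j x. T (tp x b (e j)) (h j) = T x (k j)" by metis
  have "T x (\<Sum>j\<in>I. k j) = \<Phi> x b" for x
    by (simp add: \<Phi>_def k blinfun.sum_right)
  thus ?thesis by blast
qed

lemma \<Phi>_wlim1: "wlim U x m \<Longrightarrow> ((\<lambda>i. \<Phi> (x i) b) \<longlongrightarrow> \<Phi> m b) U"
proof -
  assume x: "wlim U x m"
  obtain k where k: "\<And>x. T x k = \<Phi> x b" using \<Phi>_representation by blast
  have "((\<lambda>i. T (x i) k) \<longlongrightarrow> T m k) U" using x by (simp add: wlim_def)
  thus ?thesis by (simp add: k)
qed

lemma \<Phi>_wlim2: "wlim U x m \<Longrightarrow> ((\<lambda>i. \<Phi> b (x i)) \<longlongrightarrow> \<Phi> b m) U"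
  using \<Phi>_wlim1[of U x m b] by (simp add: \<Phi>_sym[of b])

text \<open>The form is symmetric and weak-star continuous in each variable, so weak-star limits of
  points \<open>b\<close> in the unit ball give weak limits of the corresponding elements of the
  predual.\<close>

lemma weakly_compact_image:
  assumes r: "r \<ge> 0"
  shows "compactin weak_top {k. \<exists>b. norm b \<le> 1 \<and> (\<forall>x. T x k = r * \<Phi> x b)}" (is "compactin _ ?K")
  unfolding compactin_iff_ultrafilter
proof (intro conjI allI impI)
  fix U :: "'p filter" assume U: "ultrafilter U \<and> eventually (\<lambda>k. k \<in> ?K) U"
  define b where "b k = (SOME b. norm b \<le> 1 \<and> (\<forall>x. T x k = r * \<Phi> x b))" for k
  have b: "norm (b k) \<le> 1 \<and> (\<forall>x. T x k = r * \<Phi> x (b k))" if "k \<in> ?K" for k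
    unfolding b_def by (rule someI_ex) (use that in simp)
  have "eventually (\<lambda>k. norm (b k) \<le> 1) U"
    by (rule eventually_mono[OF conjunct2[OF U]]) (rule conjunct1[OF b])
  then obtain b0 where b0: "wlim U b b0" "norm b0 \<le> 1"
    by (rule wlim_exists[OF conjunct1[OF U]]) blast
  obtain k1 where k1: "\<And>x. T x k1 = \<Phi> x b0" using \<Phi>_representation by blast
  define k0 where "k0 = r *\<^sub>R k1"
  have k0: "T x k0 = r * \<Phi> x b0" for x by (simp add: k0_def blinfun.scaleR_right k1)
  have "(blinfun_apply f \<longlongrightarrow> f k0) U" for f :: "'p \<Rightarrow>\<^sub>L real"
  proof -
    obtain x where x: "f = T x" using bij_T by (metis bij_pointE)
    have "((\<lambda>k. r * \<Phi> x (b k)) \<longlongrightarrow> r * \<Phi> x b0) U" by (intro tendsto_mult tendsto_const \<Phi>_wlim2 b0)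
    moreover have "eventually (\<lambda>k. r * \<Phi> x (b k) = f k) U"
      by (rule eventually_mono[OF conjunct2[OF U]]) (simp only: x conjunct2[OF b, rule_format])
    ultimately show ?thesis using tendsto_cong[of "\<lambda>k. r * \<Phi> x (b k)" "blinfun_apply f" U] x k0 by simp
  qed
  moreover have "k0 \<in> ?K" using b0(2) k0 by blast
  ultimately show "\<exists>x\<in>?K. ultra_limit weak_top U x" by (auto simp: ultra_limit_weak_top_iff)
qed simp

text \<open>The point maximizes \<open>T x \<psi> - N * \<Phi> x x\<close>; the conclusion is the
  first-order condition along segments in the ball, which replaces the quadratic penalty by a linear
  one.\<close>

lemma penalized_maximum:
  assumes N: "N \<ge> 0"
  obtains x0 where "norm x0 \<le> 1" "\<And>x. norm x \<le> 1 \<Longrightarrow> T x \<psi> - 2 * N * \<Phi> x x0 \<le> T x0 \<psi> - 2 * N * \<Phi> x0 x0"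
proof -
  define \<Theta> where "\<Theta> x = T x \<psi> - N * \<Phi> x x" for x
  have bdd: "bdd_above (\<Theta> ` cball 0 1)"
  proof (rule bdd_aboveI2[where M = "norm \<psi>"])
    fix x :: 'm assume "x \<in> cball 0 1"
    hence "norm x * norm \<psi> \<le> norm \<psi>" by (intro mult_left_le_one_le) auto
    moreover have "0 \<le> N * \<Phi> x x" using N \<Phi>_nonneg by simp
    ultimately show "\<Theta> x \<le> norm \<psi>" using T_le[of x \<psi>] unfolding \<Theta>_def by linarith
  qed
  define S where "S = (SUP x\<in>cball 0 1. \<Theta> x)"
  have "\<exists>x. norm x \<le> 1 \<and> S - inverse (real (Suc n)) < \<Theta> x" for n
  proof -
    have "S - inverse (real (Suc n)) < S" by simp
    thus ?thesis unfolding S_def using less_cSUP_iff[OF _ bdd] by force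
  qed
  then obtain x where x: "\<And>n. norm (x n) \<le> 1" "\<And>n. S - inverse (real (Suc n)) < \<Theta> (x n)" by metis
  obtain U :: "nat filter" where U: "ultrafilter U" "U \<le> sequentially"
    using ultrafilter_exists[of sequentially] by auto
  obtain x0 where x0: "wlim U x x0" "norm x0 \<le> 1" using wlim_exists[OF U(1), of x 1] x(1) by auto
  have "S \<le> \<Theta> x0"
  proof (rule ultrafilter_limit_le[OF U(1)])
    have "(\<lambda>n. S - inverse (real (Suc n))) \<longlonglongrightarrow> S - 0"
      by (intro tendsto_diff tendsto_const LIMSEQ_inverse_real_of_nat)
    thus "((\<lambda>n. S - inverse (real (Suc n))) \<longlongrightarrow> S) U" using U(2) by (auto intro: tendsto_mono)
    have "((\<lambda>n. T (x n) \<psi> - N * (2 * \<Phi> (x n) x0 - \<Phi> x0 x0)) \<longlongrightarrow> T x0 \<psi> - N * (2 * \<Phi> x0 x0 - \<Phi> x0 x0)) U"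
      using x0(1) unfolding wlim_def
      by (intro tendsto_diff tendsto_mult tendsto_const \<Phi>_wlim1[OF x0(1)]) blast
    thus "((\<lambda>n. T (x n) \<psi> - N * (2 * \<Phi> (x n) x0 - \<Phi> x0 x0)) \<longlongrightarrow> \<Theta> x0) U"
      by (simp add: \<Theta>_def)
    \<comment> \<open>Positivity of \<open>\<Phi>\<close> at \<open>x n - x0\<close> bounds the
      quadratic term from below by one that is affine in \<open>x n\<close>, hence weak-star
      continuous; this semicontinuity makes the maximum exist.\<close>
    have "S - inverse (real (Suc n)) \<le> T (x n) \<psi> - N * (2 * \<Phi> (x n) x0 - \<Phi> x0 x0)" for n
    proof -
      have "0 \<le> \<Phi> (x n) (x n) - 2 * \<Phi> (x n) x0 + \<Phi> x0 x0"
        using \<Phi>_nonneg[of "x n - x0"] \<Phi>_sym[of x0 "x n"] by (simp add: \<Phi>_diff1 \<Phi>_diff2)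
      hence "N * (2 * \<Phi> (x n) x0 - \<Phi> x0 x0) \<le> N * \<Phi> (x n) (x n)" using N by (intro mult_left_mono) auto
      with x(2)[of n] show ?thesis unfolding \<Theta>_def by linarith
    qed
    thus "\<forall>\<^sub>F n in U. S - inverse (real (Suc n)) \<le> T (x n) \<psi> - N * (2 * \<Phi> (x n) x0 - \<Phi> x0 x0)"
      by simp
  qed
  hence max: "\<Theta> y \<le> \<Theta> x0" if "norm y \<le> 1" for y
    using cSUP_upper[OF _ bdd, of y] that by (simp add: S_def)
  have opt: "T x \<psi> - 2 * N * \<Phi> x x0 \<le> T x0 \<psi> - 2 * N * \<Phi> x0 x0" if nx: "norm x \<le> 1" for x
  proof -
    define y where "y = x - x0"
    define c where "c = N * \<Phi> y y"
    have c: "c \<ge> 0" using N \<Phi>_nonneg by (simp add: c_def)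
    have "T y \<psi> - 2 * N * \<Phi> y x0 \<le> t * c" if t: "0 < t" "t \<le> 1" for t
    proof -
      have "x0 + t *\<^sub>R y = (1 - t) *\<^sub>R x0 + t *\<^sub>R x" by (simp add: y_def algebra_simps)
      hence "norm (x0 + t *\<^sub>R y) \<le> (1 - t) * norm x0 + t * norm x"
        using norm_triangle_ineq[of "(1 - t) *\<^sub>R x0" "t *\<^sub>R x"] t by simp
      also have "\<dots> \<le> (1 - t) * 1 + t * 1" using x0(2) nx t by (intro add_mono mult_left_mono) auto
      finally have "\<Theta> (x0 + t *\<^sub>R y) \<le> \<Theta> x0" by (intro max) simp
      hence "t * (T y \<psi> - 2 * N * \<Phi> y x0) \<le> t * (t * c)"
        using \<Phi>_sym[of x0 y]
        by (simp add: \<Theta>_def c_def T_add T_scaleR \<Phi>_add1 \<Phi>_add2 \<Phi>_scale1 \<Phi>_scale2 algebra_simps)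
      thus ?thesis using t by simp
    qed
    note small = this
    have "T y \<psi> - 2 * N * \<Phi> y x0 \<le> 0"
    proof (rule field_le_epsilon)
      fix \<epsilon> :: real assume e: "\<epsilon> > 0"
      define t where "t = min 1 (\<epsilon> / (c + 1))"
      have t: "0 < t" "t \<le> 1" "t \<le> \<epsilon> / (c + 1)" using e c by (auto simp: t_def)
      have "t * c \<le> \<epsilon> / (c + 1) * (c + 1)" using t c by (intro mult_mono) auto
      hence "t * c \<le> \<epsilon>" using c by simp
      with small[OF t(1,2)] show "T y \<psi> - 2 * N * \<Phi> y x0 \<le> 0 + \<epsilon>" by simp
    qed
    thus ?thesis by (simp add: y_def T_diff \<Phi>_diff1 algebra_simps)
  qed
  show ?thesis by (rule that[OF x0(2) opt])
qed

text \<open>At a maximizer x0 of \<psi> - N' \<Phi> on the unit ball, the functional g = \<psi> - 2 N' \<Phi>(-, x0) is normed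
  by x0, and norm g > c because \<psi> is far from the weakly compact set of all 2 N' \<Phi>(-, b).  The
  support tripotent of g at x0 then has the required properties.\<close>
lemma far_tripotent:
  assumes A: "bounded A" "A \<noteq> {}" and B: "\<And>a. a \<in> A \<Longrightarrow> norm a \<le> B"
    and c: "0 \<le> c" "c < deBlasi A" and d: "d > 0"
  obtains \<psi> v where "\<psi> \<in> A" "tripotent v" "norm v \<le> 1" "c \<le> T v \<psi>" "\<Phi> v v \<le> d"
proof -
  have B0: "B \<ge> 0" using A(2) B norm_ge_zero order_trans by (metis ex_in_conv)
  \<comment> \<open>The weight is chosen so that \<open>2 * N' * \<Phi> v v\<close>, at most
    \<open>T v \<psi>\<close> and so at most \<open>B\<close>, forces
    \<open>\<Phi> v v \<le> d\<close>; the added 1 in \<open>N'\<close> keeps it positive.\<close>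
  define N where "N = B / (2 * d)"
  have N: "N \<ge> 0" "B = 2 * N * d" using B0 d by (simp_all add: N_def)
  define N' where "N' = N + 1"
  have N': "N' > 0" "B \<le> 2 * N' * d" using N d by (simp_all add: N'_def algebra_simps)
  define K where "K = {k. \<exists>b. norm b \<le> 1 \<and> (\<forall>x. T x k = (2 * N') * \<Phi> x b)}"
  have Kc: "compactin weak_top K" unfolding K_def using N' by (intro weakly_compact_image) simp
  have kb: "\<exists>k. \<forall>x. T x k = (2 * N') * \<Phi> x b" for b
  proof -
    obtain k where "\<And>x. T x k = \<Phi> x b" using \<Phi>_representation by blast
    hence "T x ((2 * N') *\<^sub>R k) = (2 * N') * \<Phi> x b" for x by (simp add: blinfun.scaleR_right)
    thus ?thesis by blast
  qed
  obtain k00 where "\<forall>x. T x k00 = (2 * N') * \<Phi> x 0" using kb by blast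
  hence "k00 \<in> K" unfolding K_def by (auto intro!: exI[of _ 0])
  hence "K \<noteq> {}" by blast
  then obtain \<psi> where \<psi>: "\<psi> \<in> A" "c < infdist \<psi> K"
    using deBlasi_less_iff_far[OF A _ Kc c(2)] by blast
  obtain x0 where x0: "norm x0 \<le> 1"
    "\<And>x. norm x \<le> 1 \<Longrightarrow> T x \<psi> - 2 * N' * \<Phi> x x0 \<le> T x0 \<psi> - 2 * N' * \<Phi> x0 x0"
    using penalized_maximum[of N' \<psi>] N' by (metis less_imp_le)
  obtain k where k: "\<And>x. T x k = (2 * N') * \<Phi> x x0" using kb by blast
  have kK: "k \<in> K" using k x0(1) unfolding K_def by blast
  define g where "g = \<psi> - k"
  have Tg: "T x g = T x \<psi> - 2 * N' * \<Phi> x x0" for x by (simp add: g_def blinfun.diff_right k)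
  have ng: "c < norm g" using \<psi>(2) infdist_le[OF kK, of \<psi>] by (simp add: g_def dist_norm)
  have Tx0: "T x0 g = norm g"
  proof (rule antisym)
    show "T x0 g \<le> norm g"
      using T_le[of x0 g] mult_left_le_one_le[OF norm_ge_zero[of g] norm_ge_zero[of x0] x0(1)] by simp
    obtain f :: "'p \<Rightarrow>\<^sub>L real" where f: "norm f \<le> 1" "f g = norm g" by (rule norming_functional)
    obtain x where x: "f = T x" using bij_T by (metis bij_pointE)
    with f have "norm x \<le> 1" by simp
    from x0(2)[OF this] have "T x g \<le> T x0 g" unfolding Tg .
    with f x show "norm g \<le> T x0 g" by simp
  qed
  have g0: "norm g > 0" using ng c by linarith
  have n: "norming (pf ((1 / norm g) *\<^sub>R g)) x0"
    using x0(1) Tx0 g0 by (intro normingI) (auto simp: blinfun.scaleR_right)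
  hence nx0: "norm x0 = 1" by (rule normingD)
  obtain v where v: "tripotent v" "norm v \<le> 1" "\<And>c. tp v x0 c = tp v v c"
    "\<And>p s. (\<And>j. T (pw x0 j) p = s) \<Longrightarrow> T v p = s"
    using exists_support_tripotent[OF nx0] by metis
  have "T (pw x0 j) g = norm g" for j
    using norming_pw[OF n, of j] g0 by (simp add: blinfun.scaleR_right)
  hence Tv: "T v g = norm g" by (rule v(4))
  \<comment> \<open>The support identity turns the linear penalty back into the quadratic
    one.\<close>
  have "\<Phi> v x0 = \<Phi> v v" by (simp add: \<Phi>_def v(3))
  hence eq: "T v \<psi> = norm g + 2 * N' * \<Phi> v v" using Tg[of v] Tv by simp
  have p: "0 \<le> 2 * N' * \<Phi> v v" using N' \<Phi>_nonneg by simp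
  have "T v \<psi> \<le> B"
    using T_le[of v \<psi>] mult_left_le_one_le[OF norm_ge_zero[of \<psi>] norm_ge_zero[of v] v(2)] B[OF \<psi>(1)] by simp
  hence "2 * N' * \<Phi> v v \<le> 2 * N' * d" using eq g0 N' by linarith
  hence "\<Phi> v v \<le> d" using N' by simp
  moreover have "c \<le> T v \<psi>" using eq p ng by linarith
  ultimately show ?thesis using that \<psi>(1) v(1,2) by blast
qed

end

context jbw_triple
begin

lemma next_tripotent:
  fixes \<psi> :: "nat \<Rightarrow> 'p"
  assumes A: "bounded A" "A \<noteq> {}" and c: "0 \<le> c" "c < deBlasi A" and \<epsilon>: "\<epsilon> > 0"
  obtains \<psi>' v where "\<psi>' \<in> A" "tripotent v" "c \<le> T v \<psi>'"
    "\<And>j x. j < n \<Longrightarrow> \<bar>T (x - Pz v x) (\<psi> j)\<bar> \<le> \<epsilon> * norm x"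
proof -
  obtain B where B: "\<And>a. a \<in> A \<Longrightarrow> norm a \<le> B" using A by (auto simp: bounded_iff)
  \<comment> \<open>Zero functionals have no norming partner and satisfy the estimate
    trivially.\<close>
  define I where "I = {j. j < n \<and> \<psi> j \<noteq> 0}"
  define M where "M = 1 + (\<Sum>j<n. norm (\<psi> j))"
  have M: "M > 0" by (simp add: M_def sum_nonneg add_pos_nonneg)
  have M': "norm (\<psi> j) \<le> M" if "j < n" for j
  proof -
    have "norm (\<psi> j) \<le> (\<Sum>j<n. norm (\<psi> j))" using that by (intro member_le_sum) auto
    thus ?thesis by (simp add: M_def)
  qed
  define h where "h j = (1 / norm (\<psi> j)) *\<^sub>R \<psi> j" for j
  define e where "e j = (SOME e. norming (pf (h j)) e)" for j
  have he: "norming (pf (h j)) (e j)" if "j \<in> I" for j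
  proof -
    have "\<exists>e. norming (pf (h j)) e" using norming_pf_exists[of "\<psi> j"] that by (auto simp: I_def h_def)
    thus ?thesis unfolding e_def by (rule someI_ex)
  qed
  interpret norming_family Jm tp Jp T I h e
    by unfold_locales (use he in \<open>auto simp: I_def\<close>)
  have "\<epsilon> / M > 0" using \<epsilon> M by simp
  then obtain d where d: "d > 0" "\<And>h e v x. norming (pf h) e \<Longrightarrow> tripotent v \<Longrightarrow> T (tp v v e) h \<le> d \<Longrightarrow>
    \<bar>T (x - Pz v x) h\<bar> \<le> \<epsilon> / M * norm x"
    using almost_orthogonal by metis
  obtain \<psi>' v where v: "\<psi>' \<in> A" "tripotent v" "c \<le> T v \<psi>'" "\<Phi> v v \<le> d"
    using far_tripotent[OF A B c d(1)] by metis
  show ?thesis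
  proof (rule that[OF v(1,2,3)])
    fix j x assume j: "j < n"
    show "\<bar>T (x - Pz v x) (\<psi> j)\<bar> \<le> \<epsilon> * norm x"
    proof (cases "\<psi> j = 0")
      case True
      thus ?thesis using \<epsilon> by (simp add: blinfun.zero_right)
    next
      case False
      hence jI: "j \<in> I" using j by (simp add: I_def)
      have "\<bar>T (x - Pz v x) (h j)\<bar> \<le> \<epsilon> / M * norm x"
        using \<Phi>_term_le[OF jI, of v] v(4) by (intro d(2)[OF he[OF jI] v(2)]) simp
      hence "norm (\<psi> j) * \<bar>T (x - Pz v x) (h j)\<bar> \<le> M * (\<epsilon> / M * norm x)"
        using M'[OF j] M by (intro mult_mono) auto
      moreover have "\<psi> j = norm (\<psi> j) *\<^sub>R h j" using False by (simp add: h_def)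
      hence "T (x - Pz v x) (\<psi> j) = norm (\<psi> j) * T (x - Pz v x) (h j)"
        by (metis blinfun.scaleR_right real_scaleR_def)
      ultimately show ?thesis using M by (simp add: abs_mult)
    qed
  qed
qed

end

section \<open>The bad sequence and its test elements\<close>

text \<open>The weights \<open>(1/2) ^ n\<close> make the disturbances by all later tripotents
  summable, with a total loss of at most \<open>2 * \<epsilon>\<close> in
  \<open>Y_lower\<close>.\<close>

locale almost_orthogonal_sequence = jbw_triple Jm tp Jp T
  for Jm :: "'m::banach \<Rightarrow> 'm" and tp and Jp :: "'p::banach \<Rightarrow> 'p" and T +
  fixes \<psi> :: "nat \<Rightarrow> 'p" and v :: "nat \<Rightarrow> 'm" and c \<epsilon> :: real
  assumes tripotent_v: "tripotent (v n)" and c_nonneg: "c \<ge> 0" and eps_pos: "\<epsilon> > 0"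
    and norming_v: "c \<le> T (v n) (\<psi> n)"
    and orthogonal_v: "j < n \<Longrightarrow> \<bar>T (x - Pz (v n) x) (\<psi> j)\<bar> \<le> \<epsilon> * (1/2) ^ n * norm x"
begin

text \<open>The sign is chosen so that both summands of Y k (Suc i) act on the newest functional with the
  same sign; the earlier functionals hardly notice the change.\<close>
primrec Y :: "nat \<Rightarrow> nat \<Rightarrow> 'm" where
  "Y k 0 = 0"
| "Y k (Suc i) = (if T (Pz (v (k + i + 1)) (Y k i)) (\<psi> (k + i + 1)) \<ge> 0 then 1 else - 1) *\<^sub>R v (k + i + 1)
    + Pz (v (k + i + 1)) (Y k i)"

lemma Y_Suc:
  obtains s :: real where "s = 1 \<or> s = - 1" "Y k (Suc i) = s *\<^sub>R v (k + i + 1) + Pz (v (k + i + 1)) (Y k i)"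
  by (rule that[OF _ Y.simps(2)]) simp

lemma norm_Y_le: "norm (Y k i) \<le> 1"
proof (induction i)
  case (Suc i)
  obtain s :: real where s: "s = 1 \<or> s = - 1" "Y k (Suc i) = s *\<^sub>R v (k + i + 1) + Pz (v (k + i + 1)) (Y k i)"
    by (rule Y_Suc)
  show ?case unfolding s(2) by (rule norm_tripotent_plus_Pz_le[OF tripotent_v s(1) Suc])
qed simp

lemma Pz_Y_Suc: "Pz (v (k + i + 1)) (Y k (Suc i)) = Pz (v (k + i + 1)) (Y k i)"
proof -
  obtain s :: real where "Y k (Suc i) = s *\<^sub>R v (k + i + 1) + Pz (v (k + i + 1)) (Y k i)"
    by (rule Y_Suc)
  thus ?thesis
    by (simp add: linear_add[OF linear_Pz] linear_scale[OF linear_Pz] Pz_self[OF tripotent_v] Pz_Pz[OF tripotent_v]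
        del: Y.simps)
qed

lemma Y_new: "c \<le> \<bar>T (Y k (Suc i)) (\<psi> (k + i + 1))\<bar>"
  using norming_v[of "k + i + 1"] c_nonneg by (auto simp: T_add T_scaleR T_minus)

text \<open>Both elements have the same P0 component with respect to the new tripotent, and the
  earlier functional hardly sees the rest.\<close>

lemma Y_old:
  assumes "j < k + i + 1"
  shows "\<bar>T (Y k (Suc i)) (\<psi> j) - T (Y k i) (\<psi> j)\<bar> \<le> 2 * \<epsilon> * (1/2) ^ (k + i + 1)"
proof -
  let ?n = "k + i + 1"
  define b where "b = \<epsilon> * (1/2) ^ ?n"
  have b: "b \<ge> 0" using eps_pos by (simp add: b_def)
  have o: "\<bar>T (x - Pz (v ?n) x) (\<psi> j)\<bar> \<le> b" if "norm x \<le> 1" for x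
    using orthogonal_v[OF assms, of x] mult_left_mono[OF that b] unfolding b_def by simp
  have "T (Y k (Suc i)) (\<psi> j) - T (Y k i) (\<psi> j)
      = T (Y k (Suc i) - Pz (v ?n) (Y k (Suc i))) (\<psi> j) - T (Y k i - Pz (v ?n) (Y k i)) (\<psi> j)"
    unfolding Pz_Y_Suc T_diff by simp
  hence "\<bar>T (Y k (Suc i)) (\<psi> j) - T (Y k i) (\<psi> j)\<bar> \<le> 2 * b"
    using o[OF norm_Y_le[of k "Suc i"]] o[OF norm_Y_le[of k i]] by linarith
  thus ?thesis by (simp add: b_def mult.assoc)
qed

lemma Y_lower:
  assumes "k < j" "j \<le> k + i"
  shows "c - 2 * \<epsilon> \<le> \<bar>T (Y k i) (\<psi> j)\<bar>"
proof -
  \<comment> \<open>Strengthened for the induction: the loss is a partial geometric sum, which is 0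
    when \<open>\<psi> j\<close> is the newest functional.\<close>
  have "c - 2 * \<epsilon> * ((1/2) ^ j - (1/2) ^ (k + i)) \<le> \<bar>T (Y k i) (\<psi> j)\<bar>"
    using assms(2)
  proof (induction i)
    case 0 thus ?case using assms(1) by simp
  next
    case (Suc i)
    show ?case
    proof (cases "j = k + i + 1")
      case True
      thus ?thesis using Y_new[of k i] by simp
    next
      case False
      hence j: "j \<le> k + i" "j < k + i + 1" using Suc.prems by simp_all
      define w where "w = \<epsilon> * (1/2) ^ (k + i + 1)"
      have w: "\<epsilon> * (1/2) ^ (k + i) = 2 * w" "\<epsilon> * (1/2) ^ (k + Suc i) = w" by (simp_all add: w_def)
      have split: "2 * \<epsilon> * (a - b) = 2 * (\<epsilon> * a) - 2 * (\<epsilon> * b)" for a b by (simp add: algebra_simps)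
      have "c - (2 * (\<epsilon> * (1/2) ^ j) - 2 * (2 * w)) \<le> \<bar>T (Y k i) (\<psi> j)\<bar>"
        using Suc.IH[OF j(1)] unfolding split w .
      moreover have "\<bar>T (Y k (Suc i)) (\<psi> j) - T (Y k i) (\<psi> j)\<bar> \<le> 2 * w"
        using Y_old[OF j(2)] unfolding w_def by (simp only: mult.assoc)
      ultimately show ?thesis unfolding split w by linarith
    qed
  qed
  moreover have "2 * \<epsilon> * ((1/2) ^ j - (1/2) ^ (k + i)) \<le> 2 * \<epsilon> * 1"
  proof (rule mult_left_mono)
    have "(1/2::real) ^ j \<le> 1" "(0::real) \<le> (1/2) ^ (k + i)" by (simp_all add: power_le_one)
    thus "(1/2::real) ^ j - (1/2) ^ (k + i) \<le> 1" by linarith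
  qed (use eps_pos in simp)
  ultimately show ?thesis by simp
qed

text \<open>Under P0 of the new tripotent the new summand disappears by
  \<open>Pz_tp_tripotent\<close>, and \<open>Pz_tp_Pz_average\<close> removes the projection of
  \<open>Y k i\<close> at the price of changing \<open>b\<close> and \<open>d\<close>; hence the
  induction over all \<open>b\<close> and \<open>d\<close> at once. Each stage costs two
  almost-orthogonality errors.\<close>

lemma Y_ideal:
  assumes j: "j \<le> k"
  shows "\<bar>T (tp (Y k i) b d) (\<psi> j)\<bar> \<le> 2 * Ktp * \<epsilon> * (1/2) ^ k * (norm b * norm d)"
proof -
  have K: "Ktp \<ge> 0" using Ktp_ge_1 by simp
  have "\<bar>T (tp (Y k i) b d) (\<psi> j)\<bar> \<le> 2 * Ktp * \<epsilon> * ((1/2) ^ k - (1/2) ^ (k + i)) * (norm b * norm d)"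
  proof (induction i arbitrary: b d)
    case (Suc i)
    let ?n = "k + i + 1"
    define h where "h = (1/2 :: real) ^ ?n"
    have jn: "j < ?n" using j by simp
    have h: "(1/2 :: real) ^ (k + i) = 2 * h" "(1/2 :: real) ^ (k + Suc i) = h" "h \<ge> 0"
      by (simp_all add: h_def)
    define B where "B = Ktp * (norm b * norm d)"
    define q0 where "q0 = 2 * Ktp * \<epsilon> * ((1/2) ^ k - 2 * h)"
    have o: "\<bar>T (tp (Y k m) b' d' - Pz (v ?n) (tp (Y k m) b' d')) (\<psi> j)\<bar> \<le> \<epsilon> * h * B"
      if "norm b' \<le> norm b" "norm d' \<le> norm d" for b' d' m
    proof -
      have "norm (tp (Y k m) b' d') \<le> Ktp * 1 * norm b * norm d"
        by (rule norm_tp_le_mult[OF norm_Y_le that])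
      hence "\<epsilon> * h * norm (tp (Y k m) b' d') \<le> \<epsilon> * h * B"
        using eps_pos h(3) by (intro mult_left_mono) (auto simp: B_def mult.assoc)
      with orthogonal_v[OF jn, of "tp (Y k m) b' d'"] show ?thesis unfolding h_def by linarith
    qed
    have q0: "q0 \<ge> 0"
    proof -
      have "(1/2::real) ^ (k + i) \<le> (1/2) ^ k" by (rule power_decreasing) auto
      thus ?thesis using K eps_pos unfolding q0_def h(1)[symmetric] by simp
    qed
    have IH: "\<bar>T (tp (Y k i) b' d') (\<psi> j)\<bar> \<le> q0 * (norm b * norm d)"
      if "norm b' \<le> norm b" "norm d' \<le> norm d" for b' d'
    proof -
      have "q0 * (norm b' * norm d') \<le> q0 * (norm b * norm d)"
        using that q0 by (intro mult_left_mono mult_mono) auto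
      with Suc[of b' d'] show ?thesis unfolding q0_def h(1) by linarith
    qed
    have P: "\<bar>T (Pz (v ?n) (tp (Y k i) b' d')) (\<psi> j)\<bar> \<le> q0 * (norm b * norm d) + \<epsilon> * h * B"
      if "norm b' \<le> norm b" "norm d' \<le> norm d" for b' d'
      using o[OF that, of i] IH[OF that] unfolding T_diff by linarith
    obtain b1 d1 b2 d2 where a: "norm b1 \<le> norm b" "norm d1 \<le> norm d" "norm b2 \<le> norm b" "norm d2 \<le> norm d"
      "3 *\<^sub>R Pz (v ?n) (tp (Pz (v ?n) (Y k i)) b d)
        = Pz (v ?n) (tp (Y k i) b d) + Pz (v ?n) (tp (Y k i) b1 d1) + Pz (v ?n) (tp (Y k i) b2 d2)"
      by (rule Pz_tp_Pz_average[OF tripotent_v])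
    obtain s :: real where s: "Y k (Suc i) = s *\<^sub>R v ?n + Pz (v ?n) (Y k i)" by (rule Y_Suc)
    have "Pz (v ?n) (tp (Y k (Suc i)) b d) = Pz (v ?n) (tp (Pz (v ?n) (Y k i)) b d)"
      unfolding s by (simp add: tp_linear linear_add[OF linear_Pz] linear_scale[OF linear_Pz]
          Pz_tp_tripotent[OF tripotent_v])
    hence "3 * T (Pz (v ?n) (tp (Y k (Suc i)) b d)) (\<psi> j)
        = T (3 *\<^sub>R Pz (v ?n) (tp (Pz (v ?n) (Y k i)) b d)) (\<psi> j)" by (simp add: T_scaleR)
    also have "\<dots> = T (Pz (v ?n) (tp (Y k i) b d)) (\<psi> j) + T (Pz (v ?n) (tp (Y k i) b1 d1)) (\<psi> j)
        + T (Pz (v ?n) (tp (Y k i) b2 d2)) (\<psi> j)" unfolding a(5) by (simp add: T_add)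
    finally have "\<bar>T (Pz (v ?n) (tp (Y k (Suc i)) b d)) (\<psi> j)\<bar> \<le> q0 * (norm b * norm d) + \<epsilon> * h * B"
      using P[of b d] P[OF a(1,2)] P[OF a(3,4)] by linarith
    with o[of b d "Suc i"] have "\<bar>T (tp (Y k (Suc i)) b d) (\<psi> j)\<bar> \<le> q0 * (norm b * norm d) + 2 * (\<epsilon> * h * B)"
      unfolding T_diff by linarith
    also have "\<dots> = 2 * Ktp * \<epsilon> * ((1/2) ^ k - h) * (norm b * norm d)"
      by (simp add: q0_def B_def algebra_simps)
    finally show ?case unfolding h(2) .
  qed simp
  also have "\<dots> \<le> 2 * Ktp * \<epsilon> * (1/2) ^ k * (norm b * norm d)"
    using K eps_pos by (intro mult_right_mono mult_left_mono) auto
  finally show ?thesis .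
qed

section \<open>The inner ideal annihilated by the sequence\<close>

definition N :: "'m set" where "N = {a. \<forall>j b d. T (tp a b d) (\<psi> j) = 0}"

lemma subspace_N: "subspace N"
  by (auto simp: subspace_def N_def tp_add1 tp_scaleR1 T_add T_scaleR)

lemma N_inner_ideal:
  assumes x: "x \<in> N" and a: "a \<in> N"
  shows "tp x y a \<in> N"
  unfolding N_def
proof (intro CollectI allI)
  fix j b d
  have "tp (tp x y a) b d = tp x y (tp a b d) + tp a (tp y x b) d - tp a b (tp x y d)"
    using jordan[of x y a b d] by simp
  thus "T (tp (tp x y a) b d) (\<psi> j) = 0" using x a by (simp add: N_def T_add T_diff)
qed

lemma N_wlim:
  assumes U: "ultrafilter U" and x: "wlim U x m" and N: "\<And>i. x i \<in> N"
  shows "m \<in> N"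
  unfolding N_def
proof (intro CollectI allI)
  fix j b d
  have "((\<lambda>i. T (tp (x i) b d) (\<psi> j)) \<longlongrightarrow> T (tp m b d) (\<psi> j)) U"
    using wlim_compose[OF weak_star_cont_tp1 x] by (simp add: wlim_def)
  moreover have "T (tp (x i) b d) (\<psi> j) = 0" for i using N[of i] by (simp add: N_def)
  ultimately have "((\<lambda>i. 0) \<longlongrightarrow> T (tp m b d) (\<psi> j)) U" by simp
  moreover have "U \<noteq> bot" using U by (simp add: ultrafilter_def)
  ultimately show "T (tp m b d) (\<psi> j) = 0" by (simp add: tendsto_const_iff)
qed

lemma norm_attained_on_N:
  obtains x0 where "x0 \<in> N" "norm x0 \<le> 1" "\<And>x. x \<in> N \<Longrightarrow> T x \<rho> \<le> T x0 \<rho> * norm x"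
proof -
  define S where "S = N \<inter> cball 0 1"
  have S0: "S \<noteq> {}" using subspace_0[OF subspace_N] by (auto simp: S_def)
  have bdd: "bdd_above ((\<lambda>x. T x \<rho>) ` S)"
  proof (rule bdd_aboveI2[where M = "norm \<rho>"])
    fix x assume "x \<in> S"
    hence "norm x * norm \<rho> \<le> norm \<rho>" by (intro mult_left_le_one_le) (auto simp: S_def)
    with T_le[of x \<rho>] show "T x \<rho> \<le> norm \<rho>" by linarith
  qed
  define s where "s = (SUP x\<in>S. T x \<rho>)"
  have "\<exists>x. x \<in> S \<and> s - inverse (real (Suc n)) < T x \<rho>" for n
  proof -
    have "s - inverse (real (Suc n)) < s" by simp
    thus ?thesis unfolding s_def using less_cSUP_iff[OF S0 bdd] by blast
  qed
  then obtain x where x: "\<And>n. x n \<in> S" "\<And>n. s - inverse (real (Suc n)) < T (x n) \<rho>" by metis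
  have xn: "norm (x n) \<le> 1" "x n \<in> N" for n using x(1)[of n] by (auto simp: S_def)
  obtain U :: "nat filter" where U: "ultrafilter U" "U \<le> sequentially"
    using ultrafilter_exists[of sequentially] by auto
  obtain x0 where x0: "wlim U x x0" "norm x0 \<le> 1" using wlim_exists[OF U(1), of x 1] xn by auto
  have N0: "x0 \<in> N" by (rule N_wlim[OF U(1) x0(1) xn(2)])
  have "s \<le> T x0 \<rho>"
  proof (rule ultrafilter_limit_le[OF U(1)])
    have "(\<lambda>n. s - inverse (real (Suc n))) \<longlonglongrightarrow> s - 0"
      by (intro tendsto_diff tendsto_const LIMSEQ_inverse_real_of_nat)
    thus "((\<lambda>n. s - inverse (real (Suc n))) \<longlongrightarrow> s) U" using U(2) by (auto intro: tendsto_mono)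
    show "((\<lambda>n. T (x n) \<rho>) \<longlongrightarrow> T x0 \<rho>) U" using x0(1) by (simp add: wlim_def)
    show "\<forall>\<^sub>F n in U. s - inverse (real (Suc n)) \<le> T (x n) \<rho>" using x(2) by (simp add: less_imp_le)
  qed
  hence max: "T y \<rho> \<le> T x0 \<rho>" if "y \<in> N" "norm y \<le> 1" for y
    using cSUP_upper[OF _ bdd, of y] that by (simp add: s_def S_def)
  have "T y \<rho> \<le> T x0 \<rho> * norm y" if y: "y \<in> N" for y
  proof (cases "y = 0")
    case False
    have "T ((1 / norm y) *\<^sub>R y) \<rho> \<le> T x0 \<rho>"
      using False y by (intro max subspace_scale[OF subspace_N]) auto
    thus ?thesis using False by (simp add: T_scaleR field_simps)
  qed simp
  with N0 x0(2) that show ?thesis by blast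
qed

text \<open>\<open>\<rho>\<close> attains its norm over the unit ball of \<open>N\<close>, and the
  odd powers of a maximizer lead to a tripotent \<open>f\<close> in \<open>N\<close>. The
  Hahn-Banach extension \<open>l\<close> may lie outside the predual, so the limit of the powers is
  evaluated at \<open>\<rho>\<close> itself; \<open>l\<close> supplies the identities for norming
  functionals, in particular \<open>l (Pz f a) = l (tp f (Pz f a) f) = 0\<close>.\<close>

lemma support_tripotent_in_N:
  obtains f where "tripotent f" "\<And>a. a \<in> N \<Longrightarrow> T (Pz f a) \<rho> = 0" "\<And>a j. T (Pz f a) (\<psi> j) = T a (\<psi> j)"
proof -
  obtain x0 where x0: "x0 \<in> N" "norm x0 \<le> 1" "\<And>x. x \<in> N \<Longrightarrow> T x \<rho> \<le> T x0 \<rho> * norm x"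
    using norm_attained_on_N by metis
  define s where "s = T x0 \<rho>"
  have s0: "0 \<le> s"
  proof (rule ccontr)
    assume n: "\<not> 0 \<le> s"
    hence "s * norm x0 \<le> 0" by (intro mult_nonpos_nonneg) auto
    moreover have "- s \<le> s * norm x0"
      using x0(3)[OF subspace_neg[OF subspace_N x0(1)]] by (simp add: s_def T_minus)
    ultimately show False using n by linarith
  qed
  show ?thesis
  proof (cases "s = 0")
    case True
    have "T a \<rho> = 0" if "a \<in> N" for a
      using x0(3)[OF that] x0(3)[OF subspace_neg[OF subspace_N that]] True by (simp add: s_def T_minus)
    \<comment> \<open>If \<open>\<rho>\<close> vanishes on \<open>N\<close>, the tripotent 0 works,
      because \<open>Pz 0\<close> is the identity.\<close>
    thus ?thesis using that[of 0] by (simp add: tripotent_def Pz_def)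
  next
    case False
    hence s: "s > 0" using s0 by simp
    obtain g where g: "linear g" "\<And>x. g x \<le> s * norm x" "\<And>x. x \<in> N \<Longrightarrow> g x = T x \<rho>"
    proof (rule hahn_banach_subspace[OF sublinear_norm_scaled[OF s0] subspace_N linear_ident, of "\<lambda>x. T x \<rho>"])
      show "linear (\<lambda>x. T x \<rho>)" by (rule linearI) (simp_all add: T_add T_scaleR)
      show "T x \<rho> \<le> s * norm x" if "x \<in> N" for x using x0(3)[OF that] by (simp add: s_def)
    qed blast
    obtain l1 :: "'m \<Rightarrow>\<^sub>L real" where l1: "\<And>x. l1 x = g x" "norm l1 \<le> s"
      using blinfun_of_dominated[OF g(1,2) s0] by blast
    define l where "l = (1 / s) *\<^sub>R l1"
    have l: "l x = g x / s" for x by (simp add: l_def blinfun.scaleR_left l1)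
    have nl: "norm l \<le> 1" using l1(2) s by (simp add: l_def)
    have lx0: "norming l x0"
      using nl x0(2) s g(3)[OF x0(1)] by (intro normingI) (simp_all add: l s_def)
    hence nx0: "norm x0 = 1" by (rule normingD)
    obtain f where f: "tripotent f" "norm f \<le> 1" "\<And>p t. (\<And>j. T (pw x0 j) p = t) \<Longrightarrow> T f p = t"
      using exists_support_tripotent[OF nx0] by metis
    have pwN: "pw x0 j \<in> N" for j
      by (induction j) (use x0(1) N_inner_ideal in auto)
    have fN: "f \<in> N"
      unfolding N_def
    proof (intro CollectI allI)
      fix j b d
      obtain p' where p': "\<And>x. T (tp x b d) (\<psi> j) = T x p'"
        using weak_star_cont_tp1[of b d] unfolding weak_star_cont_def by metis
      have "T (pw x0 i) p' = 0" for i using pwN[of i] unfolding p'[symmetric] by (simp add: N_def)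
      hence "T f p' = 0" by (rule f(3))
      thus "T (tp f b d) (\<psi> j) = 0" using p' by simp
    qed
    have "T (pw x0 j) \<rho> = s" for j
      using norming_pw[OF lx0, of j] g(3)[OF pwN[of j]] s by (simp add: l)
    hence "T f \<rho> = s" by (rule f(3))
    hence lf: "norming l f" using nl f(2) s g(3)[OF fN] by (intro normingI) (simp_all add: l)
    show ?thesis
    proof (rule that[OF f(1)])
      fix a assume a: "a \<in> N"
      have "tp f f b \<in> N" if "b \<in> N" for b by (rule N_inner_ideal[OF fN that])
      hence "Pz f a \<in> N" unfolding Pz_def using a
        by (intro subspace_add[OF subspace_N] subspace_diff[OF subspace_N] subspace_scale[OF subspace_N]) auto
      moreover have "l (Pz f a) = 0"
        using norming_tp_fixed(2)[OF lf, of "Pz f a"] tp_tripotent_Pz[OF f(1), of a] by (simp add: blinfun.zero_right)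
      ultimately show "T (Pz f a) \<rho> = 0" using g(3) s by (simp add: l)
    next
      fix a j
      show "T (Pz f a) (\<psi> j) = T a (\<psi> j)"
        using fN by (simp add: Pz_def N_def T_add T_diff T_scaleR)
    qed
  qed
qed

lemma cluster_point_far:
  assumes z: "z \<in> clust_wstar \<psi>"
  shows "c - 2 * \<epsilon> \<le> infdist z (range canon)"
proof -
  obtain U :: "nat filter" where U: "ultrafilter U" "U \<le> sequentially"
    using ultrafilter_exists[of sequentially] by auto
  have evU: "eventually P U" if "\<And>n. n \<ge> (n0::nat) \<Longrightarrow> P n" for P n0
    using filter_leD[OF U(2), of P] that unfolding eventually_sequentially by blast
  have "\<exists>y. wlim U (Y k) y \<and> norm y \<le> 1" for k
  proof -
    have "eventually (\<lambda>i. norm (Y k i) \<le> 1) U" by (simp add: norm_Y_le)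
    from wlim_exists[OF U(1) this] show ?thesis by blast
  qed
  then obtain y where y: "\<And>k. wlim U (Y k) (y k)" "\<And>k. norm (y k) \<le> 1" by metis
  have y_lower: "c - 2 * \<epsilon> \<le> \<bar>T (y k) (\<psi> j)\<bar>" if "k < j" for k j
  proof (rule ultrafilter_limit_le[OF U(1) tendsto_const])
    show "((\<lambda>i. \<bar>T (Y k i) (\<psi> j)\<bar>) \<longlongrightarrow> \<bar>T (y k) (\<psi> j)\<bar>) U"
      using y(1)[of k] by (intro tendsto_rabs) (simp add: wlim_def)
    show "\<forall>\<^sub>F i in U. c - 2 * \<epsilon> \<le> \<bar>T (Y k i) (\<psi> j)\<bar>"
      by (rule evU[of j]) (use that Y_lower in simp)
  qed
  have y_ideal: "\<bar>T (tp (y k) b d) (\<psi> j)\<bar> \<le> 2 * Ktp * \<epsilon> * (1/2) ^ k * (norm b * norm d)" if "j \<le> k" for j k b d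
  proof (rule ultrafilter_limit_le[OF U(1) _ tendsto_const])
    have "wlim U (\<lambda>i. tp (Y k i) b d) (tp (y k) b d)" by (rule wlim_compose[OF weak_star_cont_tp1 y(1)])
    thus "((\<lambda>i. \<bar>T (tp (Y k i) b d) (\<psi> j)\<bar>) \<longlongrightarrow> \<bar>T (tp (y k) b d) (\<psi> j)\<bar>) U"
      by (intro tendsto_rabs) (simp add: wlim_def)
    show "\<forall>\<^sub>F i in U. \<bar>T (tp (Y k i) b d) (\<psi> j)\<bar> \<le> 2 * Ktp * \<epsilon> * (1/2) ^ k * (norm b * norm d)"
      using Y_ideal[OF that] by simp
  qed
  \<comment> \<open>A second limit is needed, since \<open>y k\<close> satisfies the equations
    defining \<open>N\<close> only up to a multiple of \<open>(1/2) ^ k\<close> and only for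
    \<open>j \<le> k\<close>.\<close>
  obtain y0 where y0: "wlim U y y0" using wlim_exists[OF U(1), of y 1] y(2) by auto
  have "y0 \<in> N"
    unfolding N_def
  proof (intro CollectI allI)
    fix j b d
    have l1: "((\<lambda>k. \<bar>T (tp (y k) b d) (\<psi> j)\<bar>) \<longlongrightarrow> \<bar>T (tp y0 b d) (\<psi> j)\<bar>) U"
      using wlim_compose[OF weak_star_cont_tp1 y0, of b d] by (intro tendsto_rabs) (simp add: wlim_def)
    have "(\<lambda>k. 2 * Ktp * \<epsilon> * (1/2) ^ k * (norm b * norm d)) \<longlonglongrightarrow> 2 * Ktp * \<epsilon> * 0 * (norm b * norm d)"
      by (intro tendsto_mult tendsto_const LIMSEQ_power_zero) simp
    hence "((\<lambda>k. 2 * Ktp * \<epsilon> * (1/2) ^ k * (norm b * norm d)) \<longlongrightarrow> 0) U"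
      using U(2) by (auto intro: tendsto_mono)
    hence "\<bar>T (tp y0 b d) (\<psi> j)\<bar> \<le> 0"
      by (rule ultrafilter_limit_le[OF U(1) l1]) (rule evU[of j], rule y_ideal)
    thus "T (tp y0 b d) (\<psi> j) = 0" by simp
  qed
  have main: "c - 2 * \<epsilon> \<le> dist z (canon \<rho>)" for \<rho>
  proof -
    obtain f where f: "tripotent f" "\<And>a. a \<in> N \<Longrightarrow> T (Pz f a) \<rho> = 0" "\<And>a j. T (Pz f a) (\<psi> j) = T a (\<psi> j)"
      using support_tripotent_in_N by metis
    \<comment> \<open>For fixed k the functionals after the k-th take the same values at
      \<open>y k\<close> and \<open>Pz f (y k)\<close>, so \<open>z\<close> inherits their lower
      bound. Then k runs along \<open>U\<close>, and the term with \<open>\<rho>\<close> tends to 0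
      because \<open>y0\<close> lies in \<open>N\<close>.\<close>
    have lim: "((\<lambda>k. dist z (canon \<rho>) + \<bar>T (Pz f (y k)) \<rho>\<bar>) \<longlongrightarrow> dist z (canon \<rho>) + \<bar>T (Pz f y0) \<rho>\<bar>) U"
      using wlim_compose[OF weak_star_cont_Pz y0, of f]
      by (intro tendsto_add tendsto_const tendsto_rabs) (simp add: wlim_def)
    have "c - 2 * \<epsilon> \<le> dist z (canon \<rho>) + \<bar>T (Pz f (y k)) \<rho>\<bar>" for k
    proof -
      let ?u = "T (Pz f (y k))"
      have "norm ?u \<le> 1" using norm_Pz_le[OF f(1), of "y k"] y(2)[of k] by simp
      hence "norm (z - canon \<rho>) * norm ?u \<le> norm (z - canon \<rho>)" by (intro mult_left_le) auto
      hence 1: "\<bar>z ?u - ?u \<rho>\<bar> \<le> dist z (canon \<rho>)"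
        using norm_blinfun[of "z - canon \<rho>" ?u] by (simp add: blinfun.diff_left dist_norm)
      have "c - 2 * \<epsilon> \<le> \<bar>z ?u\<bar>"
        by (rule clust_wstar_lower_bound[OF z, of "Suc k"]) (use y_lower[of k] f(3) in simp)
      with 1 show ?thesis by linarith
    qed
    hence "c - 2 * \<epsilon> \<le> dist z (canon \<rho>) + \<bar>T (Pz f y0) \<rho>\<bar>"
      by (intro ultrafilter_limit_le[OF U(1) tendsto_const lim]) simp
    thus ?thesis using f(2)[OF \<open>y0 \<in> N\<close>] by simp
  qed
  show ?thesis unfolding infdist_def using main by (auto intro!: cINF_greatest)
qed

end

text \<open>Dependent choice: the n-th condition refers only to functionals chosen earlier.\<close>

lemma (in jbw_triple) exists_almost_orthogonal_sequence:
  assumes A: "bounded A" "A \<noteq> {}" and c: "0 \<le> c" "c < deBlasi A" and \<epsilon>: "\<epsilon> > 0"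
  obtains \<psi> v where "range \<psi> \<subseteq> A" "almost_orthogonal_sequence Jm tp Jp T \<psi> v c \<epsilon>"
proof -
  define P where "P f n r \<longleftrightarrow> fst r \<in> A \<and> tripotent (snd r) \<and> c \<le> T (snd r) (fst r) \<and>
      (\<forall>j<n. \<forall>x. \<bar>T (x - Pz (snd r) x) (fst (f j))\<bar> \<le> \<epsilon> * (1/2) ^ n * norm x)"
    for f :: "nat \<Rightarrow> 'p \<times> 'm" and n :: nat and r :: "'p \<times> 'm"
  have "\<exists>f. \<forall>n. P f n (f n)"
  proof (rule dependent_wf_choice[OF wf_less])
    fix f g :: "nat \<Rightarrow> 'p \<times> 'm" and n :: nat and r
    assume "\<And>j. (j, n) \<in> {(x, y). x < y} \<Longrightarrow> f j = g j"
    thus "P f n r = P g n r" by (simp add: P_def)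
  next
    fix n :: nat and f :: "nat \<Rightarrow> 'p \<times> 'm"
    have "\<epsilon> * (1/2) ^ n > 0" using \<epsilon> by simp
    then obtain \<psi>' v where "\<psi>' \<in> A" "tripotent v" "c \<le> T v \<psi>'"
      "\<And>j x. j < n \<Longrightarrow> \<bar>T (x - Pz v x) (fst (f j))\<bar> \<le> \<epsilon> * (1/2) ^ n * norm x"
      using next_tripotent[OF A c, of "\<epsilon> * (1/2) ^ n" n "\<lambda>j. fst (f j)"] by metis
    hence "P f n (\<psi>', v)" by (simp add: P_def)
    thus "\<exists>r. P f n r" by blast
  qed
  then obtain f where f: "\<And>n. P f n (f n)" by blast
  show ?thesis
  proof (rule that[of "\<lambda>n. fst (f n)" "\<lambda>n. snd (f n)"])
    show "range (\<lambda>n. fst (f n)) \<subseteq> A" using f by (auto simp: P_def)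
    show "almost_orthogonal_sequence Jm tp Jp T (\<lambda>n. fst (f n)) (\<lambda>n. snd (f n)) c \<epsilon>"
      by unfold_locales (use f c \<epsilon> in \<open>auto simp: P_def\<close>)
  qed
qed

theorem theorem4p1:
  fixes Jm :: "'m::banach \<Rightarrow> 'm" and tp :: "'m \<Rightarrow> 'm \<Rightarrow> 'm \<Rightarrow> 'm"
    and Jp :: "'p::banach \<Rightarrow> 'p" and T :: "'m \<Rightarrow> ('p \<Rightarrow>\<^sub>L real)"
    and A :: "'p set"
  assumes "JBW_triple_with_predual Jm tp Jp T"
    and "bounded A"
  shows "deBlasi A = wk_meas A \<and> wk_meas A = wck_meas A"
proof -
  have JB: "JB_triple Jm tp" and iso: "predual_iso Jm Jp T"
    using assms(1) by (simp_all add: JBW_triple_with_predual_def)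
  have "complex_structure Jm" by (rule conjunct1[OF JB[unfolded JB_triple_def]])
  then interpret jbw_triple Jm tp Jp T
    using JB iso by unfold_locales
  show ?thesis
  proof (rule measures_equalI[OF assms(2)])
    fix c e :: real assume c: "0 \<le> c" "c < deBlasi A" and e: "e > 0" and A: "A \<noteq> {}"
    \<comment> \<open>The slack is halved because \<open>cluster_point_far\<close> loses it
      twice.\<close>
    obtain \<psi> v where \<psi>: "range \<psi> \<subseteq> A" "almost_orthogonal_sequence Jm tp Jp T \<psi> v c (e / 2)"
      using exists_almost_orthogonal_sequence[OF assms(2) A c, of "e / 2"] e by auto
    interpret almost_orthogonal_sequence Jm tp Jp T \<psi> v c "e / 2" by (rule \<psi>(2))
    show "\<exists>x. range x \<subseteq> A \<and> (\<forall>z\<in>clust_wstar x. c - e \<le> infdist z (range canon))"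
      using \<psi>(1) cluster_point_far by auto
  qed
qed

end
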